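(* Let $f$ and $g$ be nonlinearizable germs (of the form $e^{2\pi i\alpha}z+O(z^2)$ with irrational rotation number) having a common hedgehog $K$. Then $f\circ g = g\circ f$. In particular, if $f$ and $g$ have the same germ of hedgehog, $[\mathcal{K}(f)] = [\mathcal{K}(g)]$ (so that all sufficiently small hedgehogs of one are hedgehogs of the other), then $f$ and $g$ commute.
   Context: A germ $f(z)=e^{2\pi i\alpha}z+O(z^2)$ with $\alpha\in\mathbb{R}\setminus\mathbb{Q}$ is linearizable if there is a holomorphic $h(w)=w+O(w^2)$ with $h^{-1}\circ f\circ h=R_\alpha$, $R_\alpha(w)=e^{2\pi i\alpha}w$; otherwise nonlinearizable. A Siegel compact of $f$ is a full, connected, compact $K\subset\mathbb{C}$ with $0\in K$, $K\ne\{0\}$, such that $f,f^{-1}$ extend univalently to a neighbourhood of $K$ and $f(K)=f^{-1}(K)=K$; a hedgehog is a Siegel compact not contained in the closure of a linearization domain (for nonlinearizable $f$, every Siegel compact is a hedgehog). $\mathcal{K}(f)$ is the family of all Siegel compacta of $f$. For families $\mathcal{K}$ of compacta containing $0$ with members of arbitrarily small diameter, $\mathcal{K}_1\sim\mathcal{K}_2$ if there is $\epsilon>0$ such that every compact of diameter $<\epsilon$ lies in $\mathcal{K}_1$ iff it lies in $\mathcal{K}_2$; the class $[\mathcal{K}(f)]$ is the germ of hedgehog of $f$. *)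

theory Defs
  imports "HOL-Analysis.Analysis"
begin

text \<open>A germ at 0 is represented by a function holomorphic on some disc about 0;
two functions represent the same germ when they agree eventually near 0.\<close>

definition rot :: "real \<Rightarrow> complex" where
  "rot \<alpha> = exp (2 * pi * \<i> * complex_of_real \<alpha>)"

definition irrational_germ :: "(complex \<Rightarrow> complex) \<Rightarrow> real \<Rightarrow> bool" where
  "irrational_germ f \<alpha> \<longleftrightarrow> \<alpha> \<notin> \<rat> \<and>
     (\<exists>r>0. f holomorphic_on ball 0 r) \<and> f 0 = 0 \<and> deriv f 0 = rot \<alpha>"

definition linearizable :: "(complex \<Rightarrow> complex) \<Rightarrow> real \<Rightarrow> bool" where
  "linearizable f \<alpha> \<longleftrightarrow> (\<exists>h r. r > 0 \<and> h holomorphic_on ball 0 r \<and> h 0 = 0 \<and> deriv h 0 = 1 \<and>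
     (\<forall>\<^sub>F w in nhds 0. f (h w) = h (rot \<alpha> * w)))"

definition nonlinearizable :: "(complex \<Rightarrow> complex) \<Rightarrow> real \<Rightarrow> bool" where
  "nonlinearizable f \<alpha> \<longleftrightarrow> irrational_germ f \<alpha> \<and> \<not> linearizable f \<alpha>"

text \<open>Siegel compact: full, connected, compact, contains 0, not {0}; f extends univalently
(holomorphic and injective) to an open neighbourhood U of K with F(K) = K; then the inverse
F^{-1} is univalent on the open neighbourhood F(U) of K and maps K onto K.\<close>

definition siegel_compact :: "(complex \<Rightarrow> complex) \<Rightarrow> complex set \<Rightarrow> bool" where
  "siegel_compact f K \<longleftrightarrow> compact K \<and> connected K \<and> connected (- K) \<and> 0 \<in> K \<and> K \<noteq> {0} \<and>
     (\<exists>U F. open U \<and> K \<subseteq> U \<and> F holomorphic_on U \<and> inj_on F U \<and>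
        (\<forall>\<^sub>F z in nhds 0. F z = f z) \<and> F ` K = K)"

definition linearization_domain :: "(complex \<Rightarrow> complex) \<Rightarrow> real \<Rightarrow> complex set \<Rightarrow> bool" where
  "linearization_domain f \<alpha> D \<longleftrightarrow> (\<exists>S h F. (S = UNIV \<or> (\<exists>r>0. S = ball 0 r)) \<and>
     h holomorphic_on S \<and> inj_on h S \<and> h 0 = 0 \<and> deriv h 0 = 1 \<and> h ` S = D \<and>
     F holomorphic_on D \<and> (\<forall>\<^sub>F z in nhds 0. F z = f z) \<and>
     (\<forall>w\<in>S. F (h w) = h (rot \<alpha> * w)))"

definition hedgehog :: "(complex \<Rightarrow> complex) \<Rightarrow> real \<Rightarrow> complex set \<Rightarrow> bool" where
  "hedgehog f \<alpha> K \<longleftrightarrow> siegel_compact f K \<and> \<not> (\<exists>D. linearization_domain f \<alpha> D \<and> K \<subseteq> closure D)"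

definition same_hedgehog_germ :: "(complex \<Rightarrow> complex) \<Rightarrow> (complex \<Rightarrow> complex) \<Rightarrow> bool" where
  "same_hedgehog_germ f g \<longleftrightarrow> (\<exists>\<epsilon>>0. \<forall>K::complex set. compact K \<and> 0 \<in> K \<and> diameter K < \<epsilon> \<longrightarrow>
      (siegel_compact f K \<longleftrightarrow> siegel_compact g K))"

definition germs_commute :: "(complex \<Rightarrow> complex) \<Rightarrow> (complex \<Rightarrow> complex) \<Rightarrow> bool" where
  "germs_commute f g \<longleftrightarrow> (\<forall>\<^sub>F z in nhds 0. f (g z) = g (f z))"

end

theory Submission
  imports Defs "HOL-Complex_Analysis.Complex_Analysis"
begin

text \<open>
Let \<open>K\<close> be a common Siegel compact of \<open>f\<close> and \<open>g\<close>. The commutator of \<open>f\<close> and \<open>g\<close> preserves \<open>K\<close>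
and has the form \<open>h(z) = z + a z\<^sup>m\<^sup>+\<^sup>1 + \<dots>\<close>. Suppose \<open>a \<noteq> 0\<close>. The local symmetries of \<open>K\<close> of the
form \<open>z + s z\<^sup>m\<^sup>+\<^sup>1 + \<dots>\<close> give an additive group of shifts \<open>s\<close>, which is invariant under multiplication
by \<open>(rot \<alpha>)\<^sup>m\<close>, so it contains arbitrarily small shifts in all directions. Moving points of \<open>K\<close>
by these shifts approximates every \<open>z\<close> near 0 by points of \<open>K\<close> up to \<open>o(z\<^sup>m\<^sup>+\<^sup>1)\<close>; pulling these points back
along the attracting orbits of \<open>h\<close> puts a neighbourhood of 0 into \<open>K\<close>. The iterates of \<open>h\<close> are then
uniformly bounded near 0, although their coefficients \<open>n a\<close> of order \<open>m + 1\<close> are not.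

For the second claim it remains to find small Siegel compacta of \<open>f\<close>: the maximal invariant
continuum of \<open>f\<close> in a small closed disc always reaches the bounding circle. For a root of unity as
multiplier, a continuum inside the open disc would give, through the Riemann map of its exterior,
an analytic circle diffeomorphism induced by an iterate tangent to the identity; it has a fixed point
by the argument principle, and
orbits between two fixed points shadow the continuum and enlarge it. The irrational case follows
by approximating the multiplier and passing to the limit.
\<close>

text \<open>The order m + 1 of the approximation is, up to a constant, the length of one step of h
  at z. Hence a point of K can replace a late point of an attracting orbit with an error that is a
  small fraction of the step there. Such a fraction survives the way back: each step changes the
  ratio of error to step length by a factor 1 + O(step length), and orbits in the attracting cone
  have finite total length. The same estimate serves again for the map induced on the circle of
  prime ends of K: between two adjacent fixed points its orbits are monotone, hence of finite
  length, so nearby complex orbits stay close to the circle for ever. This is why fixed points on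
  the circle are needed. They exist because the iterate tangent to the identity has multiplicity at
  least 2 at 0, whereas in the absence of boundary fixed points the argument principle counts a
  single fixed point near K, with multiplicity. Multiplicity is available only for roots of unity,
  which is why these come before irrational multipliers.\<close>

section \<open>Distortion along orbits and the approximate Fatou coordinate\<close>

text \<open>Both \<open>y n\<close> and \<open>x (Suc n)\<close> are regarded as perturbations of
  \<open>x n\<close>, which \<open>\<Phi>\<close> multiplies by the same \<open>D n\<close> up to
  quadratic errors. Eliminating \<open>D n\<close> shows that the ratio of
  \<open>cmod (y n - x n)\<close> to the step at \<open>n\<close> grows by a factor at most
  \<open>1 + 2 * C * M * d n\<close>; the product of these factors is at most the exponential of the
  total length. Assumption \<open>low\<close> allows quadratic errors to be charged to the next
  step.\<close>

lemma orbit_distortion: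
  fixes \<Phi> :: "complex \<Rightarrow> complex" and x y D :: "nat \<Rightarrow> complex"
  assumes x: "\<And>n. n \<le> N \<Longrightarrow> x (Suc n) = \<Phi> (x n)"
    and y: "\<And>n. n < N \<Longrightarrow> y (Suc n) = \<Phi> (y n)"
    and taylor: "\<And>n w. n < N \<Longrightarrow> cmod (w - x n) \<le> r \<or> w = x (Suc n) \<Longrightarrow>
      cmod (\<Phi> w - \<Phi> (x n) - D n * (w - x n)) \<le> C * (cmod (w - x n))\<^sup>2"
    and low: "\<And>n. n < N \<Longrightarrow> cmod (x (Suc n) - x n) \<le> M * cmod (x (Suc (Suc n)) - x (Suc n))"
    and sum: "(\<Sum>k<N. cmod (x (Suc k) - x k)) \<le> L"
    and nn: "0 \<le> \<kappa>" "0 \<le> C" "0 \<le> M"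
    and small: "\<kappa> * exp (2 * C * M * L) \<le> 1"
    and rad: "\<And>n. n < N \<Longrightarrow> \<kappa> * exp (2 * C * M * L) * cmod (x (Suc n) - x n) \<le> r"
    and start: "cmod (y 0 - x 0) \<le> \<kappa> * cmod (x 1 - x 0)"
    and n: "n \<le> N"
  shows "cmod (y n - x n) \<le> \<kappa> * exp (2 * C * M * L) * cmod (x (Suc n) - x n)"
proof -
  define d where "d n = cmod (x (Suc n) - x n)" for n
  define S where "S n = (\<Sum>k<n. d k)" for n
  have S_le: "S n \<le> L" if "n \<le> N" for n
  proof -
    have "S n \<le> (\<Sum>k<N. d k)"
      unfolding S_def by (rule sum_mono2) (use that in \<open>auto simp: d_def\<close>)
    then show ?thesis using sum by (simp add: d_def)
  qed
  have e_le: "\<kappa> * exp (2 * C * M * S n) \<le> \<kappa> * exp (2 * C * M * L)" if "n \<le> N" for n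
    using S_le[OF that] nn by (intro mult_left_mono) (auto intro!: mult_left_mono)
  have "n \<le> N \<Longrightarrow> cmod (y n - x n) \<le> \<kappa> * exp (2 * C * M * S n) * d n" for n
  proof (induction n)
    case 0
    then show ?case using start by (simp add: S_def d_def)
  next
    case (Suc n)
    define k where "k = \<kappa> * exp (2 * C * M * S n)"
    define \<delta> where "\<delta> = cmod (y n - x n)"
    have n: "n < N" "n \<le> N" using Suc by auto
    have k: "0 \<le> k" "k \<le> 1" "k * d n \<le> r"
      using e_le[OF n(2)] small nn rad[OF n(1)] mult_right_mono[OF e_le[OF n(2)], of "d n"]
      by (auto simp: k_def d_def)
    have IH: "\<delta> \<le> k * d n" using Suc n by (simp add: k_def \<delta>_def)
    have dn: "0 \<le> d n" "0 \<le> \<delta>" by (auto simp: d_def \<delta>_def)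
    have t1: "cmod (\<Phi> (y n) - \<Phi> (x n) - D n * (y n - x n)) \<le> C * \<delta>\<^sup>2"
      using taylor[OF n(1), of "y n"] IH k by (simp add: \<delta>_def)
    have t2: "cmod (\<Phi> (x (Suc n)) - \<Phi> (x n) - D n * (x (Suc n) - x n)) \<le> C * (d n)\<^sup>2"
      using taylor[OF n(1), of "x (Suc n)"] by (simp add: d_def)
    have a1: "cmod (y (Suc n) - x (Suc n)) \<le> cmod (D n) * \<delta> + C * \<delta>\<^sup>2"
    proof -
      have "y (Suc n) - x (Suc n) = D n * (y n - x n) + (\<Phi> (y n) - \<Phi> (x n) - D n * (y n - x n))"
        using x[OF n(2)] y[OF n(1)] by simp
      then have "cmod (y (Suc n) - x (Suc n)) \<le> cmod (D n * (y n - x n)) + cmod (\<Phi> (y n) - \<Phi> (x n) - D n * (y n - x n))"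
        by (metis norm_triangle_ineq)
      then show ?thesis using t1 by (simp add: norm_mult \<delta>_def)
    qed
    \<comment> \<open>Taylor's formula at \<open>w = x (Suc n)\<close> is read backwards: the next
      step of the orbit bounds \<open>cmod (D n) * d n\<close>.\<close>
    have a2: "cmod (D n) * d n \<le> d (Suc n) + C * (d n)\<^sup>2"
    proof -
      have "D n * (x (Suc n) - x n) = (x (Suc (Suc n)) - x (Suc n)) - (\<Phi> (x (Suc n)) - \<Phi> (x n) - D n * (x (Suc n) - x n))"
        using x[OF n(2)] x[of "Suc n"] Suc.prems by simp
      then have "cmod (D n * (x (Suc n) - x n)) \<le> cmod (x (Suc (Suc n)) - x (Suc n)) + cmod (\<Phi> (x (Suc n)) - \<Phi> (x n) - D n * (x (Suc n) - x n))"
        by (metis norm_triangle_ineq4)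
      then show ?thesis using t2 by (simp add: norm_mult d_def)
    qed
    have "cmod (D n) * \<delta> \<le> k * (cmod (D n) * d n)"
      using mult_left_mono[OF IH, of "cmod (D n)"] by (simp add: algebra_simps)
    also have "\<dots> \<le> k * (d (Suc n) + C * (d n)\<^sup>2)"
      using a2 k by (intro mult_left_mono) auto
    finally have b1: "cmod (D n) * \<delta> \<le> k * (d (Suc n) + C * (d n)\<^sup>2)" .
    have "\<delta>\<^sup>2 \<le> (k * d n)\<^sup>2" using IH dn by (intro power_mono) auto
    also have "\<dots> \<le> k * (d n)\<^sup>2"
      using k mult_right_mono[of "k * k" k "(d n)\<^sup>2"]
      by (simp add: power_mult_distrib power2_eq_square mult_left_le mult_ac)
    finally have b2: "C * \<delta>\<^sup>2 \<le> k * (C * (d n)\<^sup>2)"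
      using nn by (metis mult.left_commute mult_left_mono)
    have "d n * d n \<le> d n * (M * d (Suc n))"
      using low[OF n(1)] dn by (intro mult_left_mono) (auto simp: d_def)
    then have b3: "C * (d n)\<^sup>2 \<le> C * M * d n * d (Suc n)"
      using nn mult_left_mono[of "d n * d n" "d n * (M * d (Suc n))" C]
      by (simp add: power2_eq_square algebra_simps)
    \<comment> \<open>The 2 collects the Taylor errors at \<open>y n\<close> and at
      \<open>x (Suc n)\<close>. Both carry the factor \<open>k\<close> because
      \<open>k \<le> 1\<close> absorbs its square.\<close>
    have "cmod (y (Suc n) - x (Suc n)) \<le> k * (d (Suc n) + 2 * (C * (d n)\<^sup>2))"
      using a1 b1 b2 by (simp add: algebra_simps)
    also have "\<dots> \<le> k * (d (Suc n) + 2 * (C * M * d n * d (Suc n)))"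
      using b3 k by (intro mult_left_mono) auto
    also have "\<dots> = k * ((1 + 2 * C * M * d n) * d (Suc n))"
      by (simp add: algebra_simps)
    also have "\<dots> \<le> k * (exp (2 * C * M * d n) * d (Suc n))"
      using k exp_ge_add_one_self[of "2 * C * M * d n"]
      by (intro mult_left_mono mult_right_mono) (auto simp: d_def)
    also have "\<dots> = \<kappa> * exp (2 * C * M * S (Suc n)) * d (Suc n)"
      by (simp add: k_def S_def algebra_simps flip: exp_add)
    finally show ?case .
  qed
  from this[OF n] e_le[OF n] show ?thesis
    by (smt (verit) d_def mult_right_mono norm_ge_zero)
qed

lemma taylor_bound_convex_compact:
  assumes "f holomorphic_on W" "open W" "Q \<subseteq> W" "compact Q" "convex Q"
  obtains C where "0 \<le> C" "\<And>x w. x \<in> Q \<Longrightarrow> w \<in> Q \<Longrightarrow>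
      cmod (f w - f x - deriv f x * (w - x)) \<le> C * (cmod (w - x))\<^sup>2"
proof -
  have h1: "deriv f holomorphic_on W" and h2: "deriv (deriv f) holomorphic_on W"
    using assms by (auto intro: holomorphic_deriv)
  have "compact (deriv (deriv f) ` Q)"
    using h2 assms by (meson compact_continuous_image continuous_on_subset holomorphic_on_imp_continuous_on)
  then obtain B where B: "\<And>z. z \<in> Q \<Longrightarrow> cmod (deriv (deriv f) z) \<le> B"
    by (metis bounded_iff compact_imp_bounded imageI)
  have "cmod (f w - f x - deriv f x * (w - x)) \<le> max 0 B * (cmod (w - x))\<^sup>2"
    if "x \<in> Q" "w \<in> Q" for x w
  proof -
    define g where "g n = (if n = 0 then f else if n = 1 then deriv f else deriv (deriv f))" for n :: nat
    have "cmod (g 0 w - (\<Sum>i\<le>1. g i x * (w - x) ^ i / fact i)) \<le> B * cmod (w - x) ^ Suc 1 / fact 1"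
    proof (rule complex_Taylor[where S = Q])
      show "(g i has_field_derivative g (Suc i) z) (at z within Q)" if "z \<in> Q" "i \<le> 1" for i z
      proof -
        have "i = 0 \<or> i = 1" using that by auto
        then show ?thesis
          using that assms h1 unfolding g_def
          by (auto intro!: DERIV_subset[OF holomorphic_derivI[of _ W]])
      qed
    qed (use assms that B in \<open>auto simp: g_def\<close>)
    then have "cmod (f w - f x - deriv f x * (w - x)) \<le> B * (cmod (w - x))\<^sup>2"
      by (simp add: g_def algebra_simps power2_eq_square)
    also have "\<dots> \<le> max 0 B * (cmod (w - x))\<^sup>2"
      by (intro mult_right_mono) auto
    finally show ?thesis .
  qed
  then show ?thesis using that[of "max 0 B"] by auto
qed

text \<open>\<open>- 1 / (of_nat m * a * z ^ m)\<close> is the leading term of the Fatou coordinate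
  of \<open>h\<close>. With \<open>h z = z * (1 + x)\<close> and \<open>x = z ^ m * b z\<close>, the
  difference is \<open>- (b z / (of_nat m * a)) * q x\<close>, where \<open>q\<close> is the
  difference quotient at 0 of \<open>1 / (1 + x) ^ m\<close>, completed by the derivative
  \<open>- of_nat m\<close>.\<close>

lemma nontangential_fatou_coordinate:
  assumes b: "isCont b 0" and b0: "b 0 = a" and a: "a \<noteq> (0::complex)" and m: "m \<ge> 1"
    and h: "\<forall>\<^sub>F z in nhds 0. h z = z + z ^ Suc m * b z"
  shows "((\<lambda>z. - 1 / (of_nat m * a * h z ^ m) + 1 / (of_nat m * a * z ^ m)) \<longlongrightarrow> 1) (at 0)"
proof -
  define q where "q x = (if x = 0 then - of_nat m else (1 / (1 + x) ^ m - 1) / (x::complex))" for x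
  have "((\<lambda>x. 1 / (1 + x) ^ m) has_field_derivative (- of_nat m)) (at (0::complex))"
    using m by (auto intro!: derivative_eq_intros)
  then have "((\<lambda>x. (1 / (1 + x) ^ m - 1) / x) \<longlongrightarrow> - of_nat m) (at (0::complex))"
    by (simp add: has_field_derivative_iff)
  then have q: "isCont q 0"
    unfolding isCont_def q_def by (simp cong: LIM_cong)
  have bb: "(b \<longlongrightarrow> a) (at 0)" using b b0 by (simp add: isCont_def)
  have "((\<lambda>z. z ^ m * b z) \<longlongrightarrow> 0 ^ m * a) (at 0)"
    by (intro tendsto_intros bb)
  then have lim0: "((\<lambda>z. z ^ m * b z) \<longlongrightarrow> 0) (at 0)"
    using m by (cases m) auto
  have "((\<lambda>z. q (z ^ m * b z)) \<longlongrightarrow> q 0) (at 0)"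
    by (rule isCont_tendsto_compose[OF q lim0])
  then have lim: "((\<lambda>z. - (b z / (of_nat m * a)) * q (z ^ m * b z)) \<longlongrightarrow> - (a / (of_nat m * a)) * q 0) (at 0)"
    by (intro tendsto_intros bb) (use a m in auto)
  have bn: "\<forall>\<^sub>F z in at 0. b z \<noteq> 0"
    using tendsto_imp_eventually_ne[OF bb a] .
  have hn: "\<forall>\<^sub>F z in at 0. h z = z + z ^ Suc m * b z"
    using h by (simp add: eventually_at_filter eventually_mono)
  have sn: "\<forall>\<^sub>F z in at 0. 1 + z ^ m * b z \<noteq> 0"
    using tendsto_imp_eventually_ne[OF tendsto_add[OF tendsto_const[of 1] lim0], of 0] by simp
  have zn: "\<forall>\<^sub>F z in at (0::complex). z \<noteq> 0" by (simp add: eventually_at_filter)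
  have "\<forall>\<^sub>F z in at 0. - (b z / (of_nat m * a)) * q (z ^ m * b z) =
      - 1 / (of_nat m * a * h z ^ m) + 1 / (of_nat m * a * z ^ m)"
    using bn hn sn zn
  proof eventually_elim
    case (elim z)
    then have z: "z \<noteq> 0" "b z \<noteq> 0" "1 + z ^ m * b z \<noteq> 0" by auto
    have hz: "h z = z * (1 + z ^ m * b z)" using elim by (simp add: algebra_simps)
    have "- (b z / (of_nat m * a)) * q (z ^ m * b z)
        = - (b z / (of_nat m * a)) * ((1 / (1 + z ^ m * b z) ^ m - 1) / (z ^ m * b z))"
      using z by (simp add: q_def)
    also have "\<dots> = - (1 / (of_nat m * a * z ^ m)) * (1 / (1 + z ^ m * b z) ^ m - 1)"
      using z a m by (simp add: field_simps)
    also have "\<dots> = - 1 / (of_nat m * a * h z ^ m) + 1 / (of_nat m * a * z ^ m)"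
      using z a m by (simp add: hz power_mult_distrib divide_simps)
    finally show ?case .
  qed
  from Lim_transform_eventually[OF lim this] show ?thesis
    using a m by (simp add: q_def)
qed

section \<open>Irrational rotations and the local symmetries of \<open>K\<close>\<close>

lemma rot_power: "rot \<alpha> ^ n = rot (real n * \<alpha>)"
  by (simp add: rot_def exp_of_nat_mult[symmetric] mult_ac)

lemma norm_rot [simp]: "cmod (rot \<alpha>) = 1"
  by (simp add: rot_def)

lemma rot_eq_1_iff: "rot \<alpha> = 1 \<longleftrightarrow> \<alpha> \<in> \<int>"
proof -
  have "rot \<alpha> = 1 \<longleftrightarrow> (\<exists>n::int. 2 * pi * \<alpha> = real_of_int (2 * n) * pi)"
    by (auto simp: rot_def exp_eq_1)
  also have "\<dots> \<longleftrightarrow> (\<exists>n::int. \<alpha> = n)" by auto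
  finally show ?thesis by (auto simp: Ints_def)
qed

definition dense_powers :: "complex \<Rightarrow> bool" where
  "dense_powers \<mu> \<longleftrightarrow> (\<forall>w \<delta>. cmod w = 1 \<longrightarrow> \<delta> > 0 \<longrightarrow> (\<exists>i::nat. cmod (\<mu> ^ i - w) < \<delta>))"

text \<open>Kronecker's theorem on the fractional parts of \<open>real k * \<theta>\<close>, carried
  to the circle by \<open>cis (2 * pi * s)\<close>.\<close>

lemma dense_powers_rot:
  assumes "\<theta> \<notin> \<rat>"
  shows "dense_powers (rot \<theta>)"
  unfolding dense_powers_def
proof (intro allI impI)
  fix w :: complex and \<delta> :: real
  assume w: "cmod w = 1" and \<delta>: "\<delta> > 0"
  obtain t where t: "0 \<le> t" "t < 2 * pi" "w = cis t"
    using complex_norm_eq_1_exp[of w] w by (metis Arg2pi_ge_0 Arg2pi_lt_2pi Arg2pi_eq cis_conv_exp norm_one of_real_1 mult_1)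
  have ct: "isCont (\<lambda>s. cis (2 * pi * s)) (t / (2 * pi))"
    unfolding cis_conv_exp by (intro continuous_intros)
  then obtain \<epsilon> where \<epsilon>: "\<epsilon> > 0" "\<And>s. \<bar>s - t / (2 * pi)\<bar> < \<epsilon> \<Longrightarrow> cmod (cis (2 * pi * s) - w) < \<delta>"
    using \<delta> t(3) unfolding continuous_at_eps_delta by (auto simp: dist_norm)
  obtain k where k: "k > 0" "\<bar>frac (real k * \<theta>) - t / (2 * pi)\<bar> < \<epsilon>"
    using Kronecker_approx_1_explicit[OF assms, of "t / (2 * pi)" \<epsilon>] \<epsilon> t by auto
  have "rot \<theta> ^ k = cis (2 * pi * (frac (real k * \<theta>) + of_int \<lfloor>real k * \<theta>\<rfloor>))"
    by (simp add: rot_power frac_def) (simp add: rot_def cis_conv_exp mult_ac)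
  also have "\<dots> = cis (2 * pi * frac (real k * \<theta>)) * cis (2 * pi * of_int \<lfloor>real k * \<theta>\<rfloor>)"
    by (simp add: cis_mult algebra_simps)
  also have "\<dots> = cis (2 * pi * frac (real k * \<theta>))"
    by (simp add: cis_multiple_2pi)
  finally show "\<exists>i. cmod (rot \<theta> ^ i - w) < \<delta>" using \<epsilon>(2)[OF k(2)] by metis
qed

text \<open>Compactness of the circle leaves finitely many exponents, so that the corresponding
  conditions near 0 can be met in one common disc.\<close>

lemma dense_powers_uniform:
  assumes "dense_powers \<mu>" "\<delta> > 0"
  obtains J :: nat where "\<And>w. cmod w = 1 \<Longrightarrow> \<exists>i<J. cmod (\<mu> ^ i - w) < \<delta>"
proof -
  have "sphere 0 1 \<subseteq> (\<Union>i. ball (\<mu> ^ i) \<delta>)"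
    using assms unfolding dense_powers_def by (auto simp: dist_norm)
  then obtain I where I: "finite I" "sphere 0 1 \<subseteq> (\<Union>i\<in>I. ball (\<mu> ^ i) \<delta>)"
    using compactE_image[of "sphere (0::complex) 1" UNIV "\<lambda>i. ball (\<mu> ^ i) \<delta>"] by auto
  have "\<exists>i<Suc (Max I). cmod (\<mu> ^ i - w) < \<delta>" if "cmod w = 1" for w
  proof -
    have "w \<in> sphere 0 1" using that by simp
    then obtain i where "i \<in> I" "cmod (\<mu> ^ i - w) < \<delta>" using I by (auto simp: dist_norm)
    then show ?thesis using I(1) by (meson Max_ge le_imp_less_Suc)
  qed
  then show ?thesis by (rule that)
qed

text \<open>The pair consists of a local homeomorphism at 0 and its local inverse.\<close>

definition local_symmetry :: "complex set \<Rightarrow> (complex \<Rightarrow> complex) \<Rightarrow> (complex \<Rightarrow> complex) \<Rightarrow> bool" where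
  "local_symmetry K \<phi> \<psi> \<longleftrightarrow> filterlim \<phi> (at 0) (at 0) \<and> filterlim \<psi> (at 0) (at 0) \<and>
    (\<forall>\<^sub>F z in at 0. \<psi> (\<phi> z) = z \<and> \<phi> (\<psi> z) = z \<and> (\<phi> z \<in> K \<longleftrightarrow> z \<in> K))"

lemma local_symmetry_inverse:
  assumes "local_symmetry K \<phi> \<psi>"
  shows "local_symmetry K \<psi> \<phi>"
proof -
  have "\<forall>\<^sub>F z in at 0. \<phi> z \<in> K \<longleftrightarrow> z \<in> K" "\<forall>\<^sub>F z in at 0. \<psi> (\<phi> z) = z \<and> \<phi> (\<psi> z) = z"
    using assms unfolding local_symmetry_def by (auto elim: eventually_mono)
  moreover have "\<forall>\<^sub>F z in at 0. \<phi> (\<psi> z) \<in> K \<longleftrightarrow> \<psi> z \<in> K"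
    using assms calculation(1) unfolding local_symmetry_def by (auto dest: eventually_compose_filterlim)
  ultimately have "\<forall>\<^sub>F z in at 0. \<phi> (\<psi> z) = z \<and> \<psi> (\<phi> z) = z \<and> (\<psi> z \<in> K \<longleftrightarrow> z \<in> K)"
    by eventually_elim auto
  then show ?thesis using assms by (simp add: local_symmetry_def)
qed

lemma local_symmetry_compose:
  assumes "local_symmetry K \<phi> \<psi>" "local_symmetry K \<phi>' \<psi>'"
  shows "local_symmetry K (\<lambda>z. \<phi> (\<phi>' z)) (\<lambda>z. \<psi>' (\<psi> z))"
proof -
  note a = assms[unfolded local_symmetry_def]
  have "\<forall>\<^sub>F z in at 0. \<psi> (\<phi> (\<phi>' z)) = \<phi>' z \<and> (\<phi> (\<phi>' z) \<in> K \<longleftrightarrow> \<phi>' z \<in> K)"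
    using eventually_compose_filterlim[OF a(1)[THEN conjunct2, THEN conjunct2] a(2)[THEN conjunct1]]
    by (rule eventually_mono) blast
  moreover have "\<forall>\<^sub>F z in at 0. \<phi>' (\<psi>' (\<psi> z)) = \<psi> z"
    using eventually_compose_filterlim[OF a(2)[THEN conjunct2, THEN conjunct2] a(1)[THEN conjunct2, THEN conjunct1]]
    by (rule eventually_mono) blast
  ultimately have "\<forall>\<^sub>F z in at 0. \<psi>' (\<psi> (\<phi> (\<phi>' z))) = z \<and> \<phi> (\<phi>' (\<psi>' (\<psi> z))) = z \<and> (\<phi> (\<phi>' z) \<in> K \<longleftrightarrow> z \<in> K)"
    using a[THEN conjunct2, THEN conjunct2] by eventually_elim auto
  moreover have "filterlim (\<lambda>z. \<phi> (\<phi>' z)) (at 0) (at 0)" "filterlim (\<lambda>z. \<psi>' (\<psi> z)) (at 0) (at 0)"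
    using a by (auto intro: filterlim_compose)
  ultimately show ?thesis by (simp add: local_symmetry_def)
qed

text \<open>The exponent \<open>n\<close> is the m + 1 of the overview. Only a limit is demanded of
  the symmetries, so no Taylor expansion has to be composed or inverted.\<close>

definition shifts :: "complex set \<Rightarrow> nat \<Rightarrow> complex set" where
  "shifts K n = {s. \<exists>\<phi> \<psi>. local_symmetry K \<phi> \<psi> \<and> ((\<lambda>z. (\<phi> z - z) / z ^ n) \<longlongrightarrow> s) (at 0)}"

lemma shift_ratio_limit:
  assumes "((\<lambda>z. (\<phi> z - z) / z ^ n) \<longlongrightarrow> s) (at (0::complex))" "n \<ge> 2"
  shows "((\<lambda>z. \<phi> z / z) \<longlongrightarrow> 1) (at 0)"
proof -
  have "((\<lambda>z. 1 + (\<phi> z - z) / z ^ n * z ^ (n - 1)) \<longlongrightarrow> 1 + s * 0 ^ (n - 1)) (at 0)"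
    by (intro tendsto_intros assms)
  moreover have "\<forall>\<^sub>F z in at 0. 1 + (\<phi> z - z) / z ^ n * z ^ (n - 1) = \<phi> z / z"
    unfolding eventually_at_filter using assms(2)
    by (auto simp: field_simps power_eq_if[of _ n] intro!: always_eventually)
  ultimately show ?thesis using assms(2) by (auto intro: Lim_transform_eventually simp: power_0_left)
qed

lemma shifts_add:
  assumes "s \<in> shifts K n" "t \<in> shifts K n" "n \<ge> 2"
  shows "s + t \<in> shifts K n"
proof -
  obtain \<phi> \<psi> where 1: "local_symmetry K \<phi> \<psi>" "((\<lambda>z. (\<phi> z - z) / z ^ n) \<longlongrightarrow> s) (at 0)"
    using assms by (auto simp: shifts_def)
  obtain \<phi>' \<psi>' where 2: "local_symmetry K \<phi>' \<psi>'" "((\<lambda>z. (\<phi>' z - z) / z ^ n) \<longlongrightarrow> t) (at 0)"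
    using assms by (auto simp: shifts_def)
  have f: "filterlim \<phi>' (at 0) (at 0)" using 2 by (simp add: local_symmetry_def)
  have "((\<lambda>z. (\<phi> (\<phi>' z) - \<phi>' z) / \<phi>' z ^ n * (\<phi>' z / z) ^ n + (\<phi>' z - z) / z ^ n) \<longlongrightarrow> s * 1 ^ n + t) (at 0)"
    by (intro tendsto_intros filterlim_compose[OF 1(2) f] shift_ratio_limit[OF 2(2) assms(3)] 2)
  moreover have "\<forall>\<^sub>F z in at 0. \<phi>' z \<noteq> 0" using f by (simp add: filterlim_at)
  then have "\<forall>\<^sub>F z in at 0. (\<phi> (\<phi>' z) - \<phi>' z) / \<phi>' z ^ n * (\<phi>' z / z) ^ n + (\<phi>' z - z) / z ^ n = (\<phi> (\<phi>' z) - z) / z ^ n"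
  proof eventually_elim
    case (elim z)
    then have "(\<phi> (\<phi>' z) - \<phi>' z) / \<phi>' z ^ n * (\<phi>' z / z) ^ n = (\<phi> (\<phi>' z) - \<phi>' z) / z ^ n"
      by (simp add: power_divide)
    then show ?case by (simp add: diff_divide_distrib)
  qed
  ultimately have "((\<lambda>z. (\<phi> (\<phi>' z) - z) / z ^ n) \<longlongrightarrow> s + t) (at 0)"
    by (auto intro: Lim_transform_eventually)
  then show ?thesis using local_symmetry_compose[OF 1(1) 2(1)] by (auto simp: shifts_def)
qed

lemma shifts_uminus:
  assumes "s \<in> shifts K n" "n \<ge> 2"
  shows "- s \<in> shifts K n"
proof -
  obtain \<phi> \<psi> where 1: "local_symmetry K \<phi> \<psi>" "((\<lambda>z. (\<phi> z - z) / z ^ n) \<longlongrightarrow> s) (at 0)"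
    using assms by (auto simp: shifts_def)
  have f: "filterlim \<psi> (at 0) (at 0)" using 1 by (simp add: local_symmetry_def)
  have "((\<lambda>z. - ((\<phi> (\<psi> z) - \<psi> z) / \<psi> z ^ n / (\<phi> (\<psi> z) / \<psi> z) ^ n)) \<longlongrightarrow> - (s / 1 ^ n)) (at 0)"
    by (intro tendsto_intros filterlim_compose[OF 1(2) f] filterlim_compose[OF shift_ratio_limit[OF 1(2) assms(2)] f]) auto
  moreover have "\<forall>\<^sub>F z in at 0. \<psi> z \<noteq> 0" "\<forall>\<^sub>F z in at 0. \<phi> (\<psi> z) = z"
    using f 1 by (auto simp: filterlim_at local_symmetry_def elim: eventually_mono)
  then have "\<forall>\<^sub>F z in at 0. - ((\<phi> (\<psi> z) - \<psi> z) / \<psi> z ^ n / (\<phi> (\<psi> z) / \<psi> z) ^ n) = (\<psi> z - z) / z ^ n"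
    by eventually_elim (simp add: power_divide minus_divide_left)
  ultimately have "((\<lambda>z. (\<psi> z - z) / z ^ n) \<longlongrightarrow> - s) (at 0)"
    by (auto intro: Lim_transform_eventually)
  then show ?thesis using local_symmetry_inverse[OF 1(1)] by (auto simp: shifts_def)
qed

text \<open>Differentiability at 0 alone would leave an error \<open>o(cmod x + cmod y)\<close>.
  When shifts are conjugated, the two points differ only by a term of order \<open>n\<close>, so the
  error must be small relative to \<open>cmod (x - y)\<close>.\<close>

lemma holomorphic_strict_derivative:
  assumes "f holomorphic_on ball 0 r" "r > 0" "e > 0"
  obtains d where "d > 0" "\<And>x y. cmod x < d \<Longrightarrow> cmod y < d \<Longrightarrow>
      cmod (f x - f y - deriv f 0 * (x - y)) \<le> e * cmod (x - y)"
proof -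
  have "isCont (deriv f) 0"
    using holomorphic_deriv[OF assms(1)] assms(2)
    by (auto intro: holomorphic_on_imp_continuous_on continuous_on_interior)
  then obtain d where d: "d > 0" "\<And>z. cmod z < d \<Longrightarrow> cmod (deriv f z - deriv f 0) < e"
    using assms(3) unfolding continuous_at_eps_delta by (auto simp: dist_norm)
  have "cmod (f x - f y - deriv f 0 * (x - y)) \<le> e * cmod (x - y)"
    if "cmod x < min d r" "cmod y < min d r" for x y
  proof -
    have "cmod ((\<lambda>z. f z - deriv f 0 * z) x - (\<lambda>z. f z - deriv f 0 * z) y) \<le> e * cmod (x - y)"
    proof (rule field_differentiable_bound[where S = "ball 0 (min d r)" and f' = "\<lambda>z. deriv f z - deriv f 0"])
      show "((\<lambda>z. f z - deriv f 0 * z) has_field_derivative deriv f z - deriv f 0) (at z within ball 0 (min d r))"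
        if "z \<in> ball 0 (min d r)" for z
      proof -
        have "(f has_field_derivative deriv f z) (at z within ball 0 (min d r))"
          using holomorphic_derivI[OF assms(1) open_ball] that by auto
        then show ?thesis by (auto intro!: derivative_eq_intros)
      qed
      show "cmod (deriv f z - deriv f 0) \<le> e" if "z \<in> ball 0 (min d r)" for z
        using d(2)[of z] that by auto
    qed (use that in auto)
    then show ?thesis by (simp add: algebra_simps)
  qed
  then show ?thesis using that[of "min d r"] d assms(2) by auto
qed

text \<open>At \<open>f z\<close>, which is about \<open>l * z\<close>, the symmetry
  \<open>\<phi>\<close> moves points by about \<open>s * (l * z) ^ n\<close>; going back by
  \<open>g\<close> divides this by \<open>l\<close>.\<close>

lemma shifts_conjugate:
  assumes s: "s \<in> shifts K n" and n: "n \<ge> 2"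
    and f: "local_symmetry K f g"
    and fl: "((\<lambda>z. f z / z) \<longlongrightarrow> l) (at 0)"
    and g: "g holomorphic_on ball 0 r" "r > 0" and dg: "deriv g 0 = inverse l" and l: "l \<noteq> 0"
  shows "s * l ^ (n - 1) \<in> shifts K n"
proof -
  obtain \<phi> \<psi> where 1: "local_symmetry K \<phi> \<psi>" "((\<lambda>z. (\<phi> z - z) / z ^ n) \<longlongrightarrow> s) (at 0)"
    using s by (auto simp: shifts_def)
  have f0: "filterlim f (at 0) (at 0)" using f by (simp add: local_symmetry_def)
  have fnz: "\<forall>\<^sub>F z in at 0. f z \<noteq> 0" using f0 by (simp add: filterlim_at)
  have p0: "filterlim (\<lambda>z. \<phi> (f z)) (at 0) (at 0)"
    using 1(1) f0 by (auto simp: local_symmetry_def intro: filterlim_compose)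
  have "((\<lambda>z. (\<phi> (f z) - f z) / f z ^ n * (f z / z) ^ n) \<longlongrightarrow> s * l ^ n) (at 0)"
    by (intro tendsto_intros filterlim_compose[OF 1(2) f0] fl)
  moreover have "\<forall>\<^sub>F z in at 0. (\<phi> (f z) - f z) / f z ^ n * (f z / z) ^ n = (\<phi> (f z) - f z) / z ^ n"
    using fnz by eventually_elim (simp add: power_divide)
  ultimately have L: "((\<lambda>z. (\<phi> (f z) - f z) / z ^ n) \<longlongrightarrow> s * l ^ n) (at 0)"
    by (rule Lim_transform_eventually)
  have D: "((\<lambda>z. (g (\<phi> (f z)) - g (f z) - inverse l * (\<phi> (f z) - f z)) / z ^ n) \<longlongrightarrow> 0) (at 0)"
  proof (rule tendstoI)
    fix e :: real assume e: "e > 0"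
    define M where "M = cmod (s * l ^ n) + 1"
    have M: "M > 0" by (simp add: M_def add_nonneg_pos)
    have "\<forall>\<^sub>F z in at 0. cmod ((\<phi> (f z) - f z) / z ^ n) < M"
      using order_tendstoD(2)[OF tendsto_norm[OF L], of M] by (simp add: M_def)
    moreover obtain d where d: "d > 0" "\<And>x y. cmod x < d \<Longrightarrow> cmod y < d \<Longrightarrow>
      cmod (g x - g y - deriv g 0 * (x - y)) \<le> e / M * cmod (x - y)"
      using holomorphic_strict_derivative[OF g, of "e / M"] e M by auto
    have "\<forall>\<^sub>F z in at 0. cmod (f z) < d" "\<forall>\<^sub>F z in at 0. cmod (\<phi> (f z)) < d"
      using f0 p0 d(1) order_tendstoD(2)[OF tendsto_norm_zero] by (auto simp: filterlim_at)
    ultimately show "\<forall>\<^sub>F z in at 0. dist ((g (\<phi> (f z)) - g (f z) - inverse l * (\<phi> (f z) - f z)) / z ^ n) 0 < e"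
    proof eventually_elim
      case (elim z)
      have "cmod ((g (\<phi> (f z)) - g (f z) - inverse l * (\<phi> (f z) - f z)) / z ^ n) \<le> e / M * cmod (\<phi> (f z) - f z) / cmod (z ^ n)"
        using divide_right_mono[OF d(2)[OF elim(3) elim(2)], of "cmod (z ^ n)"] by (simp add: dg norm_divide)
      also have "\<dots> = e / M * cmod ((\<phi> (f z) - f z) / z ^ n)" by (simp add: norm_divide)
      also have "\<dots> < e / M * M" using elim(1) e M by (intro mult_strict_left_mono) auto
      finally show ?case using M by simp
    qed
  qed
  have "((\<lambda>z. (g (\<phi> (f z)) - g (f z) - inverse l * (\<phi> (f z) - f z)) / z ^ n + inverse l * ((\<phi> (f z) - f z) / z ^ n))
      \<longlongrightarrow> 0 + inverse l * (s * l ^ n)) (at 0)"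
    by (intro tendsto_intros D L)
  moreover have "\<forall>\<^sub>F z in at 0. g (f z) = z" using f by (auto simp: local_symmetry_def elim: eventually_mono)
  then have "\<forall>\<^sub>F z in at 0. (g (\<phi> (f z)) - g (f z) - inverse l * (\<phi> (f z) - f z)) / z ^ n + inverse l * ((\<phi> (f z) - f z) / z ^ n)
      = (g (\<phi> (f z)) - z) / z ^ n"
    by eventually_elim (simp add: diff_divide_distrib add_divide_distrib algebra_simps)
  ultimately have "((\<lambda>z. (g (\<phi> (f z)) - z) / z ^ n) \<longlongrightarrow> 0 + inverse l * (s * l ^ n)) (at 0)"
    by (rule Lim_transform_eventually)
  moreover have "0 + inverse l * (s * l ^ n) = s * l ^ (n - 1)"
    using l n by (simp add: power_eq_if[of l n])
  moreover have "local_symmetry K (\<lambda>z. g (\<phi> (f z))) (\<lambda>z. g (\<psi> (f z)))"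
    using local_symmetry_compose[OF local_symmetry_inverse[OF f] local_symmetry_compose[OF 1(1) f]] by simp
  ultimately show ?thesis unfolding shifts_def mem_Collect_eq by metis
qed

text \<open>The difference of \<open>a\<close> and its rotation by a power of \<open>\<mu>\<close>
  close to 1 is a small element of the group, and nonzero because \<open>\<mu>\<close> is no root of
  unity.\<close>

lemma small_shifts:
  assumes a: "a \<in> shifts K n" "a \<noteq> 0" "n \<ge> 2"
    and closed: "\<And>s. s \<in> shifts K n \<Longrightarrow> s * \<mu> \<in> shifts K n"
    and \<mu>: "dense_powers \<mu>" "cmod \<mu> = 1" "\<And>j. j > 0 \<Longrightarrow> \<mu> ^ j \<noteq> 1" and \<eta>: "\<eta> > 0"
  obtains b where "0 < cmod b" "cmod b < \<eta>" "\<And>i. b * \<mu> ^ i \<in> shifts K n"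
proof -
  have cl: "s * \<mu> ^ i \<in> shifts K n" if "s \<in> shifts K n" for s i
  proof (induction i)
    case (Suc i)
    show ?case using closed[OF Suc] by (simp add: mult_ac)
  qed (use that in auto)
  have \<mu>0: "\<mu> \<noteq> 0" using \<mu>(2) by auto
  \<comment> \<open>The target is \<open>inverse \<mu>\<close> rather than 1, so that the exponent
    \<open>Suc i\<close> for which the power is near 1 is positive; the exponent 0 would give
    \<open>b = 0\<close>.\<close>
  obtain i where i: "cmod (\<mu> ^ i - inverse \<mu>) < \<eta> / cmod a"
    using \<mu>(1,2) \<eta> a(2) unfolding dense_powers_def by (metis divide_pos_pos inverse_1 norm_inverse zero_less_norm_iff)
  have "\<mu> ^ Suc i - 1 = \<mu> * (\<mu> ^ i - inverse \<mu>)" using \<mu>0 by (simp add: algebra_simps)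
  then have lt: "cmod (\<mu> ^ Suc i - 1) < \<eta> / cmod a" using i \<mu>(2) by (simp add: norm_mult)
  define b where "b = a * \<mu> ^ Suc i - a"
  have "b \<in> shifts K n"
    using shifts_add[OF cl[OF a(1), of "Suc i"] shifts_uminus[OF a(1) a(3)] a(3)] by (simp add: b_def)
  moreover have "b = a * (\<mu> ^ Suc i - 1)" by (simp add: b_def algebra_simps)
  then have "cmod b = cmod a * cmod (\<mu> ^ Suc i - 1)" by (metis norm_mult)
  then have "0 < cmod b" "cmod b < \<eta>"
    using lt a(2) \<mu>(3)[of "Suc i"] by (auto simp: pos_less_divide_eq mult.commute)
  ultimately show ?thesis using that cl by blast
qed

text \<open>The point of K closest to z could be moved closer by one of the available shifts.\<close>

lemma asymptotically_dense:
  assumes K: "compact K" "connected K" "0 \<in> K" "K \<noteq> {0}" and n: "n \<ge> 2"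
    and f: "local_symmetry K f g" and fl: "((\<lambda>z. f z / z) \<longlongrightarrow> l) (at 0)" and l: "dense_powers l"
    and small: "\<And>\<eta>. \<eta> > 0 \<Longrightarrow> \<exists>b. 0 < cmod b \<and> cmod b < \<eta> \<and> (\<forall>i. b * \<mu> ^ i \<in> shifts K n)"
    and \<mu>: "dense_powers \<mu>" "cmod \<mu> = 1" and \<epsilon>: "\<epsilon> > 0"
  obtains r where "r > 0" "\<And>z. 0 < cmod z \<Longrightarrow> cmod z < r \<Longrightarrow> \<exists>k\<in>K. cmod (k - z) < \<epsilon> * cmod z ^ n"
proof -
  obtain b where b: "0 < cmod b" "cmod b < \<epsilon> / 4" "\<And>i. b * \<mu> ^ i \<in> shifts K n"
    using small[of "\<epsilon> / 4"] \<epsilon> by auto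
  define \<beta> where "\<beta> = cmod b"
  have \<beta>: "\<beta> > 0" "\<beta> < \<epsilon> / 4" using b by (auto simp: \<beta>_def)
  obtain J :: nat where J: "\<And>w. cmod w = 1 \<Longrightarrow> \<exists>i<J. cmod (\<mu> ^ i - w) < 1 / 4"
    using dense_powers_uniform[OF \<mu>(1), of "1 / 4"] by auto
  have "\<forall>i. \<exists>\<phi> \<psi>. local_symmetry K \<phi> \<psi> \<and> ((\<lambda>z. (\<phi> z - z) / z ^ n) \<longlongrightarrow> b * \<mu> ^ i) (at 0)"
    using b(3) by (auto simp: shifts_def)
  then obtain \<phi> \<psi> where \<phi>: "\<And>i. local_symmetry K (\<phi> i) (\<psi> i)"
    "\<And>i. ((\<lambda>z. (\<phi> i z - z) / z ^ n) \<longlongrightarrow> b * \<mu> ^ i) (at 0)"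
    by metis
  have cont: "isCont (\<lambda>t::complex. t ^ n) 1" by (intro continuous_intros)
  obtain \<rho>0 where \<rho>0: "\<rho>0 > 0" "\<And>t. cmod (t - 1) < \<rho>0 \<Longrightarrow> cmod (t ^ n - 1) < 1 / 4"
    using cont[unfolded continuous_at_eps_delta, rule_format, of "1 / 4"] by (auto simp: dist_norm)
  define \<rho> where "\<rho> = min (\<rho>0 / 2) (1 / 2)"
  have \<rho>: "\<rho> > 0" "\<rho> \<le> 1 / 2" and \<rho>n: "\<And>t. cmod (t - 1) \<le> \<rho> \<Longrightarrow> cmod (t ^ n - 1) < 1 / 4"
    using \<rho>0 by (auto simp: \<rho>_def)
  obtain J' :: nat where J': "\<And>w. cmod w = 1 \<Longrightarrow> \<exists>i<J'. cmod (l ^ i - w) < \<rho> / 2"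
    using dense_powers_uniform[OF l, of "\<rho> / 2"] \<rho> by auto
  have fi: "local_symmetry K (f ^^ i) (g ^^ i) \<and> ((\<lambda>z. (f ^^ i) z / z) \<longlongrightarrow> l ^ i) (at 0)" for i
  proof (induction i)
    case 0
    have "\<forall>\<^sub>F z in at (0::complex). 1 = z / z" by (simp add: eventually_at_filter)
    then have "((\<lambda>z::complex. z / z) \<longlongrightarrow> 1) (at 0)" by (rule Lim_transform_eventually[OF tendsto_const])
    then show ?case by (simp add: local_symmetry_def filterlim_ident)
  next
    case (Suc i)
    then have a: "local_symmetry K (f ^^ i) (g ^^ i)" "((\<lambda>z. (f ^^ i) z / z) \<longlongrightarrow> l ^ i) (at 0)" by auto
    have F: "filterlim (f ^^ i) (at 0) (at 0)" using a by (simp add: local_symmetry_def)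
    have "((\<lambda>z. f ((f ^^ i) z) / (f ^^ i) z * ((f ^^ i) z / z)) \<longlongrightarrow> l * l ^ i) (at 0)"
      by (intro tendsto_intros filterlim_compose[OF fl F] a)
    moreover have "\<forall>\<^sub>F z in at 0. (f ^^ i) z \<noteq> 0" using F by (simp add: filterlim_at)
    then have "\<forall>\<^sub>F z in at 0. f ((f ^^ i) z) / (f ^^ i) z * ((f ^^ i) z / z) = (f ^^ Suc i) z / z"
      by eventually_elim simp
    ultimately have "((\<lambda>z. (f ^^ Suc i) z / z) \<longlongrightarrow> l * l ^ i) (at 0)"
      by (rule Lim_transform_eventually)
    then have "((\<lambda>z. (f ^^ Suc i) z / z) \<longlongrightarrow> l ^ Suc i) (at 0)" by (simp only: power_Suc)
    moreover have "local_symmetry K (f ^^ Suc i) (g ^^ Suc i)"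
    proof -
      have "f ^^ Suc i = (\<lambda>z. f ((f ^^ i) z))" by (simp add: o_def)
      moreover have "g ^^ Suc i = (\<lambda>z. (g ^^ i) (g z))" by (simp only: funpow_Suc_right o_def)
      ultimately
      show ?thesis using local_symmetry_compose[OF f a(1)] by (simp only:)
    qed
    ultimately show ?case by blast
  qed
  have "\<forall>\<^sub>F z in at 0. cmod ((\<phi> i z - z) / z ^ n - b * \<mu> ^ i) < \<beta> / 8 \<and> (\<phi> i z \<in> K \<longleftrightarrow> z \<in> K)" for i
  proof -
    have "\<forall>\<^sub>F z in at 0. cmod ((\<phi> i z - z) / z ^ n - b * \<mu> ^ i) < \<beta> / 8"
      using tendstoD[OF \<phi>(2)[of i], of "\<beta> / 8"] \<beta> by (simp add: dist_norm)
    with \<phi>(1)[of i, unfolded local_symmetry_def, THEN conjunct2, THEN conjunct2]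
    show ?thesis by eventually_elim blast
  qed
  then have "\<forall>\<^sub>F z in at 0. \<forall>i\<in>{..<J}. cmod ((\<phi> i z - z) / z ^ n - b * \<mu> ^ i) < \<beta> / 8 \<and> (\<phi> i z \<in> K \<longleftrightarrow> z \<in> K)"
    by (intro eventually_ball_finite) auto
  then obtain r1 where r1: "r1 > 0" "\<And>z i. z \<noteq> 0 \<Longrightarrow> cmod z < r1 \<Longrightarrow> i < J \<Longrightarrow>
      cmod ((\<phi> i z - z) / z ^ n - b * \<mu> ^ i) < \<beta> / 8 \<and> (\<phi> i z \<in> K \<longleftrightarrow> z \<in> K)"
    unfolding eventually_at by (auto simp: dist_norm)
  have "\<forall>\<^sub>F z in at 0. cmod ((f ^^ i) z / z - l ^ i) < \<rho> / 2 \<and> ((f ^^ i) z \<in> K \<longleftrightarrow> z \<in> K)" for i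
  proof -
    have "\<forall>\<^sub>F z in at 0. cmod ((f ^^ i) z / z - l ^ i) < \<rho> / 2"
      using tendstoD[OF fi[THEN conjunct2, of i], of "\<rho> / 2"] \<rho> by (simp add: dist_norm)
    with fi[THEN conjunct1, of i, unfolded local_symmetry_def, THEN conjunct2, THEN conjunct2]
    show ?thesis by eventually_elim blast
  qed
  then have "\<forall>\<^sub>F z in at 0. \<forall>i\<in>{..<J'}. cmod ((f ^^ i) z / z - l ^ i) < \<rho> / 2 \<and> ((f ^^ i) z \<in> K \<longleftrightarrow> z \<in> K)"
    by (intro eventually_ball_finite) auto
  then obtain r2 where r2: "r2 > 0" "\<And>z i. z \<noteq> 0 \<Longrightarrow> cmod z < r2 \<Longrightarrow> i < J' \<Longrightarrow>
      cmod ((f ^^ i) z / z - l ^ i) < \<rho> / 2 \<and> ((f ^^ i) z \<in> K \<longleftrightarrow> z \<in> K)"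
    unfolding eventually_at by (auto simp: dist_norm)
  obtain k1 where k1: "k1 \<in> K" "k1 \<noteq> 0" using K by blast
  define r where "r = min (cmod k1) (min (r1 / 2) r2)"
  have "\<exists>k\<in>K. cmod (k - z) < \<epsilon> * cmod z ^ n" if z: "0 < cmod z" "cmod z < r" for z
  proof -
    have z0: "z \<noteq> 0" using z by auto
    \<comment> \<open>\<open>K\<close> is connected and contains 0 and a point of larger modulus
      than \<open>z\<close>, so it meets the circle through \<open>z\<close>. An iterate of
      \<open>f\<close> rotates the point found towards \<open>z\<close>, a first approximation with
      relative error below \<open>\<rho>\<close>.\<close>
    have "connected (cmod ` K)" using K by (intro connected_continuous_image continuous_intros)
    then have "cmod z \<in> cmod ` K"
      using connectedD_interval[of "cmod ` K" "cmod 0" "cmod k1" "cmod z"] K k1 z by (auto simp: r_def)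
    then obtain k0 where k0: "k0 \<in> K" "cmod k0 = cmod z" by auto
    have k00: "k0 \<noteq> 0" using k0 z by auto
    obtain i where i: "i < J'" "cmod (l ^ i - z / k0) < \<rho> / 2"
      using J'[of "z / k0"] k0 z by (auto simp: norm_divide)
    have fk: "cmod ((f ^^ i) k0 / k0 - l ^ i) < \<rho> / 2" "(f ^^ i) k0 \<in> K"
      using r2(2)[of k0 i] k0 z i k00 by (auto simp: r_def)
    have "cmod ((f ^^ i) k0 / k0 - z / k0) < \<rho>"
      using norm_triangle_lt[of "(f ^^ i) k0 / k0 - l ^ i" "l ^ i - z / k0" \<rho>] fk i by simp
    moreover have "(f ^^ i) k0 / k0 - z / k0 = ((f ^^ i) k0 - z) / k0" by (simp add: diff_divide_distrib)
    ultimately have start: "cmod ((f ^^ i) k0 - z) < \<rho> * cmod z"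
      using k0 z by (simp add: norm_divide pos_divide_less_eq)
    \<comment> \<open>The closest point is sought only within relative distance
      \<open>\<rho>\<close>, which makes \<open>k ^ n\<close> and \<open>z ^ n\<close> comparable.
      An improved point is even closer to \<open>z\<close> and therefore stays admissible.\<close>
    define Q where "Q = K \<inter> cball z (\<rho> * cmod z)"
    have "(f ^^ i) k0 \<in> Q"
      using fk(2) start by (simp add: Q_def dist_norm norm_minus_commute)
    then have "compact Q" "Q \<noteq> {}"
      using K by (auto simp: Q_def)
    moreover have contQ: "continuous_on Q (\<lambda>y. cmod (y - z))" by (intro continuous_intros)
    ultimately obtain k where k: "k \<in> Q" "\<And>y. y \<in> Q \<Longrightarrow> cmod (k - z) \<le> cmod (y - z)"
      using continuous_attains_inf[of Q "\<lambda>y. cmod (y - z)"] contQ by blast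
    have kK: "k \<in> K" and kz: "cmod (k - z) \<le> \<rho> * cmod z"
      using k by (auto simp: Q_def dist_norm norm_minus_commute)
    have "cmod (k - z) < \<epsilon> * cmod z ^ n"
    proof (rule ccontr)
      assume far: "\<not> ?thesis"
      define v where "v = (k - z) / z ^ n"
      have "\<epsilon> \<le> cmod v" using far z by (simp add: v_def norm_divide norm_power pos_le_divide_eq)
      then have v: "4 * \<beta> \<le> cmod v" using \<beta> by simp
      have v0: "v \<noteq> 0" using v \<beta> by auto
      define t where "t = k / z"
      have "cmod (t - 1) = cmod ((k - z) / z)" using z0 by (simp add: t_def diff_divide_distrib)
      then have "cmod (t - 1) \<le> \<rho>" using kz z by (simp add: norm_divide pos_divide_le_eq)
      then have tn: "cmod (t ^ n - 1) < 1 / 4" by (rule \<rho>n)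
      then have tn2: "cmod (t ^ n) \<le> 2" using norm_triangle_sub[of "t ^ n" 1] by simp
      have kn: "cmod k \<le> cmod z * 3 / 2"
      proof -
        have "cmod k \<le> cmod (k - z) + cmod z" using norm_triangle_sub[of k z] by simp
        also have "\<dots> \<le> 1 / 2 * cmod z + cmod z" using kz \<rho>(2) mult_right_mono[OF \<rho>(2), of "cmod z"] by simp
        finally show ?thesis by simp
      qed
      have knz: "k \<noteq> 0"
      proof
        assume "k = 0"
        then show False using kz \<rho>(2) z mult_right_mono[OF \<rho>(2), of "cmod z"] by simp
      qed
      have "2 * cmod z < r1" using z by (simp add: r_def)
      then have klt: "cmod k < r1" using kn r1(1) by linarith
      \<comment> \<open>\<open>b * w\<close> has modulus \<open>\<beta>\<close> and, in units of
        \<open>z ^ n\<close>, points from \<open>k\<close> towards \<open>z\<close>. The shift used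
        differs from it by less than \<open>\<beta> / 4\<close>; the factor \<open>t ^ n\<close> and
        the remainder \<open>e\<close> cost at most \<open>\<beta> / 4\<close> each, so the losses
        stay below the gain \<open>\<beta>\<close>.\<close>
      define w where "w = - (cmod b / b) * (v / cmod v)"
      have "cmod w = 1" using v0 b(1) by (simp add: w_def norm_mult norm_divide)
      then obtain j where j: "j < J" "cmod (\<mu> ^ j - w) < 1 / 4" using J by blast
      define s where "s = b * \<mu> ^ j"
      have s\<beta>: "cmod s = \<beta>" using \<mu> by (simp add: s_def \<beta>_def norm_mult norm_power)
      define e where "e = (\<phi> j k - k) / k ^ n - s"
      have e: "cmod e < \<beta> / 8" and \<phi>K: "\<phi> j k \<in> K"
        using r1(2)[of k j] knz klt j(1) kK by (auto simp: e_def s_def)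
      have bw: "b * w = - (complex_of_real \<beta> * (v / cmod v))" using b by (simp add: w_def \<beta>_def)
      have "cmod (s - b * w) < \<beta> / 4"
      proof -
        have "s - b * w = b * (\<mu> ^ j - w)" by (simp add: s_def algebra_simps)
        then show ?thesis using j(2) \<beta> by (simp add: norm_mult \<beta>_def)
      qed
      moreover have "cmod (v + b * w) = cmod v - \<beta>"
      proof -
        have "v + b * w = complex_of_real (1 - \<beta> / cmod v) * v"
          using v0 by (simp add: bw field_simps)
        then have "cmod (v + b * w) = \<bar>1 - \<beta> / cmod v\<bar> * cmod v" by (simp only: norm_mult norm_of_real)
        also have "\<dots> = (1 - \<beta> / cmod v) * cmod v" using v v0 \<beta> by (simp add: field_simps)
        also have "\<dots> = cmod v - \<beta>" using v0 by (simp add: field_simps)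
        finally show ?thesis .
      qed
      ultimately have vs: "cmod (v + s) < cmod v - 3 * \<beta> / 4"
        using norm_triangle_ineq[of "v + b * w" "s - b * w"] by simp
      have eq: "(\<phi> j k - z) / z ^ n = (v + s) + s * (t ^ n - 1) + e * t ^ n"
      proof -
        have "\<phi> j k = k + (s + e) * k ^ n" using knz by (simp add: e_def)
        then show ?thesis using z0 by (simp add: v_def t_def power_divide field_simps)
      qed
      have "cmod ((\<phi> j k - z) / z ^ n) \<le> cmod (v + s) + cmod (s * (t ^ n - 1)) + cmod (e * t ^ n)"
        unfolding eq using norm_triangle_ineq[of "v + s" "s * (t ^ n - 1)"]
          norm_triangle_ineq[of "(v + s) + s * (t ^ n - 1)" "e * t ^ n"] by linarith
      also have "cmod (s * (t ^ n - 1)) \<le> \<beta> / 4"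
        using tn mult_left_mono[OF less_imp_le[OF tn], of \<beta>] \<beta> by (simp add: norm_mult s\<beta>)
      also have "cmod (e * t ^ n) \<le> \<beta> / 8 * 2"
        unfolding norm_mult using e tn2 \<beta> by (intro mult_mono) auto
      finally have "cmod ((\<phi> j k - z) / z ^ n) < cmod v" using vs \<beta> by simp
      then have lt: "cmod (\<phi> j k - z) < cmod (k - z)"
        using z by (simp add: v_def norm_divide divide_less_cancel norm_power)
      then have "\<phi> j k \<in> Q" using kz \<phi>K by (simp add: Q_def dist_norm norm_minus_commute)
      then show False using k(2)[of "\<phi> j k"] lt by simp
    qed
    then show ?thesis using kK by blast
  qed
  moreover have "r > 0" using k1 r1 r2 by (simp add: r_def)
  ultimately show ?thesis using that by blast
qed

section \<open>The attracting cone of the commutator\<close>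

text \<open>7 / 10 is a rational lower bound for \<open>1 / sqrt 2\<close>, the cosine of the
  half-angle of the cone.\<close>

lemma cone_norm_le:
  assumes "\<bar>Im u\<bar> \<le> Re u"
  shows "7 / 10 * cmod u \<le> Re u"
proof -
  have "(Im u)\<^sup>2 \<le> (Re u)\<^sup>2" using assms by (intro abs_le_square_iff[THEN iffD1]) auto
  moreover have "(10 / 7 * Re u)\<^sup>2 = 100 / 49 * (Re u)\<^sup>2" by (simp add: power_mult_distrib power_divide)
  ultimately have "(cmod u)\<^sup>2 \<le> (10 / 7 * Re u)\<^sup>2"
    using cmod_power2[of u] zero_le_power2[of "Re u"] by linarith
  then have "cmod u \<le> 10 / 7 * Re u" by (rule power2_le_imp_le) (use assms in simp)
  then show ?thesis by simp
qed

text \<open>For a map \<open>z * (1 - t)\<close> a step has length \<open>cmod z * cmod t\<close>,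
  and \<open>cmod z\<close> drops by at least half of this. The length of an orbit in the cone is
  therefore bounded by a telescoping sum.\<close>

lemma contraction_in_cone:
  assumes "\<bar>Im u\<bar> \<le> Re u" "cmod (c - 1) \<le> 1 / 10" "t = c * u" "cmod t \<le> 1 / 10"
  shows "cmod (1 - t) \<le> 1 - cmod t / 2"
proof -
  have "Re u \<ge> 7 / 10 * cmod u" using cone_norm_le[OF assms(1)] .
  moreover have "Re t = Re u + Re ((c - 1) * u)" by (simp add: assms(3) algebra_simps)
  moreover have "\<bar>Re ((c - 1) * u)\<bar> \<le> 1 / 10 * cmod u"
    using abs_Re_le_cmod[of "(c - 1) * u"] mult_right_mono[OF assms(2), of "cmod u"] by (simp add: norm_mult)
  moreover have "cmod c \<le> 11 / 10" using norm_triangle_sub[of c 1] assms(2) by simp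
  then have "cmod t \<le> 11 / 10 * cmod u" using mult_right_mono[of "cmod c" "11 / 10" "cmod u"] by (simp add: assms(3) norm_mult)
  ultimately have "Re t \<ge> 54 / 100 * cmod t" by linarith
  moreover have "(cmod (1 - t))\<^sup>2 = 1 - 2 * Re t + (cmod t)\<^sup>2"
    unfolding cmod_power2 by (simp add: power2_eq_square algebra_simps)
  moreover have "(cmod t)\<^sup>2 \<le> 1 / 10 * cmod t"
    using mult_right_mono[OF assms(4), of "cmod t"] by (simp add: power2_eq_square)
  moreover have "(1 - cmod t / 2)\<^sup>2 = 1 - cmod t + (cmod t)\<^sup>2 / 4"
    by (simp add: power2_diff power_divide)
  ultimately have "(cmod (1 - t))\<^sup>2 \<le> (1 - cmod t / 2)\<^sup>2"
    using norm_ge_zero[of t] by linarith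
  then show ?thesis by (rule power2_le_imp_le) (use assms(4) in simp)
qed

text \<open>In the coordinate \<open>U\<close> the map is nearly the translation by 1, so points of
  the cone stay in it and tend to 0 on orbits of finite length. Late on such an orbit a point of
  \<open>K\<close> is found within a small fraction of the step, whose length is at least
  \<open>cmod a / 2 * cmod w ^ Suc m\<close>. Distortion carries this fraction back to
  \<open>z0\<close> along \<open>hi\<close>, and \<open>K\<close> is closed.\<close>

lemma attracting_cone_subset:
  assumes R0: "R0 > 0" and h: "h holomorphic_on ball 0 R0" "h 0 = 0" "deriv h 0 = 1"
    and hi: "hi holomorphic_on ball 0 R0" "hi 0 = 0" "deriv hi 0 = 1"
    and hb: "\<And>z. z \<in> ball 0 R0 \<Longrightarrow> h z = z + z ^ Suc m * b z"
    and b: "isCont b 0" "b 0 = a" "a \<noteq> 0" and m: "m \<ge> 1"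
    and inv: "\<forall>\<^sub>F z in nhds 0. hi (h z) = z \<and> h (hi z) = z \<and> (hi z \<in> K \<longleftrightarrow> z \<in> K)"
    and K: "closed K"
    and dense: "\<And>\<epsilon>. \<epsilon> > 0 \<Longrightarrow> \<exists>r>0. \<forall>z. 0 < cmod z \<longrightarrow> cmod z < r \<longrightarrow> (\<exists>k\<in>K. cmod (k - z) < \<epsilon> * cmod z ^ Suc m)"
  obtains r where "r > 0" "\<And>z. 0 < cmod z \<Longrightarrow> cmod z < r \<Longrightarrow>
    \<bar>Im (- 1 / (of_nat m * a * z ^ m))\<bar> \<le> Re (- 1 / (of_nat m * a * z ^ m)) \<Longrightarrow> z \<in> K"
proof -
  define U where "U z = - 1 / (of_nat m * a * z ^ m)" for z
  have m0: "of_nat m * a \<noteq> 0" using m b by simp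
  have hev: "\<forall>\<^sub>F z in nhds 0. h z = z + z ^ Suc m * b z"
  proof -
    have "\<forall>\<^sub>F z in nhds 0. z \<in> ball 0 R0" by (rule eventually_nhds_in_open) (use R0 in simp_all)
    then show ?thesis by eventually_elim (rule hb)
  qed
  have "\<forall>\<^sub>F z in at 0. cmod (U (h z) - U z - 1) < 1 / 4"
    using tendstoD[OF nontangential_fatou_coordinate[OF b m hev], of "1 / 4"] by (simp add: dist_norm U_def)
  moreover have "\<forall>\<^sub>F z in at 0. cmod (b z / a - 1) < 1 / 10"
  proof -
    have "((\<lambda>z. b z / a) \<longlongrightarrow> a / a) (at 0)" using b by (intro tendsto_intros) (auto simp: isCont_def)
    then show ?thesis using tendstoD[of "\<lambda>z. b z / a" 1 "at 0" "1 / 10"] b by (simp add: dist_norm)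
  qed
  moreover have "\<forall>\<^sub>F z in at 0. cmod (z ^ m * b z) < 1 / 10"
  proof -
    have "((\<lambda>z. z ^ m * b z) \<longlongrightarrow> 0 ^ m * a) (at 0)" using b by (intro tendsto_intros) (auto simp: isCont_def)
    then show ?thesis using tendstoD[of "\<lambda>z. z ^ m * b z" 0 "at 0" "1 / 10"] m by (simp add: dist_norm power_0_left)
  qed
  moreover have "\<forall>\<^sub>F z in at 0. hi (h z) = z \<and> h (hi z) = z \<and> (hi z \<in> K \<longleftrightarrow> z \<in> K)"
    using inv unfolding eventually_at_filter by (rule eventually_mono) simp
  ultimately have "\<forall>\<^sub>F z in at 0. cmod (U (h z) - U z - 1) < 1 / 4 \<and> cmod (b z / a - 1) < 1 / 10
     \<and> cmod (z ^ m * b z) < 1 / 10 \<and> hi (h z) = z \<and> h (hi z) = z \<and> (hi z \<in> K \<longleftrightarrow> z \<in> K)"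
    by eventually_elim auto
  then obtain r1 where r1: "r1 > 0" and near: "\<And>z. z \<noteq> 0 \<Longrightarrow> cmod z < r1 \<Longrightarrow>
     cmod (U (h z) - U z - 1) < 1 / 4 \<and> cmod (b z / a - 1) < 1 / 10
     \<and> cmod (z ^ m * b z) < 1 / 10 \<and> hi (h z) = z \<and> h (hi z) = z \<and> (hi z \<in> K \<longleftrightarrow> z \<in> K)"
    unfolding eventually_at dist_norm diff_zero by blast
  obtain r2 where r2: "r2 > 0" "\<And>x y. cmod x < r2 \<Longrightarrow> cmod y < r2 \<Longrightarrow> cmod (h x - h y - deriv h 0 * (x - y)) \<le> 1 * cmod (x - y)"
    using holomorphic_strict_derivative[OF h(1) R0, of 1] by auto
  obtain r3 where r3: "r3 > 0" "\<And>x y. cmod x < r3 \<Longrightarrow> cmod y < r3 \<Longrightarrow> cmod (hi x - hi y - deriv hi 0 * (x - y)) \<le> 1 * cmod (x - y)"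
    using holomorphic_strict_derivative[OF hi(1) R0, of 1] by auto
  have hlip: "cmod (h x - h y) \<le> 2 * cmod (x - y)" if "cmod x < r2" "cmod y < r2" for x y
    using r2(2)[OF that] norm_triangle_sub[of "h x - h y" "x - y"] h(3) by simp
  have hilip: "cmod (hi x) \<le> 2 * cmod x" if "cmod x < r3" for x
    using r3(2)[of x 0] that r3(1) norm_triangle_sub[of "hi x" "x"] hi(2,3) by simp
  define \<rho> where "\<rho> = min (min r1 r2) (min r3 R0) / 2"
  have \<rho>: "\<rho> > 0" "\<rho> < r1" "\<rho> < r2" "\<rho> < r3" "\<rho> < R0" using r1 r2 r3 R0 by (auto simp: \<rho>_def)
  have sub: "cball 0 \<rho> \<subseteq> ball 0 R0" using \<rho>(5) by auto
  obtain C where C: "0 \<le> C" "\<And>x w. x \<in> cball 0 \<rho> \<Longrightarrow> w \<in> cball 0 \<rho> \<Longrightarrow>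
      cmod (hi w - hi x - deriv hi x * (w - x)) \<le> C * (cmod (w - x))\<^sup>2"
    using taylor_bound_convex_compact[OF hi(1) open_ball sub compact_cball convex_cball] by blast
  have "z0 \<in> K" if z0: "0 < cmod z0" "cmod z0 < \<rho> / 4" "\<bar>Im (U z0)\<bar> \<le> Re (U z0)" for z0
  proof -
    define z where "z n = (h ^^ n) z0" for n
    have zS: "z (Suc n) = h (z n)" for n by (simp add: z_def)
    have step: "h w \<noteq> 0 \<and> \<bar>Im (U (h w))\<bar> \<le> Re (U (h w)) \<and> Re (U (h w)) \<ge> Re (U w) + 3 / 4 \<and> cmod (h w) \<le> cmod w
        \<and> cmod (h w - w) \<le> 2 * (cmod w - cmod (h w)) \<and> cmod (h w - w) \<ge> cmod a / 2 * cmod w ^ Suc m"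
      if w: "w \<noteq> 0" "cmod w < \<rho>" "\<bar>Im (U w)\<bar> \<le> Re (U w)" for w
    proof -
      have nw: "cmod (U (h w) - U w - 1) < 1 / 4" "cmod (b w / a - 1) < 1 / 10" "cmod (w ^ m * b w) < 1 / 10" "hi (h w) = w"
        using near[of w] w \<rho> by auto
      define t where "t = - (w ^ m * b w)"
      have hw: "h w = w * (1 - t)" using hb[of w] w \<rho> by (simp add: t_def algebra_simps)
      have Uw: "U w \<noteq> 0" using w m0 by (simp add: U_def)
      define u where "u = 1 / U w / of_nat m"
      have teq: "t = b w / a * u" using w m0 b by (simp add: t_def u_def U_def field_simps)
      have "\<bar>Im u\<bar> \<le> Re u"
      proof -
        \<comment> \<open>The cone is symmetric about the real axis, so inversion, which reverses
          the sign of the argument, maps it to itself.\<close>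
        have "\<bar>Im (1 / U w)\<bar> \<le> Re (1 / U w)"
          using w(3) by (simp add: Re_divide Im_divide divide_right_mono)
        then show ?thesis
          unfolding u_def Re_divide_of_nat Im_divide_of_nat abs_divide abs_of_nat by (rule divide_right_mono) simp
      qed
      moreover have "cmod t \<le> 1 / 10" using nw(3) by (simp add: t_def)
      ultimately have ct: "cmod (1 - t) \<le> 1 - cmod t / 2"
        using contraction_in_cone[OF _ _ teq] nw(2) by simp
      have "cmod (h w) \<le> cmod w * (1 - cmod t / 2)"
        using ct by (simp add: hw norm_mult mult_left_mono)
      moreover have eq: "cmod (h w - w) = cmod w * cmod t" by (simp add: hw algebra_simps flip: norm_mult)
      ultimately have s: "cmod (h w - w) \<le> 2 * (cmod w - cmod (h w))" by (simp add: algebra_simps)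
      have "\<bar>Re (U (h w)) - Re (U w) - 1\<bar> \<le> 1 / 4" "\<bar>Im (U (h w)) - Im (U w)\<bar> \<le> 1 / 4"
        using nw(1) abs_Re_le_cmod[of "U (h w) - U w - 1"] abs_Im_le_cmod[of "U (h w) - U w - 1"] by simp_all
      then have c: "\<bar>Im (U (h w))\<bar> \<le> Re (U (h w))" "Re (U (h w)) \<ge> Re (U w) + 3 / 4"
        using w(3) by linarith+
      have "cmod (b w) \<ge> cmod a / 2"
      proof -
        have "9 / 10 \<le> cmod (b w / a)" using norm_triangle_sub[of 1 "b w / a"] nw(2) by (simp add: norm_minus_commute)
        then have "9 / 10 * cmod a \<le> cmod (b w)" using b by (simp add: norm_divide pos_le_divide_eq)
        then show ?thesis using norm_ge_zero[of a] by linarith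
      qed
      then have "cmod (h w - w) \<ge> cmod a / 2 * cmod w ^ Suc m"
        using mult_right_mono[of "cmod a / 2" "cmod (b w)" "cmod w ^ Suc m"]
        by (simp add: eq t_def norm_mult norm_power mult_ac)
      moreover have "h w \<noteq> 0" using nw(4) w(1) hi(2) by metis
      moreover have "cmod (h w) \<le> cmod w" using order_trans[OF norm_ge_zero s] by simp
      ultimately show ?thesis using s c by blast
    qed
    have zn: "z n \<noteq> 0 \<and> \<bar>Im (U (z n))\<bar> \<le> Re (U (z n)) \<and> cmod (z n) \<le> cmod z0 \<and> Re (U (z n)) \<ge> 3 / 4 * n" for n
    proof (induction n)
      case 0
      then show ?case using z0 by (auto simp: z_def)
    next
      case (Suc n)
      then show ?case using step[of "z n"] z0 by (auto simp: zS)
    qed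
    note stepn = step[of "z n" for n, folded zS]
    have zlt: "cmod (z n) < \<rho> / 4" for n using zn[of n] z0 by linarith
    have sum: "(\<Sum>i<N. cmod (z (Suc i) - z i)) \<le> 2 * (cmod z0 - cmod (z N))" for N
    proof (induction N)
      case 0
      then show ?case by (simp add: z_def)
    next
      case (Suc N)
      have "cmod (z N) < \<rho>" using zlt[of N] \<rho> by simp
      then have "cmod (z (Suc N) - z N) \<le> 2 * (cmod (z N) - cmod (z (Suc N)))"
        using stepn[of N] zn[of N] by blast
      then show ?case using Suc by simp
    qed
    \<comment> \<open>\<open>Re (U (z N))\<close> is at least \<open>3 / 4 * N\<close>, and a large
      coordinate means a point near 0. The condition \<open>N \<ge> 1\<close> leaves a preceding
      point \<open>z (N - 1)\<close>, whose step starts the comparison.\<close>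
    have to0: "\<exists>N\<ge>1. cmod (z N) < s" if s: "s > 0" for s
    proof -
      obtain N :: nat where N: "real N > 2 / (cmod (of_nat m * a) * s ^ m)" using reals_Archimedean2 by blast
      have pos: "cmod (of_nat m * a) * s ^ m > 0" using m0 s by (simp del: norm_mult)
      have "2 / (cmod (of_nat m * a) * s ^ m) > 0" using pos by (rule divide_pos_pos[rotated]) simp
      then have "real N > 0" using N by (rule less_trans)
      then have "N \<ge> 1" by simp
      moreover have "cmod (z N) < s"
      proof (rule ccontr)
        assume "\<not> ?thesis"
        then have "s ^ m \<le> cmod (z N) ^ m" using s by (intro power_mono) auto
        then have "cmod (of_nat m * a) * s ^ m \<le> cmod (of_nat m * a * z N ^ m)"
          by (simp add: norm_mult norm_power mult_left_mono)
        then have "cmod (U (z N)) \<le> 1 / (cmod (of_nat m * a) * s ^ m)"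
          using pos unfolding U_def norm_divide by (intro frac_le) auto
        moreover have "3 / 4 * N \<le> cmod (U (z N))" using zn[of N] complex_Re_le_cmod order_trans by blast
        ultimately show False using N pos by (simp add: field_simps)
      qed
      ultimately show ?thesis by blast
    qed
    have close: "\<exists>y\<in>K. cmod (y - z0) < e" if e: "e > 0" for e
    proof -
      define X where "X = exp (2 * C * 2 * \<rho>)"
      have X: "X > 0" by (simp add: X_def)
      \<comment> \<open>Errors will be at most \<open>\<kappa> * X\<close> times a step shorter than
        \<open>\<rho>\<close>: the first bound keeps the orbit of \<open>k\<close> in the disc, the
        second one makes the error less than \<open>e\<close>.\<close>
      define \<kappa> where "\<kappa> = min (1 / 4) (e / (2 * \<rho>)) / X"
      have \<kappa>: "\<kappa> > 0" "\<kappa> * X \<le> 1 / 4" "\<kappa> * X \<le> e / (2 * \<rho>)" using X e \<rho> by (auto simp: \<kappa>_def)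
      obtain s where s: "s > 0" "\<And>w. 0 < cmod w \<Longrightarrow> cmod w < s \<Longrightarrow> \<exists>k\<in>K. cmod (k - w) < \<kappa> * cmod a / 2 * cmod w ^ Suc m"
        using dense[of "\<kappa> * cmod a / 2"] \<kappa> b by auto
      obtain N where N: "N \<ge> 1" "cmod (z N) < s" using to0[OF s(1)] by blast
      obtain k where k: "k \<in> K" "cmod (k - z N) < \<kappa> * cmod a / 2 * cmod (z N) ^ Suc m"
        using s(2)[of "z N"] zn[of N] N by auto
      \<comment> \<open>The orbit is run backwards from \<open>z N\<close>, with
        \<open>x N = z0\<close>. The comparison at \<open>N\<close> also needs the step beyond it,
        to \<open>x (Suc N) = hi z0\<close>.\<close>
      define x where "x i = (hi ^^ i) (z N)" for i
      define y where "y i = (hi ^^ i) k" for i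
      have xz: "x i = z (N - i)" if "i \<le> N" for i
        using that
      proof (induction i)
        case (Suc i)
        then have "x (Suc i) = hi (z (Suc (N - Suc i)))" by (simp add: x_def Suc_diff_Suc)
        also have "\<dots> = z (N - Suc i)"
          using near[of "z (N - Suc i)"] zn[of "N - Suc i"] zlt[of "N - Suc i"] \<rho> by (simp add: zS)
        finally show ?case .
      qed (simp add: x_def)
      have xN: "x (Suc N) = hi z0" using xz[of N] by (simp add: x_def z_def)
      have xS: "x (Suc i) = hi (x i)" for i by (simp add: x_def)
      have x_le: "cmod (x i) < \<rho> / 2" if "i \<le> Suc N" for i
      proof (cases "i = Suc N")
        case True
        then show ?thesis using hilip[of z0] z0 \<rho> xN by simp
      next
        case False
        then show ?thesis using xz[of i] zlt[of "N - i"] that \<rho> by simp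
      qed
      have hx: "h (x (Suc i)) = x i" if "i \<le> N" for i
        using near[of "x i"] xz[of i] zn[of "N - i"] x_le[of i] that \<rho> by (simp add: xS)
      have dist: "cmod (y n - x n) \<le> \<kappa> * exp (2 * C * 2 * \<rho>) * cmod (x (Suc n) - x n)" if nN: "n \<le> N" for n
      proof (rule orbit_distortion[where \<Phi> = hi and x = x and y = y and D = "\<lambda>n. deriv hi (x n)" and N = n and r = "\<rho> / 2"])
        show "y (Suc j) = hi (y j)" for j by (simp add: y_def)
        show "cmod (hi w - hi (x i) - deriv hi (x i) * (w - x i)) \<le> C * (cmod (w - x i))\<^sup>2"
          if "i < n" "cmod (w - x i) \<le> \<rho> / 2 \<or> w = x (Suc i)" for i w
        proof (rule C(2))
          show "x i \<in> cball 0 \<rho>" using x_le[of i] that nN \<rho> by simp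
          show "w \<in> cball 0 \<rho>"
            using x_le[of i] x_le[of "Suc i"] that nN \<rho> norm_triangle_sub[of w "x i"] by auto
        qed
        \<comment> \<open>On the backward orbit \<open>h\<close> maps each step to the preceding
          one, so 2 is the Lipschitz constant of \<open>h\<close> near 0.\<close>
        show "cmod (x (Suc i) - x i) \<le> 2 * cmod (x (Suc (Suc i)) - x (Suc i))" if "i < n" for i
          using hlip[of "x (Suc (Suc i))" "x (Suc i)"] hx[of i] hx[of "Suc i"] x_le[of "Suc i"] x_le[of "Suc (Suc i)"] that nN \<rho>
          by (simp add: norm_minus_commute)
        show "(\<Sum>i<n. cmod (x (Suc i) - x i)) \<le> \<rho>"
        proof -
          have "(\<Sum>i<n. cmod (x (Suc i) - x i)) \<le> (\<Sum>i<N. cmod (x (Suc i) - x i))"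
            using nN by (intro sum_mono2) auto
          also have "\<dots> = (\<Sum>i<N. cmod (z (N - Suc i) - z (Suc (N - Suc i))))"
            by (intro sum.cong) (auto simp: xz Suc_diff_Suc)
          also have "\<dots> = (\<Sum>i<N. cmod (z (Suc i) - z i))"
            by (subst sum.nat_diff_reindex[symmetric]) (simp add: norm_minus_commute)
          also have "\<dots> \<le> 2 * (cmod z0 - cmod (z N))" by (rule sum)
          also have "\<dots> \<le> \<rho>" using z0(2) norm_ge_zero[of "z N"] \<rho>(1) unfolding right_diff_distrib by linarith
          finally show ?thesis .
        qed
        show "\<kappa> * exp (2 * C * 2 * \<rho>) \<le> 1" using \<kappa> by (simp add: X_def)
        show "\<kappa> * exp (2 * C * 2 * \<rho>) * cmod (x (Suc i) - x i) \<le> \<rho> / 2" if "i < n" for i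
        proof -
          have "cmod (x (Suc i) - x i) \<le> \<rho>"
            using x_le[of i] x_le[of "Suc i"] norm_triangle_ineq4[of "x (Suc i)" "x i"] that nN by simp
          then have "\<kappa> * X * cmod (x (Suc i) - x i) \<le> 1 / 4 * \<rho>"
            using \<kappa> X by (intro mult_mono) auto
          then show ?thesis using \<rho> by (simp add: X_def)
        qed
        show "cmod (y 0 - x 0) \<le> \<kappa> * cmod (x 1 - x 0)"
        proof -
          have "x 0 = z (Suc (N - 1))" "x 1 = z (N - 1)" using N xz[of 0] xz[of 1] by auto
          moreover have "cmod a / 2 * cmod (z (N - 1)) ^ Suc m \<le> cmod (z (Suc (N - 1)) - z (N - 1))"
            using stepn[of "N - 1"] zn[of "N - 1"] zlt[of "N - 1"] \<rho> by auto
          moreover have "cmod (z N) ^ Suc m \<le> cmod (z (N - 1)) ^ Suc m"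
            using stepn[of "N - 1"] zn[of "N - 1"] zlt[of "N - 1"] \<rho> N by (intro power_mono) auto
          then have "cmod a / 2 * cmod (z N) ^ Suc m \<le> cmod a / 2 * cmod (z (N - 1)) ^ Suc m"
            by (intro mult_left_mono) auto
          ultimately have "cmod a / 2 * cmod (z N) ^ Suc m \<le> cmod (x 1 - x 0)" by (simp add: norm_minus_commute)
          then have "\<kappa> * (cmod a / 2 * cmod (z N) ^ Suc m) \<le> \<kappa> * cmod (x 1 - x 0)"
            using \<kappa> by (intro mult_left_mono) auto
          then show ?thesis using k(2) by (simp add: y_def x_def)
        qed
      qed (use xS \<kappa> C(1) in auto)
      have ylt: "cmod (y n - x n) < \<rho> / 2 \<and> cmod (y n - x n) < e" if "n \<le> N" for n
      proof -
        have "cmod (x (Suc n) - x n) < \<rho>"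
          using x_le[of n] x_le[of "Suc n"] norm_triangle_ineq4[of "x (Suc n)" "x n"] that by simp
        then have "\<kappa> * X * cmod (x (Suc n) - x n) < \<kappa> * X * \<rho>" using \<kappa> X by simp
        moreover have "\<kappa> * X * \<rho> \<le> 1 / 4 * \<rho>" "\<kappa> * X * \<rho> \<le> e / 2"
          using mult_right_mono[OF \<kappa>(2), of \<rho>] mult_right_mono[OF \<kappa>(3), of \<rho>] \<rho>(1) by simp_all
        ultimately show ?thesis using dist[OF that, folded X_def] \<rho>(1) e by linarith
      qed
      have "y n \<in> K" if "n \<le> N" for n
        using that
      proof (induction n)
        case (Suc n)
        then have yK: "y n \<in> K" by simp
        have "cmod (y n) < r1"
          using ylt[of n] x_le[of n] Suc.prems norm_triangle_sub[of "y n" "x n"] \<rho> by simp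
        then have "hi (y n) \<in> K" using near[of "y n"] yK hi(2) by (cases "y n = 0") auto
        then show ?case by (simp add: y_def)
      qed (simp add: y_def k)
      then have "y N \<in> K" by simp
      moreover have "x N = z0" using xz[of N] by (simp add: z_def)
      ultimately show ?thesis using ylt[of N] by auto
    qed
    show "z0 \<in> K"
      using K close closure_approachable[of z0 K] by (auto simp: dist_norm)
  qed
  then show ?thesis using that[of "\<rho> / 4"] \<rho> by (auto simp: U_def)
qed

text \<open>The computation of \<open>shifts_add\<close> without reference to a set; it makes the
  coefficient of order \<open>n\<close> additive along the iterates of one map.\<close>

lemma shift_limit_compose:
  assumes 1: "((\<lambda>z. (\<phi> z - z) / z ^ n) \<longlongrightarrow> s) (at (0::complex))"
    and 2: "((\<lambda>z. (\<phi>' z - z) / z ^ n) \<longlongrightarrow> t) (at 0)"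
    and f: "filterlim \<phi>' (at 0) (at 0)" and n: "n \<ge> 2"
  shows "((\<lambda>z. (\<phi> (\<phi>' z) - z) / z ^ n) \<longlongrightarrow> s + t) (at 0)"
proof -
  have "((\<lambda>z. (\<phi> (\<phi>' z) - \<phi>' z) / \<phi>' z ^ n * (\<phi>' z / z) ^ n + (\<phi>' z - z) / z ^ n) \<longlongrightarrow> s * 1 ^ n + t) (at 0)"
    by (intro tendsto_intros filterlim_compose[OF 1 f] shift_ratio_limit[OF 2 n] 2)
  moreover have "\<forall>\<^sub>F z in at 0. \<phi>' z \<noteq> 0" using f by (simp add: filterlim_at)
  then have "\<forall>\<^sub>F z in at 0. (\<phi> (\<phi>' z) - \<phi>' z) / \<phi>' z ^ n * (\<phi>' z / z) ^ n + (\<phi>' z - z) / z ^ n = (\<phi> (\<phi>' z) - z) / z ^ n"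
  proof eventually_elim
    case (elim z)
    then have "(\<phi> (\<phi>' z) - \<phi>' z) / \<phi>' z ^ n * (\<phi>' z / z) ^ n = (\<phi> (\<phi>' z) - \<phi>' z) / z ^ n"
      by (simp add: power_divide)
    then show ?case by (simp add: diff_divide_distrib)
  qed
  ultimately show ?thesis
    by (auto intro: Lim_transform_eventually)
qed

lemma local_symmetry_funpow:
  assumes f: "local_symmetry K f g" and fl: "((\<lambda>z. f z / z) \<longlongrightarrow> l) (at 0)"
  shows "local_symmetry K (f ^^ i) (g ^^ i)" "((\<lambda>z. (f ^^ i) z / z) \<longlongrightarrow> l ^ i) (at 0)"
proof -
  have "local_symmetry K (f ^^ i) (g ^^ i) \<and> ((\<lambda>z. (f ^^ i) z / z) \<longlongrightarrow> l ^ i) (at 0)"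
  proof (induction i)
    case 0
    have "\<forall>\<^sub>F z in at (0::complex). 1 = z / z" by (simp add: eventually_at_filter)
    then have "((\<lambda>z::complex. z / z) \<longlongrightarrow> 1) (at 0)" by (rule Lim_transform_eventually[OF tendsto_const])
    then show ?case by (simp add: local_symmetry_def filterlim_ident)
  next
    case (Suc i)
    then have a: "local_symmetry K (f ^^ i) (g ^^ i)" "((\<lambda>z. (f ^^ i) z / z) \<longlongrightarrow> l ^ i) (at 0)" by auto
    have F: "filterlim (f ^^ i) (at 0) (at 0)" using a by (simp add: local_symmetry_def)
    have "((\<lambda>z. f ((f ^^ i) z) / (f ^^ i) z * ((f ^^ i) z / z)) \<longlongrightarrow> l * l ^ i) (at 0)"
      by (intro tendsto_intros filterlim_compose[OF fl F] a)
    moreover have "\<forall>\<^sub>F z in at 0. (f ^^ i) z \<noteq> 0" using F by (simp add: filterlim_at)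
    then have "\<forall>\<^sub>F z in at 0. f ((f ^^ i) z) / (f ^^ i) z * ((f ^^ i) z / z) = (f ^^ Suc i) z / z"
      by eventually_elim simp
    ultimately have "((\<lambda>z. (f ^^ Suc i) z / z) \<longlongrightarrow> l * l ^ i) (at 0)"
      by (rule Lim_transform_eventually)
    then have "((\<lambda>z. (f ^^ Suc i) z / z) \<longlongrightarrow> l ^ Suc i) (at 0)" by (simp only: power_Suc)
    moreover have "local_symmetry K (f ^^ Suc i) (g ^^ Suc i)"
    proof -
      have "f ^^ Suc i = (\<lambda>z. f ((f ^^ i) z))" by (simp add: o_def)
      moreover have "g ^^ Suc i = (\<lambda>z. (g ^^ i) (g z))" by (simp only: funpow_Suc_right o_def)
      ultimately
      show ?thesis using local_symmetry_compose[OF f a(1)] by (simp only:)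
    qed
    ultimately show ?case by blast
  qed
  then show "local_symmetry K (f ^^ i) (g ^^ i)" "((\<lambda>z. (f ^^ i) z / z) \<longlongrightarrow> l ^ i) (at 0)"
    by auto
qed

lemma local_symmetryI:
  assumes "isCont \<phi> 0" "isCont \<psi> 0" "\<phi> 0 = 0" "\<psi> 0 = 0"
    and ev: "\<forall>\<^sub>F z in nhds 0. \<psi> (\<phi> z) = z \<and> \<phi> (\<psi> z) = z \<and> (\<phi> z \<in> K \<longleftrightarrow> z \<in> K)"
  shows "local_symmetry K \<phi> \<psi>"
proof -
  have e: "\<forall>\<^sub>F z in at 0. \<psi> (\<phi> z) = z \<and> \<phi> (\<psi> z) = z \<and> (\<phi> z \<in> K \<longleftrightarrow> z \<in> K)"
    using ev unfolding eventually_at_filter by (rule eventually_mono) simp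
  have n0: "\<forall>\<^sub>F z in at (0::complex). z \<noteq> 0" by (simp add: eventually_at_filter)
  from e n0 have "\<forall>\<^sub>F z in at 0. \<phi> z \<noteq> 0" by eventually_elim (use assms(4) in auto)
  moreover from e n0 have "\<forall>\<^sub>F z in at 0. \<psi> z \<noteq> 0" by eventually_elim (use assms(3) in auto)
  moreover have "(\<phi> \<longlongrightarrow> 0) (at 0)" "(\<psi> \<longlongrightarrow> 0) (at 0)" using assms by (auto simp: isCont_def)
  ultimately show ?thesis using e unfolding local_symmetry_def by (auto simp: filterlim_at)
qed

text \<open>Near 0, membership in \<open>K\<close> does not change along iterates of
  \<open>f\<close>, and these turn any direction into one where \<open>c / z ^ m\<close> is nearly
  positive. Finitely many iterates serve all directions, which gives a uniform radius.\<close>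

lemma rotate_into_cone:
  assumes l: "dense_powers l" and f: "local_symmetry K f g" and fl: "((\<lambda>z. f z / z) \<longlongrightarrow> l) (at 0)"
    and m: "m \<ge> 1" "c \<noteq> (0::complex)" and r: "r > 0"
    and cone: "\<And>z. 0 < cmod z \<Longrightarrow> cmod z < r \<Longrightarrow> \<bar>Im (c / z ^ m)\<bar> \<le> Re (c / z ^ m) \<Longrightarrow> z \<in> K"
  obtains s where "s > 0" "\<And>z. 0 < cmod z \<Longrightarrow> cmod z < s \<Longrightarrow> z \<in> K"
proof -
  have cont: "isCont (\<lambda>t::complex. 1 / t ^ m) 1" by (intro continuous_intros) auto
  obtain d where d: "d > 0" "\<And>t. cmod (t - 1) < d \<Longrightarrow> cmod (1 / t ^ m - 1) < 1 / 2"
    using cont[unfolded continuous_at_eps_delta, rule_format, of "1 / 2"] by (auto simp: dist_norm)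
  obtain J :: nat where J: "\<And>w. cmod w = 1 \<Longrightarrow> \<exists>i<J. cmod (l ^ i - w) < d / 2"
    using dense_powers_uniform[OF l, of "d / 2"] d by auto
  have "\<forall>\<^sub>F z in at 0. cmod ((f ^^ i) z / z - l ^ i) < d / 2 \<and> ((f ^^ i) z \<in> K \<longleftrightarrow> z \<in> K) \<and> cmod ((f ^^ i) z) < r \<and> (f ^^ i) z \<noteq> 0" for i
  proof -
    note fi = local_symmetry_funpow[OF f fl, of i]
    have "filterlim (f ^^ i) (at 0) (at 0)" using fi(1) by (simp add: local_symmetry_def)
    then have t: "((f ^^ i) \<longlongrightarrow> 0) (at 0)" "\<forall>\<^sub>F z in at 0. (f ^^ i) z \<noteq> 0" by (auto simp: filterlim_at)
    have "\<forall>\<^sub>F z in at 0. cmod ((f ^^ i) z / z - l ^ i) < d / 2"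
      using tendstoD[OF fi(2), of "d / 2"] d by (simp add: dist_norm)
    moreover have "\<forall>\<^sub>F z in at 0. cmod ((f ^^ i) z) < r"
      using tendstoD[OF t(1), of r] r by (simp add: dist_norm)
    ultimately show ?thesis using t(2) fi(1)[unfolded local_symmetry_def, THEN conjunct2, THEN conjunct2]
      by eventually_elim blast
  qed
  then have "\<forall>\<^sub>F z in at 0. \<forall>i\<in>{..<J}. cmod ((f ^^ i) z / z - l ^ i) < d / 2 \<and> ((f ^^ i) z \<in> K \<longleftrightarrow> z \<in> K) \<and> cmod ((f ^^ i) z) < r \<and> (f ^^ i) z \<noteq> 0"
    by (intro eventually_ball_finite) auto
  then obtain s where s: "s > 0" "\<And>z i. z \<noteq> 0 \<Longrightarrow> cmod z < s \<Longrightarrow> i < J \<Longrightarrow>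
      cmod ((f ^^ i) z / z - l ^ i) < d / 2 \<and> ((f ^^ i) z \<in> K \<longleftrightarrow> z \<in> K) \<and> cmod ((f ^^ i) z) < r \<and> (f ^^ i) z \<noteq> 0"
    unfolding eventually_at dist_norm diff_zero by blast
  have "z \<in> K" if z: "0 < cmod z" "cmod z < s" for z
  proof -
    define u where "u = c / z ^ m"
    have u: "u \<noteq> 0" and z0: "z \<noteq> 0" using z m by (auto simp: u_def)
    \<comment> \<open>An m-th root of the direction of \<open>u\<close>: for the ideal rotation,
      \<open>c / (z * \<tau>) ^ m\<close> is the positive number \<open>cmod u\<close>. The
      tolerance \<open>d\<close> keeps the actual iterate in the cone.\<close>
    define \<tau> where "\<tau> = cis (Arg u / m)"
    have "\<tau> ^ m = cis (Arg u)" using m(1) by (simp add: \<tau>_def Complex.DeMoivre)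
    then have \<tau>: "\<tau> ^ m = u / cmod u" "cmod \<tau> = 1" "\<tau> \<noteq> 0"
      using u by (simp_all add: \<tau>_def cis_Arg sgn_eq)
    obtain i where i: "i < J" "cmod (l ^ i - \<tau>) < d / 2" using J \<tau> by blast
    define y where "y = (f ^^ i) z"
    have y: "cmod (y / z - l ^ i) < d / 2" "y \<in> K \<longleftrightarrow> z \<in> K" "cmod y < r" "y \<noteq> 0"
      using s(2)[of z i] z z0 i by (auto simp: y_def)
    define t where "t = y / (z * \<tau>)"
    have "t - 1 = (y / z - \<tau>) / \<tau>" using z0 \<tau> by (simp add: t_def field_simps)
    then have "cmod (t - 1) = cmod (y / z - \<tau>)" using \<tau> by (simp add: norm_divide)
    also have "\<dots> < d"
      using norm_triangle_lt[of "y / z - l ^ i" "l ^ i - \<tau>" d] y i by simp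
    finally have t1: "cmod (1 / t ^ m - 1) < 1 / 2" by (rule d(2))
    have "c / y ^ m = u / \<tau> ^ m * (1 / t ^ m)"
      using z0 \<tau> y m by (simp add: u_def t_def power_mult_distrib power_divide)
    also have "u / \<tau> ^ m = cmod u" using \<tau> u by simp
    finally have cy: "c / y ^ m = cmod u * (1 / t ^ m)" .
    have "\<bar>Re (1 / t ^ m) - 1\<bar> \<le> 1 / 2" "\<bar>Im (1 / t ^ m)\<bar> \<le> 1 / 2"
      using t1 abs_Re_le_cmod[of "1 / t ^ m - 1"] abs_Im_le_cmod[of "1 / t ^ m - 1"] by simp_all
    then have "\<bar>Im (1 / t ^ m)\<bar> \<le> Re (1 / t ^ m)" by linarith
    moreover have scale: "Re (of_real p * q) = p * Re q" "Im (of_real p * q) = p * Im q" for p q by simp_all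
    ultimately have "cmod u * \<bar>Im (1 / t ^ m)\<bar> \<le> cmod u * Re (1 / t ^ m)" by (intro mult_left_mono) auto
    then have "\<bar>Im (c / y ^ m)\<bar> \<le> Re (c / y ^ m)"
      unfolding cy scale by (simp add: abs_mult)
    then show ?thesis using cone[of y] y by auto
  qed
  then show ?thesis using that s by blast
qed

text \<open>All iterates map the disc into the bounded set \<open>K\<close>, so Cauchy's estimate
  bounds their coefficients of order \<open>n\<close> uniformly; but the i-th coefficient is
  \<open>of_nat i * a\<close>.\<close>

lemma bounded_iterates_identity:
  assumes W: "open W" "h holomorphic_on W" "K \<subseteq> W" "bounded K" "h ` K \<subseteq> K" and r: "r > 0" "ball 0 r \<subseteq> K"
    and h0: "filterlim h (at 0) (at 0)" "h 0 = 0" and n: "n \<ge> 2"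
    and lim: "((\<lambda>z. (h z - z) / z ^ n) \<longlongrightarrow> a) (at 0)"
  shows "a = 0"
proof (rule ccontr)
  assume a: "a \<noteq> 0"
  obtain B where B: "B > 0" "\<And>z. z \<in> K \<Longrightarrow> cmod z \<le> B" using W(4) bounded_pos by blast
  have it: "(h ^^ i) holomorphic_on ball 0 r \<and> (h ^^ i) ` ball 0 r \<subseteq> K \<and> (h ^^ i) 0 = 0 \<and>
      filterlim (h ^^ i) (at 0) (at 0) \<and> ((\<lambda>z. ((h ^^ i) z - z) / z ^ n) \<longlongrightarrow> of_nat i * a) (at 0)" for i
  proof (induction i)
    case 0
    then show ?case using r by (auto simp: filterlim_ident)
  next
    case (Suc i)
    have "h \<circ> (h ^^ i) holomorphic_on ball 0 r"
      using Suc W by (intro holomorphic_on_compose_gen[where t = W]) auto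
    moreover have "((\<lambda>z. (h ((h ^^ i) z) - z) / z ^ n) \<longlongrightarrow> a + of_nat i * a) (at 0)"
      using Suc by (intro shift_limit_compose[OF lim _ _ n]) auto
    moreover have "filterlim (\<lambda>z. h ((h ^^ i) z)) (at 0) (at 0)"
      using filterlim_compose[OF h0(1)] Suc by blast
    moreover have "(\<lambda>z. h ((h ^^ i) z)) ` ball 0 r \<subseteq> K" using Suc W(5) by auto
    ultimately show ?case using Suc h0(2) by (simp add: o_def algebra_simps)
  qed
  define M where "M = (B + r / 2) / (r / 2) ^ n"
  have bound: "cmod (of_nat i * a) \<le> M" for i
  proof -
    define c where "c z = (if z = 0 then of_nat i * a else ((h ^^ i) z - z) / z ^ n)" for z
    have "c holomorphic_on ball 0 r"
    proof (rule no_isolated_singularity[of _ _ "{0}"])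
      have "c holomorphic_on ball 0 r - {0}"
        by (rule holomorphic_transform[of "\<lambda>z. ((h ^^ i) z - z) / z ^ n"])
           (use it[of i] in \<open>auto simp: c_def intro!: holomorphic_intros intro: holomorphic_on_subset\<close>)
      then show "c holomorphic_on ball 0 r - {0}" .
      have "isCont c z" if "z \<in> ball 0 r" for z
      proof (cases "z = 0")
        case True
        have "(c \<longlongrightarrow> of_nat i * a) (at 0)"
          by (rule Lim_transform_eventually[of "\<lambda>z. ((h ^^ i) z - z) / z ^ n"])
             (use it[of i] in \<open>auto simp: c_def eventually_at_filter\<close>)
        then show ?thesis using True by (simp add: isCont_def c_def)
      next
        case False
        then show ?thesis using that \<open>c holomorphic_on ball 0 r - {0}\<close>
          by (metis DiffI continuous_on_eq_continuous_at finite.emptyI finite.insertI finite_imp_closed holomorphic_on_imp_continuous_on open_Diff open_ball singletonD)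
      qed
      then show "continuous_on (ball 0 r) c" by (simp add: continuous_at_imp_continuous_on)
    qed auto
    \<comment> \<open>Cauchy's inequality for the derivative of order 0 bounds the value at the
      centre, which is the coefficient.\<close>
    then have "cmod ((deriv ^^ 0) c 0) \<le> fact 0 * M / (r / 2) ^ 0"
    proof (intro Cauchy_inequality)
      show "c holomorphic_on ball 0 (r / 2)" "continuous_on (cball 0 (r / 2)) c"
        using \<open>c holomorphic_on ball 0 r\<close> r
        by (auto intro: holomorphic_on_subset holomorphic_on_imp_continuous_on continuous_on_subset)
      show "cmod (c x) \<le> M" if "cmod (0 - x) = r / 2" for x
      proof -
        have x: "cmod x = r / 2" "x \<noteq> 0" "x \<in> ball 0 r" using that r by auto
        have "(h ^^ i) x \<in> K" using it[of i] x(3) by blast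
        then have "cmod ((h ^^ i) x - x) \<le> B + r / 2"
          using norm_triangle_ineq4[of "(h ^^ i) x" x] B(2)[of "(h ^^ i) x"] x(1) by simp
        then have "cmod ((h ^^ i) x - x) / (r / 2) ^ n \<le> M"
          unfolding M_def using r(1) by (intro divide_right_mono) auto
        then show ?thesis using x(2) by (simp add: c_def norm_divide norm_power x(1))
      qed
    qed (use r in auto)
    then show ?thesis by (simp add: c_def)
  qed
  obtain i :: nat where "real i > M / cmod a" using reals_Archimedean2 by blast
  then have "real i * cmod a > M" using a by (simp add: divide_less_eq)
  then show False using bound[of i] by (simp add: norm_mult)
qed

section \<open>The commutator of two maps with a common Siegel compact\<close>

lemma univalent_with_inverse:
  assumes "open U" "F holomorphic_on U" "inj_on F U" "K \<subseteq> U" "F ` K = K"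
  obtains Fi where "open (F ` U)" "Fi holomorphic_on F ` U" "\<And>z. z \<in> U \<Longrightarrow> Fi (F z) = z"
    "\<And>w. w \<in> F ` U \<Longrightarrow> Fi w \<in> U \<and> F (Fi w) = w" "K \<subseteq> F ` U" "Fi ` K = K"
    "\<And>z. z \<in> U \<Longrightarrow> deriv F z * deriv Fi (F z) = 1"
proof -
  obtain Fi where Fi: "Fi holomorphic_on F ` U" "\<And>z. z \<in> U \<Longrightarrow> deriv F z * deriv Fi (F z) = 1"
    "\<And>z. z \<in> U \<Longrightarrow> Fi (F z) = z"
    using holomorphic_has_inverse[OF assms(2,1,3)] by metis
  show ?thesis
  proof (rule that)
    show "open (F ` U)" using open_mapping_thm3[OF assms(2,1,3)] .
    show "K \<subseteq> F ` U" using assms(4,5) by blast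
    have "Fi ` K = Fi ` F ` K" using assms(5) by simp
    also have "\<dots> = K" using Fi(3) assms(4) by (force simp: image_image)
    finally show "Fi ` K = K" .
  qed (use Fi in auto)
qed

lemma common_siegel_compact_commute:
  assumes \<alpha>: "\<alpha> \<notin> \<rat>" and df: "deriv f 0 = rot \<alpha>" and f0: "f 0 = 0" and g0: "g 0 = 0"
    and Kf: "siegel_compact f K" and Kg: "siegel_compact g K"
  shows "germs_commute f g"
proof -
  have K: "compact K" "connected K" "0 \<in> K" "K \<noteq> {0}" using Kf by (auto simp: siegel_compact_def)
  obtain U F where F: "open U" "K \<subseteq> U" "F holomorphic_on U" "inj_on F U" "\<forall>\<^sub>F z in nhds 0. F z = f z" "F ` K = K"
    using Kf by (auto simp: siegel_compact_def)
  obtain V G where G: "open V" "K \<subseteq> V" "G holomorphic_on V" "inj_on G V" "\<forall>\<^sub>F z in nhds 0. G z = g z" "G ` K = K"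
    using Kg by (auto simp: siegel_compact_def)
  have F0: "F 0 = 0" and G0: "G 0 = 0" using eventually_nhds_x_imp_x[OF F(5)] eventually_nhds_x_imp_x[OF G(5)] f0 g0 by auto
  obtain Fi where Fi: "open (F ` U)" "Fi holomorphic_on F ` U" "\<And>z. z \<in> U \<Longrightarrow> Fi (F z) = z"
    "\<And>w. w \<in> F ` U \<Longrightarrow> Fi w \<in> U \<and> F (Fi w) = w" "K \<subseteq> F ` U" "Fi ` K = K"
    "\<And>z. z \<in> U \<Longrightarrow> deriv F z * deriv Fi (F z) = 1"
    using univalent_with_inverse[OF F(1,3,4,2,6)] by metis
  obtain Gi where Gi: "open (G ` V)" "Gi holomorphic_on G ` V" "\<And>z. z \<in> V \<Longrightarrow> Gi (G z) = z"
    "\<And>w. w \<in> G ` V \<Longrightarrow> Gi w \<in> V \<and> G (Gi w) = w" "K \<subseteq> G ` V" "Gi ` K = K"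
    "\<And>z. z \<in> V \<Longrightarrow> deriv G z * deriv Gi (G z) = 1"
    using univalent_with_inverse[OF G(1,3,4,2,6)] by metis
  have in0: "0 \<in> U" "0 \<in> V" "0 \<in> F ` U" "0 \<in> G ` V" using K(3) F(2) G(2) Fi(5) Gi(5) by auto
  have Fi0: "Fi 0 = 0" and Gi0: "Gi 0 = 0" using Fi(3)[OF in0(1)] Gi(3)[OF in0(2)] F0 G0 by auto
  have dF: "deriv F 0 = rot \<alpha>" using deriv_cong_ev[OF F(5) refl] df by simp
  have rot0: "rot \<alpha> \<noteq> 0" by (simp add: rot_def)
  have dFi: "deriv Fi 0 = inverse (rot \<alpha>)" using Fi(7)[OF in0(1)] F0 dF rot0 by (simp add: field_simps)
  have dGi: "deriv G 0 * deriv Gi 0 = 1" using Gi(7)[OF in0(2)] G0 by simp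
  define h where "h z = Fi (Gi (F (G z)))" for z
  define hi where "hi z = Gi (Fi (G (F z)))" for z
  \<comment> \<open>The points at which the four factors of \<open>h\<close> can be evaluated one
    after the other. Invariance puts all of \<open>K\<close> inside, so \<open>h\<close> is
    holomorphic near \<open>K\<close> and not just near 0, as its iteration on \<open>K\<close>
    requires.\<close>
  define W where "W = V \<inter> G -` (U \<inter> F -` (G ` V \<inter> Gi -` (F ` U)))"
  define W' where "W' = U \<inter> F -` (V \<inter> G -` (F ` U \<inter> Fi -` (G ` V)))"
  have oW: "open W" and oW': "open W'"
    unfolding W_def W'_def
    by (intro continuous_open_preimage holomorphic_on_imp_continuous_on F(1,3) G(1,3) Fi(1,2) Gi(1,2))+
  have maps: "F z \<in> K" "G z \<in> K" "Fi z \<in> K" "Gi z \<in> K" if "z \<in> K" for z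
    using imageI[OF that, of F] imageI[OF that, of G] imageI[OF that, of Fi] imageI[OF that, of Gi]
    by (simp_all add: F(6) G(6) Fi(6) Gi(6))
  have KW: "K \<subseteq> W" and KW': "K \<subseteq> W'"
    unfolding W_def W'_def
    by (auto simp: maps subsetD[OF F(2)] subsetD[OF G(2)] subsetD[OF Fi(5)] subsetD[OF Gi(5)])
  have hK: "h ` K \<subseteq> K" and hiK: "hi ` K \<subseteq> K"
    by (auto simp: h_def hi_def maps)
  have hol: "h holomorphic_on W"
  proof -
    have "G holomorphic_on W" using G(3) by (rule holomorphic_on_subset) (auto simp: W_def)
    then have "F \<circ> G holomorphic_on W" using F(3) by (rule holomorphic_on_compose_gen) (auto simp: W_def)
    then have "Gi \<circ> (F \<circ> G) holomorphic_on W" using Gi(2) by (rule holomorphic_on_compose_gen) (auto simp: W_def)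
    then have "Fi \<circ> (Gi \<circ> (F \<circ> G)) holomorphic_on W" using Fi(2) by (rule holomorphic_on_compose_gen) (auto simp: W_def)
    then show ?thesis by (simp add: o_def h_def[abs_def])
  qed
  have hol': "hi holomorphic_on W'"
  proof -
    have "F holomorphic_on W'" using F(3) by (rule holomorphic_on_subset) (auto simp: W'_def)
    then have "G \<circ> F holomorphic_on W'" using G(3) by (rule holomorphic_on_compose_gen) (auto simp: W'_def)
    then have "Fi \<circ> (G \<circ> F) holomorphic_on W'" using Fi(2) by (rule holomorphic_on_compose_gen) (auto simp: W'_def)
    then have "Gi \<circ> (Fi \<circ> (G \<circ> F)) holomorphic_on W'" using Gi(2) by (rule holomorphic_on_compose_gen) (auto simp: W'_def)
    then show ?thesis by (simp add: o_def hi_def[abs_def])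
  qed
  have hih: "hi (h z) = z" if "z \<in> W" for z
    using that Fi(3,4) Gi(3,4) unfolding W_def h_def hi_def by auto
  have hhi: "h (hi z) = z" if "z \<in> W'" for z
    using that Fi(3,4) Gi(3,4) unfolding W'_def h_def hi_def by auto
  have h0: "h 0 = 0" "hi 0 = 0" by (simp_all add: h_def hi_def F0 G0 Fi0 Gi0)
  have dif: "F field_differentiable at 0" "G field_differentiable at 0" "Fi field_differentiable at 0" "Gi field_differentiable at 0"
    using F(1,3) G(1,3) Fi(1,2) Gi(1,2) in0 by (auto intro: holomorphic_on_imp_differentiable_at)
  have dh: "deriv h 0 = 1"
  proof -
    have "(Fi \<circ> (Gi \<circ> (F \<circ> G)) has_field_derivative deriv Fi 0 * (deriv Gi 0 * (deriv F 0 * deriv G 0))) (at 0)"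
      using dif by (intro DERIV_chain) (auto simp: F0 G0 Gi0 Fi0 DERIV_deriv_iff_field_differentiable)
    moreover have "deriv Fi 0 * (deriv Gi 0 * (deriv F 0 * deriv G 0)) = 1"
      using dGi dF dFi rot0 by (simp add: field_simps)
    moreover have "Fi \<circ> (Gi \<circ> (F \<circ> G)) = h" by (auto simp: h_def)
    ultimately show ?thesis by (metis DERIV_imp_deriv)
  qed
  have dhi: "deriv hi 0 = 1"
  proof -
    have "(Gi \<circ> (Fi \<circ> (G \<circ> F)) has_field_derivative deriv Gi 0 * (deriv Fi 0 * (deriv G 0 * deriv F 0))) (at 0)"
      using dif by (intro DERIV_chain) (auto simp: F0 G0 Gi0 Fi0 DERIV_deriv_iff_field_differentiable)
    moreover have "deriv Gi 0 * (deriv Fi 0 * (deriv G 0 * deriv F 0)) = 1"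
      using dGi dF dFi rot0 by (simp add: field_simps)
    moreover have "Gi \<circ> (Fi \<circ> (G \<circ> F)) = hi" by (auto simp: hi_def)
    ultimately show ?thesis by (metis DERIV_imp_deriv)
  qed
  have "0 \<in> W \<inter> W'" using KW KW' K(3) by blast
  then obtain R where R: "R > 0" "ball 0 R \<subseteq> W \<inter> W'"
    using open_contains_ball[of "W \<inter> W'"] oW oW' by blast
  have hR: "h holomorphic_on ball 0 R" "hi holomorphic_on ball 0 R"
    using hol hol' R(2) by (auto intro: holomorphic_on_subset)
  have evR: "\<forall>\<^sub>F z in nhds 0. z \<in> ball 0 R" by (rule eventually_nhds_in_open) (use R(1) in simp_all)
  have hinK: "hi z \<in> K \<longleftrightarrow> z \<in> K" if "z \<in> ball 0 R" for z
    using hiK hK hhi[of z] R(2) that by (metis IntD2 image_subset_iff subsetD)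
  have hnK: "h z \<in> K \<longleftrightarrow> z \<in> K" if "z \<in> ball 0 R" for z
    using hiK hK hih[of z] R(2) that by (metis IntD1 image_subset_iff subsetD)
  have evh: "\<forall>\<^sub>F z in nhds 0. hi (h z) = z \<and> h (hi z) = z \<and> (hi z \<in> K \<longleftrightarrow> z \<in> K)"
    using evR by eventually_elim (use hih hhi hinK R(2) in blast)
  have evh': "\<forall>\<^sub>F z in nhds 0. hi (h z) = z \<and> h (hi z) = z \<and> (h z \<in> K \<longleftrightarrow> z \<in> K)"
    using evR by eventually_elim (use hih hhi hnK R(2) in blast)
  have conth: "isCont h 0" "isCont hi 0"
    using hR R(1) by (auto intro!: continuous_on_interior[of "ball 0 R"] holomorphic_on_imp_continuous_on)
  have symh: "local_symmetry K h hi" by (rule local_symmetryI) (use conth h0 evh' in auto)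
  have symF: "local_symmetry K F Fi"
  proof (rule local_symmetryI)
    show "isCont F 0" "isCont Fi 0" using dif by (auto intro: field_differentiable_imp_continuous_at)
    have "\<forall>\<^sub>F z in nhds 0. z \<in> U \<inter> F ` U"
      by (rule eventually_nhds_in_open) (use F(1) Fi(1) in0 in auto)
    then show "\<forall>\<^sub>F z in nhds 0. Fi (F z) = z \<and> F (Fi z) = z \<and> (F z \<in> K \<longleftrightarrow> z \<in> K)"
    proof eventually_elim
      case (elim z)
      then have "Fi (F z) = z" "F (Fi z) = z" using Fi(3,4) by auto
      then show ?case using F(6) Fi(6) by (metis imageI)
    qed
  qed (use F0 Fi0 in auto)
  have Fl: "((\<lambda>z. F z / z) \<longlongrightarrow> rot \<alpha>) (at 0)"
    using DERIV_deriv_iff_field_differentiable[of F 0] dif(1) dF F0 by (simp add: has_field_derivative_iff)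
  have "h z = z" if "z \<in> ball 0 R" for z
  proof (rule ccontr)
    assume "h z \<noteq> z"
    have hz: "(\<lambda>z. h z - z) holomorphic_on ball 0 R" by (intro holomorphic_intros hR)
    have z0: "0 \<in> ball 0 R" "h 0 - 0 = 0" using R(1) h0 by auto
    have nc: "\<not> (\<lambda>z. h z - z) constant_on ball 0 R"
    proof
      assume "(\<lambda>z. h z - z) constant_on ball 0 R"
      then obtain c where c: "\<And>z. z \<in> ball 0 R \<Longrightarrow> h z - z = c" unfolding constant_on_def by blast
      from c[of 0] c[OF that] show False using h0 R(1) \<open>h z \<noteq> z\<close> by simp
    qed
    obtain b r n where br: "0 < n" "0 < r" "ball (0::complex) r \<subseteq> ball 0 R" "b holomorphic_on ball 0 r"
      "\<And>w. w \<in> ball 0 r \<Longrightarrow> h w - w = (w - 0) ^ n * b w" "\<And>w. w \<in> ball 0 r \<Longrightarrow> b w \<noteq> 0"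
      by (rule holomorphic_factor_zero_nonconstant[OF hz open_ball connected_ball z0 nc]) (rule that)
    define a where "a = b 0"
    have a: "a \<noteq> 0" using br by (simp add: a_def)
    have bcont: "isCont b 0"
      using br(2,4) by (auto intro!: continuous_on_interior[of "ball 0 r"] holomorphic_on_imp_continuous_on)
    have evr: "\<forall>\<^sub>F z in at 0. z \<in> ball 0 r" by (rule eventually_at_in_open') (use br(2) in simp_all)
    have n0: "\<forall>\<^sub>F z in at (0::complex). z \<noteq> 0" by (simp add: eventually_at_filter)
    have lim: "((\<lambda>z. (h z - z) / z ^ n) \<longlongrightarrow> a) (at 0)"
    proof (rule Lim_transform_eventually)
      show "(b \<longlongrightarrow> a) (at 0)" using bcont by (simp add: isCont_def a_def)
      from evr n0 show "\<forall>\<^sub>F z in at 0. b z = (h z - z) / z ^ n"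
        by eventually_elim (use br(5) in simp)
    qed
    \<comment> \<open>The multipliers cancel in the commutator, and the resulting derivative 1 at 0
      excludes a deviation of order 1.\<close>
    have n2: "n \<ge> 2"
    proof (rule ccontr)
      assume "\<not> n \<ge> 2"
      then have "n = 1" using br(1) by simp
      have "((\<lambda>z. h z / z) \<longlongrightarrow> 1) (at 0)"
        using hR(1) R(1) dh h0 holomorphic_derivI[OF hR(1) open_ball, of 0] by (simp add: has_field_derivative_iff)
      then have "((\<lambda>z. h z / z - 1) \<longlongrightarrow> 1 - 1) (at 0)" by (intro tendsto_intros)
      moreover from n0 have "\<forall>\<^sub>F z in at 0. h z / z - 1 = (h z - z) / z ^ n"
        by eventually_elim (simp add: \<open>n = 1\<close> diff_divide_distrib)
      ultimately have "((\<lambda>z. (h z - z) / z ^ n) \<longlongrightarrow> 1 - 1) (at 0)" by (rule Lim_transform_eventually)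
      then show False using tendsto_unique[OF at_neq_bot _ lim] a by fastforce
    qed
    define m where "m = n - 1"
    have m: "m \<ge> 1" "n = Suc m" using n2 by (auto simp: m_def)
    have \<mu>: "rot \<alpha> ^ m = rot (real m * \<alpha>)" by (rule rot_power)
    have irr: "real k * \<alpha> \<notin> \<rat>" if "k > 0" for k
    proof
      assume "real k * \<alpha> \<in> \<rat>"
      then have "real k * \<alpha> / real k \<in> \<rat>" by (intro Rats_divide) auto
      then show False using \<alpha> that by simp
    qed
    have as: "a \<in> shifts K n" using symh lim by (auto simp: shifts_def)
    have RFi: "\<exists>s>0. Fi holomorphic_on ball 0 s"
      using Fi(1,2) in0(3) open_contains_ball[of "F ` U"] by (meson holomorphic_on_subset)
    then obtain s where s: "s > 0" "Fi holomorphic_on ball 0 s" by blast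
    have conj: "t * rot (real m * \<alpha>) \<in> shifts K n" if "t \<in> shifts K n" for t
      using shifts_conjugate[OF that n2 symF Fl s(2,1) dFi rot0] by (simp add: m \<mu>)
    have small: "\<exists>b. 0 < cmod b \<and> cmod b < \<eta> \<and> (\<forall>i. b * rot (real m * \<alpha>) ^ i \<in> shifts K n)" if "\<eta> > 0" for \<eta>
    proof -
      have "rot (real m * \<alpha>) ^ j \<noteq> 1" if "j > 0" for j
      proof
        assume "rot (real m * \<alpha>) ^ j = 1"
        then have "real (j * m) * \<alpha> \<in> \<int>" by (simp add: rot_power rot_eq_1_iff mult_ac)
        then show False using irr[of "j * m"] that m Ints_subset_Rats by auto
      qed
      then show ?thesis
        using small_shifts[OF as a n2 conj dense_powers_rot[OF irr] norm_rot _ that] m by (metis less_le_trans zero_less_one)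
    qed
    have dense: "\<exists>r>0. \<forall>z. 0 < cmod z \<longrightarrow> cmod z < r \<longrightarrow> (\<exists>k\<in>K. cmod (k - z) < \<epsilon> * cmod z ^ Suc m)" if "\<epsilon> > 0" for \<epsilon>
    proof -
      have mpos: "m > 0" using m by simp
      show ?thesis
        using asymptotically_dense[OF K n2 symF Fl dense_powers_rot[OF \<alpha>] small dense_powers_rot[OF irr[OF mpos]] norm_rot that]
        unfolding m(2) by metis
    qed
    obtain r1 where r1: "r1 > 0" "\<And>z. 0 < cmod z \<Longrightarrow> cmod z < r1 \<Longrightarrow>
      \<bar>Im (- 1 / (of_nat m * a * z ^ m))\<bar> \<le> Re (- 1 / (of_nat m * a * z ^ m)) \<Longrightarrow> z \<in> K"
    proof (rule attracting_cone_subset[of r h hi m b a K])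
      show "h holomorphic_on ball 0 r" "hi holomorphic_on ball 0 r" using hR br(3) by (auto intro: holomorphic_on_subset)
      show "h z = z + z ^ Suc m * b z" if "z \<in> ball 0 r" for z using br(5)[OF that] by (simp add: m(2) algebra_simps)
      show "closed K" using K(1) by (rule compact_imp_closed)
    qed (use br(2) h0 dh dhi bcont a m(1) evh dense in \<open>auto simp: a_def\<close>)
    obtain r2 where r2: "r2 > 0" "\<And>z. 0 < cmod z \<Longrightarrow> cmod z < r2 \<Longrightarrow> z \<in> K"
    proof (rule rotate_into_cone[OF dense_powers_rot[OF \<alpha>] symF Fl m(1) _ r1(1)])
      show "- 1 / (of_nat m * a) \<noteq> 0" using a m by simp
      show "z \<in> K" if "0 < cmod z" "cmod z < r1" "\<bar>Im (- 1 / (of_nat m * a) / z ^ m)\<bar> \<le> Re (- 1 / (of_nat m * a) / z ^ m)" for z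
        using r1(2)[of z] that by (simp add: divide_divide_eq_left)
    qed blast
    have "a = 0"
    proof (rule bounded_iterates_identity[OF oW hol KW compact_imp_bounded[OF K(1)] hK r2(1) _ _ h0(1) n2 lim])
      show "ball 0 r2 \<subseteq> K" using r2(2) K(3) by (metis mem_ball_0 norm_le_zero_iff not_less subsetI)
      show "filterlim h (at 0) (at 0)" using symh by (simp add: local_symmetry_def)
    qed
    then show False using a by simp
  qed
  then have evid: "\<forall>\<^sub>F z in nhds 0. h z = z" using evR by (auto elim: eventually_mono)
  have FG: "F (G z) = G (F z)" if "z \<in> W" "h z = z" for z
    using that Fi(3,4) Gi(3,4) unfolding W_def h_def by (metis IntD1 IntD2 vimageD)
  have evW: "\<forall>\<^sub>F z in nhds 0. z \<in> W" by (rule eventually_nhds_in_open) (use oW KW K(3) in auto)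
  have "\<forall>\<^sub>F z in nhds 0. F (g z) = f (g z)" "\<forall>\<^sub>F z in nhds 0. G (f z) = g (f z)"
  proof -
    have "isCont F 0" "isCont G 0" using dif by (auto intro: field_differentiable_imp_continuous_at)
    then have "filterlim F (nhds (F 0)) (nhds 0)" "filterlim G (nhds (G 0)) (nhds 0)"
      by (simp_all only: isCont_def tendsto_at_iff_tendsto_nhds)
    then have tF: "filterlim F (nhds 0) (nhds 0)" and tG: "filterlim G (nhds 0) (nhds 0)"
      by (simp_all only: F0 G0)
    from eventually_compose_filterlim[OF F(5) tG] G(5) show "\<forall>\<^sub>F z in nhds 0. F (g z) = f (g z)"
      by eventually_elim simp
    from eventually_compose_filterlim[OF G(5) tF] F(5) show "\<forall>\<^sub>F z in nhds 0. G (f z) = g (f z)"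
      by eventually_elim simp
  qed
  with evid evW F(5) G(5) show ?thesis
    unfolding germs_commute_def by eventually_elim (use FG in metis)
qed

section \<open>The maximal invariant continuum in a closed disc\<close>

lemma connected_Un_closure:
  assumes "connected A" "connected B" "closure B \<inter> A \<noteq> {}"
  shows "connected (A \<union> B)"
proof -
  obtain p where p: "p \<in> closure B" "p \<in> A" using assms(3) by blast
  have "connected (insert p B)"
    by (rule connected_intermediate_closure[OF assms(2)]) (use p closure_subset in auto)
  then have "connected (A \<union> insert p B)" using assms(1) p by (intro connected_Un) auto
  then show ?thesis using p by (simp add: insert_absorb)
qed

text \<open>The inverse laws are demanded only where both the point and its image lie in the disc.
  In this form the assumptions are symmetric in \<open>F\<close> and \<open>H\<close>, and they
  survive multiplication of \<open>F\<close> by a number of modulus 1 with the matching change of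
  \<open>H\<close>. The gap between \<open>r\<close> and \<open>R\<close> keeps the maps holomorphic
  near the closed disc.\<close>

locale mutually_inverse =
  fixes F H :: "complex \<Rightarrow> complex" and R r :: real
  assumes r: "0 < r" "r < R"
    and holF: "F holomorphic_on ball 0 R" and holH: "H holomorphic_on ball 0 R"
    and HF: "\<And>z. z \<in> ball 0 R \<Longrightarrow> F z \<in> ball 0 R \<Longrightarrow> H (F z) = z"
    and FH: "\<And>z. z \<in> ball 0 R \<Longrightarrow> H z \<in> ball 0 R \<Longrightarrow> F (H z) = z"
    and F0: "F 0 = 0" and H0: "H 0 = 0"
begin

lemma swap: "mutually_inverse H F R r"
  by unfold_locales (use r holF holH HF FH F0 H0 in auto)

lemma cball_sub: "cball 0 r \<subseteq> ball (0::complex) R"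
  using r by auto

lemma cont: "continuous_on (cball 0 r) F" "continuous_on (cball 0 r) H"
  using holF holH cball_sub by (auto intro: holomorphic_on_imp_continuous_on continuous_on_subset)

text \<open>Closedness is left out so that unions of images of a set qualify as they stand; the
  closure is taken once, in \<open>K\<close>.\<close>

definition invariant_continuum :: "complex set \<Rightarrow> bool" where
  "invariant_continuum C \<longleftrightarrow> C \<subseteq> cball 0 r \<and> connected C \<and> 0 \<in> C \<and> F ` C = C"

definition K :: "complex set" where
  "K = closure (\<Union>{C. invariant_continuum C})"

lemma invariant_subset: "invariant_continuum C \<Longrightarrow> C \<subseteq> K"
  unfolding K_def by (rule subset_trans[OF _ closure_subset]) auto

lemma K_props: "compact K" "connected K" "0 \<in> K" "K \<subseteq> cball 0 r" "F ` K = K" "H ` K = K"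
proof -
  let ?A = "\<Union>{C. invariant_continuum C}"
  have A0: "invariant_continuum {0}" using r by (simp add: invariant_continuum_def F0)
  have sub: "?A \<subseteq> cball 0 r" by (auto simp: invariant_continuum_def)
  then show Kc: "K \<subseteq> cball 0 r" unfolding K_def by (simp add: closure_minimal)
  show "compact K" unfolding K_def
    by (rule compact_closure[THEN iffD2]) (use sub bounded_subset bounded_cball in blast)
  have "connected ?A"
    by (rule connected_Union) (use A0 in \<open>auto simp: invariant_continuum_def\<close>)
  then show "connected K" unfolding K_def by (rule connected_imp_connected_closure)
  show "0 \<in> K" using invariant_subset[OF A0] by simp
  have FA: "F ` ?A = ?A" unfolding image_Union invariant_continuum_def by (auto; blast)
  have cK: "continuous_on K F" using cont Kc by (auto intro: continuous_on_subset)
  show FK: "F ` K = K"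
  proof
    have "F ` closure ?A \<subseteq> closure ?A"
    proof (rule image_closure_subset)
      show "continuous_on (closure ?A) F" using cK by (simp add: K_def)
      show "F ` ?A \<subseteq> closure ?A" unfolding FA by (rule closure_subset)
    qed simp
    then show "F ` K \<subseteq> K" by (simp add: K_def)
    have "closed (F ` K)" using compact_continuous_image[OF cK \<open>compact K\<close>] by (rule compact_imp_closed)
    moreover have "?A \<subseteq> F ` K" using FA closure_subset[of ?A] unfolding K_def by (metis image_mono)
    ultimately show "K \<subseteq> F ` K" unfolding K_def by (simp add: closure_minimal)
  qed
  have "H (F z) = z" if "z \<in> K" for z
  proof (rule HF)
    show "z \<in> ball 0 R" "F z \<in> ball 0 R" using that FK Kc cball_sub by blast+
  qed
  then have "H ` F ` K = K" by (force simp: image_image)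
  then show "H ` K = K" by (simp add: FK)
qed

lemma funpow_K: "z \<in> K \<Longrightarrow> (F ^^ n) z \<in> K" "z \<in> K \<Longrightarrow> (H ^^ n) z \<in> K"
proof -
  show "z \<in> K \<Longrightarrow> (F ^^ n) z \<in> K" using K_props(5) by (induction n) auto
  show "z \<in> K \<Longrightarrow> (H ^^ n) z \<in> K" using K_props(6) by (induction n) auto
qed

lemma iterates_continuous:
  assumes "\<And>n. (F ^^ n) ` J \<subseteq> cball 0 r"
  shows "continuous_on (closure J) (F ^^ n) \<and> (F ^^ n) ` closure J \<subseteq> cball 0 r"
proof (induction n)
  case 0
  then show ?case using assms[of 0] by (simp add: closure_minimal continuous_on_id)
next
  case (Suc n)
  have c: "continuous_on (closure J) (F ^^ Suc n)"
    unfolding funpow.simps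
    by (rule continuous_on_compose) (use Suc cont in \<open>auto intro: continuous_on_subset\<close>)
  moreover have "(F ^^ Suc n) ` closure J \<subseteq> cball 0 r"
    by (rule image_closure_subset[OF c]) (use assms[of "Suc n"] in auto)
  ultimately show ?case by blast
qed

text \<open>A point of \<open>closure J\<close> in \<open>K\<close> is sent to a point of
  \<open>K\<close> that adheres to the image of \<open>J\<close>, so the image remains attached to
  \<open>K\<close>.\<close>

lemma iterate_connected:
  assumes J: "connected J" "closure J \<inter> K \<noteq> {}" and F: "\<And>n. (F ^^ n) ` J \<subseteq> cball 0 r"
  shows "connected (K \<union> (F ^^ n) ` J)"
proof (rule connected_Un_closure)
  have c: "continuous_on (closure J) (F ^^ n)" using iterates_continuous[OF F] by blast
  then show "connected ((F ^^ n) ` J)"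
    using J(1) closure_subset by (intro connected_continuous_image) (auto intro: continuous_on_subset)
  obtain p where p: "p \<in> closure J" "p \<in> K" using J(2) by blast
  have "(F ^^ n) ` closure J \<subseteq> closure ((F ^^ n) ` J)"
    by (rule image_closure_subset[OF c closed_closure closure_subset])
  then show "closure ((F ^^ n) ` J) \<inter> K \<noteq> {}" using p funpow_K(1)[of p n] by blast
qed (rule K_props)

end

context mutually_inverse
begin

interpretation inv: mutually_inverse H F R r by (rule swap)

lemma K_swap: "inv.K = K"
proof -
  have "inv.invariant_continuum C \<longleftrightarrow> invariant_continuum C" for C
  proof -
    have 1: "mutually_inverse.invariant_continuum G r C \<Longrightarrow> mutually_inverse.invariant_continuum G' r C"
      if "mutually_inverse G G' R r" for G G'
    proof -
      interpret g: mutually_inverse G G' R r by (rule that)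
      interpret g': mutually_inverse G' G R r by (rule g.swap)
      assume a: "g.invariant_continuum C"
      then have C: "C \<subseteq> cball 0 r" "G ` C = C" by (auto simp: g.invariant_continuum_def)
      have "G' (G z) = z" if "z \<in> C" for z
        by (rule g.HF) (use that C g.cball_sub in blast)+
      then have "G' ` G ` C = C" by (force simp: image_image)
      then show "g'.invariant_continuum C" using a C(2) by (simp add: g.invariant_continuum_def g'.invariant_continuum_def)
    qed
    show ?thesis using 1[OF swap] 1[OF mutually_inverse_axioms] by blast
  qed
  then show ?thesis by (simp add: inv.K_def K_def)
qed

text \<open>\<open>K\<close> together with all forward and backward images of \<open>J\<close> is
  again connected and invariant, so maximality applies. Both directions of time enter because
  invariance is an equality of sets.\<close>

lemma extend_K:
  assumes J: "connected J" "closure J \<inter> K \<noteq> {}"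
    and F: "\<And>n. (F ^^ n) ` J \<subseteq> cball 0 r" and H: "\<And>n. (H ^^ n) ` J \<subseteq> cball 0 r"
  shows "J \<subseteq> K"
proof -
  define C where "C = (\<Union>n. K \<union> (F ^^ n) ` J) \<union> (\<Union>n. K \<union> (H ^^ n) ` J)"
  have cF: "connected (K \<union> (F ^^ n) ` J)" for n using iterate_connected[OF J F] .
  have cH: "connected (K \<union> (H ^^ n) ` J)" for n
    using inv.iterate_connected[OF J(1) _ H] J(2) by (simp add: K_swap)
  have con: "connected C" unfolding C_def
  proof (rule connected_Un)
    show "connected (\<Union>n. K \<union> (F ^^ n) ` J)" by (rule connected_Union) (use cF K_props in auto)
    show "connected (\<Union>n. K \<union> (H ^^ n) ` J)" by (rule connected_Union) (use cH K_props in auto)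
    show "(\<Union>n. K \<union> (F ^^ n) ` J) \<inter> (\<Union>n. K \<union> (H ^^ n) ` J) \<noteq> {}" using K_props(3) by blast
  qed
  have FHJ: "F ` (H ^^ Suc n) ` J = (H ^^ n) ` J" for n
  proof -
    have "F (H w) = w" if "w \<in> (H ^^ n) ` J" for w
    proof (rule FH)
      have "H w \<in> (H ^^ Suc n) ` J" using that by auto
      then show "w \<in> ball 0 R" "H w \<in> ball 0 R" using that H[of n] H[of "Suc n"] cball_sub by blast+
    qed
    then show ?thesis by (force simp: image_image)
  qed
  have FFJ: "F ` (F ^^ n) ` J = (F ^^ Suc n) ` J" for n by (auto simp: image_image)
  have CF: "(F ^^ n) ` J \<subseteq> C" for n
    unfolding C_def by (rule le_supI1, rule SUP_upper2[of n], rule UNIV_I, rule sup_ge2)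
  have CH: "(H ^^ n) ` J \<subseteq> C" for n
    unfolding C_def by (rule le_supI2, rule SUP_upper2[of n], rule UNIV_I, rule sup_ge2)
  have CK: "K \<subseteq> C"
    unfolding C_def by (rule le_supI1, rule SUP_upper2[of 0], rule UNIV_I, rule sup_ge1)
  have CI: "C \<subseteq> D" if "K \<subseteq> D" "\<And>n. (F ^^ n) ` J \<subseteq> D" "\<And>n. (H ^^ n) ` J \<subseteq> D" for D
    unfolding C_def by (intro Un_least UN_least that)
  have "F ` C \<subseteq> C"
  proof -
    have "F ` (H ^^ n) ` J \<subseteq> C" for n
    proof (cases n)
      case 0
      then show ?thesis using CF[of 1] by simp
    next
      case (Suc k)
      then show ?thesis using FHJ[of k] CH[of k] by simp
    qed
    moreover have "F ` (F ^^ n) ` J \<subseteq> C" for n unfolding FFJ by (rule CF)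
    moreover have "F ` K \<subseteq> C" unfolding K_props(5) by (rule CK)
    ultimately have "C \<subseteq> F -` C" by (intro CI) (simp_all only: image_subset_iff_subset_vimage)
    then show ?thesis by (simp only: image_subset_iff_subset_vimage)
  qed
  moreover have "C \<subseteq> F ` C"
  proof (rule CI)
    show "K \<subseteq> F ` C" using image_mono[OF CK, of F] unfolding K_props(5) .
    show h: "(H ^^ n) ` J \<subseteq> F ` C" for n using image_mono[OF CH[of "Suc n"], of F] unfolding FHJ .
    show "(F ^^ n) ` J \<subseteq> F ` C" for n
    proof (cases n)
      case 0
      then show ?thesis using h[of 0] by simp
    next
      case (Suc k)
      show ?thesis using image_mono[OF CF[of k], of F] unfolding FFJ Suc .
    qed
  qed
  ultimately have "F ` C = C" by (rule subset_antisym)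
  moreover have "C \<subseteq> cball 0 r" by (intro CI K_props F H)
  moreover have "0 \<in> C" using K_props(3) CK by blast
  ultimately have "C \<subseteq> K" using con by (intro invariant_subset) (simp add: invariant_continuum_def)
  then show ?thesis using CF[of 0] by simp
qed

text \<open>The frontier of \<open>V\<close> lies in \<open>K\<close> and stays in the disc under
  iteration; by the maximum modulus principle so does \<open>V\<close>.\<close>

lemma bounded_component_iterates:
  assumes V: "open V" "bounded V" "frontier V \<subseteq> K" "V \<subseteq> cball 0 r"
  shows "(F ^^ n) ` V \<subseteq> cball 0 r"
proof -
  have cl: "closure V \<subseteq> cball 0 r" using V(4) by (simp add: closure_minimal)
  have "(F ^^ n) holomorphic_on V \<and> continuous_on (closure V) (F ^^ n) \<and> (F ^^ n) ` closure V \<subseteq> cball 0 r"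
  proof (induction n)
    case 0
    then show ?case using cl by (simp add: continuous_on_id)
  next
    case (Suc n)
    have c: "continuous_on (closure V) (F ^^ Suc n)" unfolding funpow.simps
      by (rule continuous_on_compose) (use Suc cont in \<open>auto intro: continuous_on_subset\<close>)
    have h: "(F ^^ Suc n) holomorphic_on V" unfolding funpow.simps
      by (rule holomorphic_on_compose_gen[where t = "ball 0 R"]) (use Suc holF cball_sub closure_subset[of V] in blast)+
    have "cmod ((F ^^ Suc n) z) \<le> r" if "z \<in> V" for z
    proof (rule maximum_modulus_frontier[where S = V and f = "F ^^ Suc n"])
      show "(F ^^ Suc n) holomorphic_on interior V" using h V(1) by (simp add: interior_open)
      show "cmod ((F ^^ Suc n) w) \<le> r" if "w \<in> frontier V" for w
        using funpow_K(1)[of w "Suc n"] that V(3) K_props(4) by (meson mem_cball_0 subsetD)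
    qed (use c V that in auto)
    then have "(F ^^ Suc n) ` closure V \<subseteq> cball 0 r"
      by (intro image_closure_subset[OF c]) auto
    then show ?case using c h by blast
  qed
  then show ?thesis using closure_subset[of V] by blast
qed

end

context mutually_inverse
begin

interpretation inv: mutually_inverse H F R r by (rule swap)

text \<open>A component of the complement that lies inside the disc meets the hypotheses of
  \<open>extend_K\<close> and would be swallowed by \<open>K\<close>.\<close>

lemma K_full: "connected (- K)"
proof (rule ccontr)
  assume nc: "\<not> connected (- K)"
  have out: "connected (- cball (0::complex) r)"
    by (rule connected_complement_bounded_convex) auto
  have outK: "- cball 0 r \<subseteq> - K" using K_props(4) by blast
  \<comment> \<open>If every component met the connected exterior of the disc, that exterior would
    join them all.\<close>
  have "\<exists>V\<in>components (- K). V \<inter> - cball 0 r = {}"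
  proof (rule ccontr)
    assume no: "\<not> ?thesis"
    have "connected (\<Union>V\<in>components (- K). V \<union> - cball 0 r)"
    proof (rule connected_Union)
      have ne: "- cball (0::complex) r \<noteq> {}"
      proof -
        have "of_real (r + 1) \<in> - cball (0::complex) r" using r by simp
        then show ?thesis by blast
      qed
      show "connected S" if "S \<in> (\<lambda>V. V \<union> - cball 0 r) ` components (- K)" for S
        using that out no in_components_connected by (auto intro!: connected_Un)
      show "\<Inter> ((\<lambda>V. V \<union> - cball 0 r) ` components (- K)) \<noteq> {}" using ne by blast
    qed
    moreover have "(\<Union>V\<in>components (- K). V \<union> - cball 0 r) = - K"
    proof -
      have "- K \<noteq> {}" using nc by auto
      then have "components (- K) \<noteq> {}" by (simp add: components_eq_empty)
      then have "(\<Union>V\<in>components (- K). V \<union> - cball 0 r) = \<Union>(components (- K)) \<union> - cball 0 r" by auto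
      also have "\<dots> = - K" using outK unfolding Union_components by (rule Un_absorb2)
      finally show ?thesis .
    qed
    ultimately show False using nc by simp
  qed
  then obtain V where V: "V \<in> components (- K)" "V \<subseteq> cball 0 r" by blast
  have oV: "open V" using V(1) K_props(1) by (metis compact_imp_closed open_Compl open_components)
  have bV: "bounded V" using V(2) bounded_cball bounded_subset by blast
  have neV: "V \<noteq> {}" "V \<noteq> UNIV" using V bV in_components_nonempty by auto
  have fV: "frontier V \<subseteq> K"
  proof -
    have "frontier V \<subseteq> frontier (- K)" using V(1) by (rule frontier_of_components_subset)
    also have "\<dots> \<subseteq> K" using K_props(1) by (simp add: frontier_complement compact_imp_closed frontier_subset_closed)
    finally show ?thesis .
  qed
  have "V \<subseteq> K"
  proof (rule extend_K)
    show "connected V" using V(1) by (rule in_components_connected)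
    have "frontier V \<noteq> {}" using neV by (simp add: frontier_eq_empty)
    then show "closure V \<inter> K \<noteq> {}" using fV by (auto simp: frontier_def)
    show "(F ^^ n) ` V \<subseteq> cball 0 r" for n by (rule bounded_component_iterates[OF oV bV fV V(2)])
    show "(H ^^ n) ` V \<subseteq> cball 0 r" for n
      by (rule inv.bounded_component_iterates[OF oV bV _ V(2)]) (simp add: K_swap fV)
  qed
  then show False using V(1) neV(1) in_components_subset by blast
qed

end

section \<open>The Riemann map of the exterior of \<open>K\<close> and its universal
  covering\<close>

text \<open>This is the complement of \<open>T\<close> on the Riemann sphere, seen through inversion
  with infinity at 0. Boundedness of \<open>T\<close> provides a disc about that point.\<close>

lemma open_inverse_complement:
  assumes "closed T" "bounded T"
  shows "open {z::complex. z = 0 \<or> inverse z \<notin> T}"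
proof -
  obtain B where B: "B > 0" "\<And>z. z \<in> T \<Longrightarrow> cmod z \<le> B" using assms(2) bounded_pos by blast
  have eq: "{z::complex. z = 0 \<or> inverse z \<notin> T} = ball 0 (1 / B) \<union> ((- {0}) \<inter> inverse -` (- T))"
  proof (intro set_eqI iffI)
    fix z assume "z \<in> ball 0 (1 / B) \<union> ((- {0}) \<inter> inverse -` (- T))"
    moreover have "inverse z \<notin> T" if "z \<noteq> 0" "cmod z < 1 / B"
    proof
      assume "inverse z \<in> T"
      then have "1 / cmod z \<le> B" using B(2)[of "inverse z"] by (simp add: norm_inverse inverse_eq_divide norm_divide)
      then have "1 \<le> B * cmod z" using that by (simp add: pos_divide_le_eq)
      then show False using that B(1) by (simp add: pos_less_divide_eq mult.commute)
    qed
    ultimately show "z \<in> {z. z = 0 \<or> inverse z \<notin> T}" by auto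
  qed (use B in auto)
  have "open ((- {0}) \<inter> inverse -` (- T))"
    by (rule continuous_open_preimage) (use assms(1) in \<open>auto intro!: continuous_intros\<close>)
  then show ?thesis unfolding eq by (intro open_Un open_ball)
qed

text \<open>Inversion sends 0, a point of \<open>K\<close>, to infinity. A bounded component of the
  complement of the set would yield a piece of \<open>K\<close> split off from 0, contrary to
  connectedness.\<close>

lemma exterior_simply_connected:
  fixes K :: "complex set"
  assumes K: "compact K" "connected K" "connected (- K)" "0 \<in> K"
  shows "simply_connected {z. z = 0 \<or> inverse z \<notin> K}" (is "simply_connected ?S")
proof -
  have oS: "open ?S" using K(1) by (intro open_inverse_complement compact_imp_closed compact_imp_bounded)
  have S_eq: "?S = {0} \<union> inverse ` (- K)"
  proof (intro set_eqI iffI)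
    fix z assume "z \<in> ?S"
    then have "z = 0 \<or> (inverse z \<in> - K \<and> z = inverse (inverse z))" by auto
    then show "z \<in> {0} \<union> inverse ` (- K)" by blast
  next
    fix z assume "z \<in> {0} \<union> inverse ` (- K)"
    then show "z \<in> ?S" by auto
  qed
  have "connected ?S"
    unfolding S_eq
  proof (rule connected_Un_closure)
    show "connected (inverse ` (- K))"
      by (intro connected_continuous_image K continuous_intros) (use K(4) in auto)
    have "\<exists>y\<in>inverse ` (- K). dist y 0 < e" if "e > 0" for e
    proof -
      obtain d where d: "d > 0" "ball 0 d \<subseteq> ?S" using oS open_contains_ball[of ?S] by blast
      define z :: complex where "z = of_real (min d e / 2)"
      have z: "z \<noteq> 0" "cmod z < d" "cmod z < e" using d that by (auto simp: z_def)
      then have "z \<in> ?S" using d(2) by auto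
      then have "z \<in> inverse ` (- K)" using z(1) S_eq by blast
      then show ?thesis by (rule bexI[rotated]) (use z(3) in simp)
    qed
    then show "closure (inverse ` (- K)) \<inter> {0} \<noteq> {}" by (simp add: closure_approachable)
  qed simp
  moreover have "\<not> bounded C" if C: "C \<in> components (- ?S)" for C
  proof
    assume bC: "bounded C"
    have cl: "closed (- ?S)" using oS by (rule closed_Compl)
    have cC: "compact C" using closed_components[OF cl C] bC by (simp add: compact_eq_bounded_closed)
    \<comment> \<open>A component need not be relatively open, so it is enlarged to a compact
      relatively open \<open>T\<close>. Inverted, this is a clopen subset of \<open>K\<close> that
      misses 0.\<close>
    obtain T where T: "openin (top_of_set (- ?S)) T" "compact T" "C \<subseteq> T" "T \<subseteq> UNIV"
      by (rule Sura_Bura_clopen_subset[OF closed_imp_locally_compact[OF cl] C cC open_UNIV subset_UNIV])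
    then obtain Q where Q: "open Q" "T = - ?S \<inter> Q" unfolding openin_open by blast
    have mem: "t \<in> T \<longleftrightarrow> t \<noteq> 0 \<and> inverse t \<in> K \<and> t \<in> Q" for t unfolding Q(2) by simp
    have T0: "0 \<notin> T" using mem[of 0] by simp
    have A: "compact (inverse ` T)"
      by (intro compact_continuous_image continuous_intros T) (use T0 in metis)
    have AK: "inverse ` T = K \<inter> ((- {0}) \<inter> inverse -` Q)"
    proof (intro set_eqI iffI)
      fix x assume "x \<in> K \<inter> ((- {0}) \<inter> inverse -` Q)"
      then have "inverse x \<in> T" unfolding mem by simp
      then have "inverse (inverse x) \<in> inverse ` T" by (rule imageI)
      then show "x \<in> inverse ` T" by simp
    next
      fix x assume "x \<in> inverse ` T"
      then obtain t where "x = inverse t" "t \<in> T" by (rule imageE)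
      then show "x \<in> K \<inter> ((- {0}) \<inter> inverse -` Q)" using mem[of t] by simp
    qed
    have oQ: "open ((- {0}) \<inter> inverse -` Q)"
      by (rule continuous_open_preimage) (use Q(1) in \<open>auto intro!: continuous_intros\<close>)
    have "openin (top_of_set K) (inverse ` T)" unfolding AK using oQ by (rule openin_open_Int)
    moreover have "closedin (top_of_set K) (inverse ` T)"
      using A AK by (intro closed_subset compact_imp_closed) auto
    ultimately have "inverse ` T = {} \<or> inverse ` T = K"
      using K(2) unfolding connected_clopen by blast
    moreover have "inverse ` T \<noteq> {}" using T(3) in_components_nonempty[OF C] by auto
    moreover have "0 \<notin> inverse ` T" using T0 by auto
    ultimately show False using K(4) by blast
  qed
  ultimately show ?thesis using simply_connected_eq_unbounded_complement_components[OF oS] by blast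
qed

text \<open>\<open>f\<close> is the Riemann map from the exterior of \<open>K\<close> to the
  punctured disc, with inverse \<open>inverse (g w)\<close>. Working with \<open>g\<close> places
  the point at infinity at \<open>g 0 = 0\<close> and avoids a pole.\<close>

locale exterior_chart =
  fixes K :: "complex set" and g f :: "complex \<Rightarrow> complex"
  assumes K: "compact K" "0 \<in> K"
    and holg: "g holomorphic_on ball 0 1" and g0: "g 0 = 0"
    and gK: "\<And>w. w \<in> ball 0 1 \<Longrightarrow> w \<noteq> 0 \<Longrightarrow> g w \<noteq> 0 \<and> inverse (g w) \<notin> K"
    and holf: "f holomorphic_on - K"
    and fg: "\<And>w. w \<in> ball 0 1 \<Longrightarrow> w \<noteq> 0 \<Longrightarrow> f (inverse (g w)) = w"
    and gf: "\<And>z. z \<notin> K \<Longrightarrow> f z \<in> ball 0 1 \<and> f z \<noteq> 0 \<and> inverse (g (f z)) = z"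

lemma exterior_chart_exists:
  assumes K: "compact K" "connected K" "connected (- K)" "0 \<in> K" "K \<noteq> {0}"
  obtains g f where "exterior_chart K g f"
proof -
  define S where "S = {z. z = 0 \<or> inverse z \<notin> K}"
  have oS: "open S" unfolding S_def using K(1) by (intro open_inverse_complement compact_imp_closed compact_imp_bounded)
  have "simply_connected S" unfolding S_def by (rule exterior_simply_connected[OF K(1-4)])
  moreover have "0 \<in> S" by (simp add: S_def)
  moreover obtain k where "k \<in> K" "k \<noteq> 0" using K(4,5) by blast
  then have "inverse k \<notin> S" by (simp add: S_def)
  ultimately obtain f0 g0 where fg: "f0 holomorphic_on S" "g0 holomorphic_on ball 0 1"
      "\<And>z. z \<in> S \<Longrightarrow> f0 z \<in> ball 0 1 \<and> g0 (f0 z) = z" "\<And>z. z \<in> ball 0 1 \<Longrightarrow> g0 z \<in> S \<and> f0 (g0 z) = z"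
    using Riemann_mapping_theorem[of S] oS by blast
  have S0: "0 \<in> S" by fact
  \<comment> \<open>An automorphism of the disc normalizes the Riemann map so that infinity
    corresponds to 0.\<close>
  obtain u v where uv: "u (f0 0) = 0" "u holomorphic_on ball 0 1" "u ` ball 0 1 \<subseteq> ball 0 1"
      "v holomorphic_on ball 0 1" "v ` ball 0 1 \<subseteq> ball 0 1"
      "\<And>z. z \<in> ball 0 1 \<Longrightarrow> u (v z) = z" "\<And>z. z \<in> ball 0 1 \<Longrightarrow> v (u z) = z"
    using ball_biholomorphism_exists[of "f0 0"] fg(3)[OF S0] by blast
  define g where "g w = g0 (v w)" for w
  define f where "f z = u (f0 (inverse z))" for z
  have v0: "v 0 = f0 0" using uv(7)[of "f0 0"] uv(1) fg(3)[OF S0] by simp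
  have invS: "inverse z \<in> S" if "z \<notin> K" for z using that by (simp add: S_def)
  have vb: "v w \<in> ball 0 1" if "w \<in> ball 0 1" for w using uv(5) that by blast
  have ub: "u w \<in> ball 0 1" if "w \<in> ball 0 1" for w using uv(3) that by blast
  have gS: "g w \<in> S" if "w \<in> ball 0 1" for w using fg(4)[OF vb[OF that]] by (simp add: g_def)
  have ug: "u (f0 (g w)) = w" if "w \<in> ball 0 1" for w using fg(4)[OF vb[OF that]] uv(6)[OF that] by (simp add: g_def)
  have gg0: "g 0 = 0" using fg(3)[OF S0] v0 by (simp add: g_def)
  have gn: "g w \<noteq> 0" if "w \<in> ball 0 1" "w \<noteq> 0" for w
    using ug[OF that(1)] that(2) uv(1) by metis
  have "exterior_chart K g f"
  proof
    have "g0 \<circ> v holomorphic_on ball 0 1" by (rule holomorphic_on_compose_gen[OF uv(4) fg(2) uv(5)])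
    then show "g holomorphic_on ball 0 1" by (simp add: o_def g_def[abs_def])
    have i: "inverse holomorphic_on - K" by (intro holomorphic_intros) (use K(4) in auto)
    have "f0 \<circ> inverse holomorphic_on - K" by (rule holomorphic_on_compose_gen[OF i fg(1)]) (use invS in auto)
    then have "u \<circ> (f0 \<circ> inverse) holomorphic_on - K"
      by (rule holomorphic_on_compose_gen[OF _ uv(2)]) (use invS fg(3) in auto)
    then show "f holomorphic_on - K" by (simp add: o_def f_def[abs_def])
    show "g w \<noteq> 0 \<and> inverse (g w) \<notin> K" if "w \<in> ball 0 1" "w \<noteq> 0" for w
      using gn[OF that] gS[OF that(1)] by (auto simp: S_def)
    show "f (inverse (g w)) = w" if "w \<in> ball 0 1" "w \<noteq> 0" for w
      using ug[OF that(1)] by (simp add: f_def)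
    show "f z \<in> ball 0 1 \<and> f z \<noteq> 0 \<and> inverse (g (f z)) = z" if "z \<notin> K" for z
    proof -
      have b: "f0 (inverse z) \<in> ball 0 1" "g0 (f0 (inverse z)) = inverse z" using fg(3)[OF invS[OF that]] by auto
      have fz: "f z \<in> ball 0 1" using ub[OF b(1)] by (simp add: f_def)
      have gfz: "g (f z) = inverse z" using uv(7)[OF b(1)] b(2) by (simp add: f_def g_def)
      have "z \<noteq> 0" using that K(4) by auto
      then have "f z \<noteq> 0" using gfz gg0 by auto
      then show ?thesis using fz gfz by simp
    qed
  qed (use K gg0 in auto)
  then show ?thesis by (rule that)
qed

context exterior_chart
begin

definition E :: "complex \<Rightarrow> complex" where "E \<zeta> = exp (2 * of_real pi * \<i> * \<zeta>)"

text \<open>The universal covering of the exterior of \<open>K\<close> by the upper half-plane, with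
  the integer translations as deck group. Heights tending to 0 mean approach to \<open>K\<close>, so
  the real line modulo 1 is the circle of prime ends.\<close>

definition \<Psi> :: "complex \<Rightarrow> complex" where "\<Psi> \<zeta> = inverse (g (E \<zeta>))"

lemma norm_E: "cmod (E \<zeta>) = exp (- (2 * pi * Im \<zeta>))"
  by (simp add: E_def)

lemma E_nonzero [simp]: "E \<zeta> \<noteq> 0"
  by (simp add: E_def)

lemma E_ball: "0 < Im \<zeta> \<Longrightarrow> E \<zeta> \<in> ball 0 1"
  by (simp add: norm_E)

lemma E_eq_iff: "E \<zeta> = E \<xi> \<longleftrightarrow> (\<exists>n::int. \<zeta> = \<xi> + of_int n)"
proof -
  have "E \<zeta> = E \<xi> \<longleftrightarrow> (\<exists>n::int. 2 * of_real pi * \<i> * \<zeta> = 2 * of_real pi * \<i> * \<xi> + (of_int (2 * n) * pi) * \<i>)"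
    unfolding E_def by (rule exp_eq)
  also have "\<dots> \<longleftrightarrow> (\<exists>n::int. 2 * of_real pi * \<i> * \<zeta> = 2 * of_real pi * \<i> * (\<xi> + of_int n))"
    by (simp add: algebra_simps)
  finally show ?thesis by simp
qed

lemma \<Psi>_notin: "0 < Im \<zeta> \<Longrightarrow> \<Psi> \<zeta> \<notin> K"
  unfolding \<Psi>_def using gK[OF E_ball] by simp

lemma f_\<Psi>: "0 < Im \<zeta> \<Longrightarrow> f (\<Psi> \<zeta>) = E \<zeta>"
  unfolding \<Psi>_def using fg[OF E_ball] by simp

lemma \<Psi>_eq_iff:
  assumes "0 < Im \<zeta>" "0 < Im \<xi>"
  shows "\<Psi> \<zeta> = \<Psi> \<xi> \<longleftrightarrow> (\<exists>n::int. \<zeta> = \<xi> + of_int n)"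
  using f_\<Psi>[OF assms(1)] f_\<Psi>[OF assms(2)] E_eq_iff[of \<zeta> \<xi>] unfolding \<Psi>_def by metis

lemma \<Psi>_periodic: "\<Psi> (\<zeta> + of_int n) = \<Psi> \<zeta>"
  unfolding \<Psi>_def using E_eq_iff[of "\<zeta> + of_int n" \<zeta>] by auto

lemma hol_E: "E holomorphic_on A"
  unfolding E_def by (intro holomorphic_intros)

lemma hol_\<Psi>: "\<Psi> holomorphic_on {\<zeta>. 0 < Im \<zeta>}"
proof -
  have "g \<circ> E holomorphic_on {\<zeta>. 0 < Im \<zeta>}"
    by (rule holomorphic_on_compose_gen[OF hol_E holg]) (use E_ball in auto)
  then have "(\<lambda>\<zeta>. inverse ((g \<circ> E) \<zeta>)) holomorphic_on {\<zeta>. 0 < Im \<zeta>}"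
    by (rule holomorphic_on_inverse) (use gK[OF E_ball] in auto)
  then show ?thesis by (simp add: o_def \<Psi>_def[abs_def])
qed

lemma E_preimage:
  assumes "w \<in> ball 0 1" "w \<noteq> 0"
  obtains \<zeta> where "0 < Im \<zeta>" "E \<zeta> = w"
proof -
  define \<zeta> where "\<zeta> = Ln w / (2 * of_real pi * \<i>)"
  have "E \<zeta> = w" using assms(2) by (simp add: E_def \<zeta>_def exp_Ln)
  moreover from this have "exp (- (2 * pi * Im \<zeta>)) < 1" using norm_E[of \<zeta>] assms(1) by simp
  then have "0 < Im \<zeta>" by (simp add: zero_less_mult_iff)
  ultimately show ?thesis using that by blast
qed

lemma \<Psi>_surj:
  assumes "z \<notin> K"
  obtains \<zeta> where "0 < Im \<zeta>" "\<Psi> \<zeta> = z" "E \<zeta> = f z"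
  using gf[OF assms] E_preimage[of "f z"] unfolding \<Psi>_def by metis

lemma \<Psi>_lift:
  assumes S: "open S" "convex S" and \<phi>: "\<phi> holomorphic_on S" "\<And>z. z \<in> S \<Longrightarrow> \<phi> z \<notin> K"
  obtains \<Phi> where "\<Phi> holomorphic_on S" "\<And>z. z \<in> S \<Longrightarrow> 0 < Im (\<Phi> z) \<and> \<Psi> (\<Phi> z) = \<phi> z"
proof -
  have "f \<circ> \<phi> holomorphic_on S" by (rule holomorphic_on_compose_gen[OF \<phi>(1) holf]) (use \<phi>(2) in auto)
  moreover have "(f \<circ> \<phi>) z \<noteq> 0" if "z \<in> S" for z using gf[OF \<phi>(2)[OF that]] by simp
  moreover have "simply_connected S" using S(2) by (rule convex_imp_simply_connected)
  ultimately obtain L where L: "L holomorphic_on S" "\<And>z. z \<in> S \<Longrightarrow> (f \<circ> \<phi>) z = exp (L z)"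
    using simply_connected_eq_holomorphic_log[OF S(1)] by metis
  define \<Phi> where "\<Phi> z = L z / (2 * of_real pi * \<i>)" for z
  have "\<Phi> holomorphic_on S" unfolding \<Phi>_def by (intro holomorphic_intros L) auto
  moreover have "0 < Im (\<Phi> z) \<and> \<Psi> (\<Phi> z) = \<phi> z" if "z \<in> S" for z
  proof -
    have E: "E (\<Phi> z) = f (\<phi> z)" using L(2)[OF that] by (simp add: E_def \<Phi>_def)
    then have "exp (- (2 * pi * Im (\<Phi> z))) < 1" using norm_E[of "\<Phi> z"] gf[OF \<phi>(2)[OF that]] by simp
    then have "0 < Im (\<Phi> z)" by (simp add: zero_less_mult_iff)
    then show ?thesis using E gf[OF \<phi>(2)[OF that]] by (simp add: \<Psi>_def)
  qed
  ultimately show ?thesis by (rule that)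
qed

lemma inj_g: "inj_on g (ball 0 1)"
proof (rule inj_onI)
  fix w w' :: complex assume "w \<in> ball 0 1" "w' \<in> ball 0 1" "g w = g w'"
  then show "w = w'" using fg[of w] fg[of w'] gK[of w] gK[of w'] g0 by metis
qed

text \<open>Off \<open>V\<close> the modulus of \<open>f\<close> is bounded by some
  \<open>\<rho> < 1\<close>: by compactness inside a large disc, and by 1 / 2 outside of it, where
  \<open>f\<close> is close to 0. Small heights give
  \<open>cmod (E \<zeta>) > \<rho>\<close>.\<close>

lemma \<Psi>_near:
  assumes "open V" "K \<subseteq> V"
  obtains \<eta> where "0 < \<eta>" "\<And>\<zeta>. 0 < Im \<zeta> \<Longrightarrow> Im \<zeta> < \<eta> \<Longrightarrow> \<Psi> \<zeta> \<in> V"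
proof -
  have "open (g ` ball 0 (1 / 2))"
  proof (rule open_mapping_thm3)
    have sub: "ball (0::complex) (1 / 2) \<subseteq> ball 0 1" by (rule subset_ball) simp
    show "g holomorphic_on ball 0 (1 / 2)" by (rule holomorphic_on_subset[OF holg sub])
    show "inj_on g (ball 0 (1 / 2))" by (rule inj_on_subset[OF inj_g sub])
  qed simp
  moreover have "0 \<in> g ` ball 0 (1 / 2)" using g0 by (intro image_eqI[of _ _ 0]) auto
  ultimately obtain s where s: "s > 0" "ball 0 s \<subseteq> g ` ball 0 (1 / 2)" using open_contains_ball by metis
  define Q where "Q = cball 0 (1 / s) - V"
  have "compact Q" unfolding Q_def using assms(1) by (intro compact_diff) auto
  have QK: "Q \<subseteq> - K" using assms(2) by (auto simp: Q_def)
  have cf: "continuous_on Q f" using holf QK by (auto intro: holomorphic_on_imp_continuous_on continuous_on_subset)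
  have "compact (insert (1 / 2) ((\<lambda>z. cmod (f z)) ` Q))"
    using \<open>compact Q\<close> cf by (intro compact_insert compact_continuous_image continuous_intros)
  then obtain \<rho> where \<rho>: "\<rho> \<in> insert (1 / 2) ((\<lambda>z. cmod (f z)) ` Q)" "\<And>t. t \<in> insert (1 / 2) ((\<lambda>z. cmod (f z)) ` Q) \<Longrightarrow> t \<le> \<rho>"
    using compact_attains_sup[of "insert (1 / 2) ((\<lambda>z. cmod (f z)) ` Q)"] by blast
  have \<rho>1: "1 / 2 \<le> \<rho>" using \<rho>(2)[of "1 / 2"] by simp
  have \<rho>2: "\<rho> < 1" using \<rho>(1) gf QK by auto
  have out: "cmod (f z) \<le> \<rho>" if "z \<notin> V" for z
  proof (cases "cmod z \<le> 1 / s")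
    case True
    then have "z \<in> Q" using that by (simp add: Q_def)
    then show ?thesis using \<rho>(2) by auto
  next
    case False
    have z0: "z \<noteq> 0" using that assms(2) K(2) by auto
    have "1 / s < cmod z" using False by simp
    then have "1 / cmod z < s" using s(1) z0 by (simp add: pos_divide_less_eq mult.commute)
    then have "cmod (inverse z) < s" by (simp add: norm_inverse inverse_eq_divide norm_divide)
    then obtain w where w: "w \<in> ball 0 (1 / 2)" "inverse z = g w" using s(2) by auto
    have "w \<noteq> 0" using w(2) z0 g0 by auto
    then have "f (inverse (g w)) = w" using w(1) by (intro fg) auto
    then have "f z = w" using w(2) by (metis inverse_inverse_eq)
    then show ?thesis using w(1) \<rho>1 by simp
  qed
  define \<eta> where "\<eta> = - ln \<rho> / (2 * pi)"
  have "ln \<rho> < 0" using \<rho>1 \<rho>2 by simp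
  then have "\<eta> > 0" unfolding \<eta>_def by (intro divide_pos_pos) auto
  moreover have "\<Psi> \<zeta> \<in> V" if "0 < Im \<zeta>" "Im \<zeta> < \<eta>" for \<zeta>
  proof (rule ccontr)
    assume "\<Psi> \<zeta> \<notin> V"
    then have "cmod (E \<zeta>) \<le> \<rho>" using out[of "\<Psi> \<zeta>"] f_\<Psi>[OF that(1)] by simp
    then have "- (2 * pi * Im \<zeta>) \<le> ln \<rho>" using \<rho>1 by (simp add: norm_E ln_ge_iff)
    moreover have "Im \<zeta> * (2 * pi) < - ln \<rho>"
      by (rule iffD1[OF pos_less_divide_eq]) (use that(2) in \<open>simp_all add: \<eta>_def\<close>)
    ultimately show False by (simp add: mult.commute)
  qed
  ultimately show ?thesis by (rule that)
qed

text \<open>Under inversion the complement becomes the image of a smaller closed disc under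
  \<open>g\<close>, up to the point at infinity. Together with \<open>\<Psi>_near\<close>, these
  sets form a neighbourhood basis of \<open>K\<close>.\<close>

lemma \<Psi>_strip_open:
  assumes "\<eta> > 0"
  shows "open (K \<union> \<Psi> ` {\<zeta>. 0 < Im \<zeta> \<and> Im \<zeta> < \<eta>})"
proof -
  define \<rho> where "\<rho> = exp (- (2 * pi * \<eta>))"
  have \<rho>: "0 < \<rho>" "\<rho> < 1" using assms by (auto simp: \<rho>_def)
  define T where "T = g ` cball 0 \<rho>"
  have "cball 0 \<rho> \<subseteq> ball (0::complex) 1" using \<rho> by auto
  then have "compact T" unfolding T_def using holg
    by (intro compact_continuous_image) (auto intro: holomorphic_on_imp_continuous_on continuous_on_subset)
  then have "open {z. z = 0 \<or> inverse z \<notin> T}"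
    by (intro open_inverse_complement compact_imp_closed compact_imp_bounded)
  also have "{z. z = 0 \<or> inverse z \<notin> T} = K \<union> \<Psi> ` {\<zeta>. 0 < Im \<zeta> \<and> Im \<zeta> < \<eta>}"
  proof (intro set_eqI iffI)
    fix z assume z: "z \<in> {z. z = 0 \<or> inverse z \<notin> T}"
    show "z \<in> K \<union> \<Psi> ` {\<zeta>. 0 < Im \<zeta> \<and> Im \<zeta> < \<eta>}"
    proof (cases "z \<in> K")
      case False
      then obtain \<zeta> where \<zeta>: "0 < Im \<zeta>" "\<Psi> \<zeta> = z" "E \<zeta> = f z" by (rule \<Psi>_surj)
      have "z \<noteq> 0" using False K(2) by auto
      then have "inverse z \<notin> T" using z by auto
      moreover have "inverse z = g (E \<zeta>)" using \<zeta>(2) by (auto simp: \<Psi>_def)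
      ultimately have "E \<zeta> \<notin> cball 0 \<rho>" unfolding T_def by blast
      then have "\<rho> < exp (- (2 * pi * Im \<zeta>))" by (simp add: norm_E)
      then have "Im \<zeta> < \<eta>" by (simp add: \<rho>_def)
      then show ?thesis using \<zeta> by blast
    qed simp
  next
    fix z assume z: "z \<in> K \<union> \<Psi> ` {\<zeta>. 0 < Im \<zeta> \<and> Im \<zeta> < \<eta>}"
    have "inverse z \<notin> T" if "z \<noteq> 0"
    proof
      assume "inverse z \<in> T"
      then obtain w where w: "cmod w \<le> \<rho>" "inverse z = g w" unfolding T_def by auto
      have wb: "w \<in> ball 0 1" "w \<noteq> 0" using w \<rho> g0 that by auto
      have zw: "z = inverse (g w)" using w(2) by (metis inverse_inverse_eq)
      then have "z \<notin> K" using gK[OF wb] by simp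
      then obtain \<zeta> where \<zeta>: "0 < Im \<zeta>" "Im \<zeta> < \<eta>" "z = \<Psi> \<zeta>" using z by auto
      then have "E \<zeta> = w" using f_\<Psi>[OF \<zeta>(1)] fg[OF wb] zw by simp
      then show False using w(1) \<zeta>(2) norm_E[of \<zeta>] by (simp add: \<rho>_def)
    qed
    then show "z \<in> {z. z = 0 \<or> inverse z \<notin> T}" by blast
  qed
  finally show ?thesis .
qed

text \<open>\<open>Q\<close> has a holomorphic logarithm on the disc and adds no winding, while
  \<open>E\<close> runs once counterclockwise and stands in the denominator. Hence loops described
  by \<open>\<Psi>\<close> run clockwise.\<close>

lemma winding_inverse_loop:
  assumes Q: "Q holomorphic_on ball 0 1" "\<And>w. w \<in> ball 0 1 \<Longrightarrow> Q w \<noteq> 0" and y: "y > 0"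
  shows "winding_number (\<lambda>x. Q (E (of_real x + \<i> * of_real y)) / E (of_real x + \<i> * of_real y)) 0 = -1"
proof -
  have "simply_connected (ball (0::complex) 1)" by (rule convex_imp_simply_connected) simp
  then obtain q where q: "q holomorphic_on ball 0 1" "\<And>w. w \<in> ball 0 1 \<Longrightarrow> Q w = exp (q w)"
    using simply_connected_eq_holomorphic_log[of "ball (0::complex) 1"] Q by (metis open_ball)
  define \<zeta> where "\<zeta> x = of_real x + \<i> * of_real y" for x :: real
  have \<zeta>: "0 < Im (\<zeta> x)" for x using y by (simp add: \<zeta>_def)
  define p where "p x = q (E (\<zeta> x)) - 2 * of_real pi * \<i> * \<zeta> x" for x
  have cE: "continuous_on {0..1} (\<lambda>x. E (\<zeta> x))" unfolding E_def \<zeta>_def by (intro continuous_intros)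
  have "continuous_on {0..1} (\<lambda>x. q (E (\<zeta> x)))"
    by (rule continuous_on_compose2[OF holomorphic_on_imp_continuous_on[OF q(1)] cE]) (use E_ball[OF \<zeta>] in auto)
  then have "path p" unfolding path_def p_def by (intro continuous_intros) (auto simp: \<zeta>_def intro!: continuous_intros)
  then have w: "winding_number (exp \<circ> p) 0 = (pathfinish p - pathstart p) / (2 * of_real pi * \<i>)"
    by (rule winding_number_compose_exp)
  have "E (\<zeta> 1) = E (\<zeta> 0)" unfolding E_eq_iff by (intro exI[of _ 1]) (simp add: \<zeta>_def)
  then have pp: "pathfinish p - pathstart p = - (2 * of_real pi * \<i>)"
    by (simp add: pathfinish_def pathstart_def p_def \<zeta>_def algebra_simps)
  have "winding_number (exp \<circ> p) 0 = -1" unfolding w pp by simp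
  moreover have "exp \<circ> p = (\<lambda>x. Q (E (\<zeta> x)) / E (\<zeta> x))"
    using q(2)[OF E_ball[OF \<zeta>]] by (auto simp: p_def E_def exp_diff fun_eq_iff)
  ultimately show ?thesis by (simp add: \<zeta>_def)
qed

lemma g_factor:
  obtains k where "k holomorphic_on ball 0 1" "\<And>w. w \<in> ball 0 1 \<Longrightarrow> k w \<noteq> 0" "\<And>w. w \<in> ball 0 1 \<Longrightarrow> g w = w * k w"
proof -
  define k where "k w = (if w = 0 then deriv g 0 else (g w - g 0) / (w - 0))" for w
  have "k holomorphic_on ball 0 1" unfolding k_def by (rule pole_lemma[OF holg]) simp
  moreover have "deriv g 0 \<noteq> 0" by (rule holomorphic_injective_imp_regular[OF holg _ inj_g]) auto
  then have "k w \<noteq> 0" if "w \<in> ball 0 1" for w using gK[OF that] g0 by (auto simp: k_def)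
  moreover have "g w = w * k w" for w using g0 by (simp add: k_def)
  ultimately show ?thesis using that by blast
qed

lemma winding_\<Psi>:
  assumes "k \<in> K" "y > 0"
  shows "winding_number (\<lambda>x. \<Psi> (of_real x + \<i> * of_real y)) k = -1"
proof -
  obtain h where h: "h holomorphic_on ball 0 1" "\<And>w. w \<in> ball 0 1 \<Longrightarrow> h w \<noteq> 0" "\<And>w. w \<in> ball 0 1 \<Longrightarrow> g w = w * h w"
    by (rule g_factor) blast
  define Q where "Q w = inverse (h w) - k * w" for w
  have Qw: "Q w / w = inverse (g w) - k" if "w \<in> ball 0 1" "w \<noteq> 0" for w
    using that h by (simp add: Q_def field_simps)
  have "Q w \<noteq> 0" if "w \<in> ball 0 1" for w
  proof (cases "w = 0")
    case True
    then show ?thesis using h(2)[OF that] by (simp add: Q_def)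
  next
    case False
    then have "inverse (g w) \<noteq> k" using gK[OF that] assms(1) by auto
    then show ?thesis using Qw[OF that False] by auto
  qed
  moreover have "Q holomorphic_on ball 0 1" unfolding Q_def using h(2) by (intro holomorphic_intros h(1)) auto
  ultimately have "winding_number (\<lambda>x. Q (E (of_real x + \<i> * of_real y)) / E (of_real x + \<i> * of_real y)) 0 = -1"
    using assms(2) by (intro winding_inverse_loop)
  moreover have "Q (E (of_real x + \<i> * of_real y)) / E (of_real x + \<i> * of_real y) = \<Psi> (of_real x + \<i> * of_real y) - k" for x :: real
    using Qw[OF E_ball] assms(2) by (simp add: \<Psi>_def)
  ultimately show ?thesis by (subst winding_number_offset) simp
qed

text \<open>The model displacement: translation by 1 / 2 replaces \<open>w\<close> by
  \<open>- w\<close>, and injectivity of \<open>g\<close> keeps the difference away from 0. The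
  displacement of a map without boundary fixed points will be deformed into it.\<close>

lemma winding_antipodal:
  assumes "y > 0"
  shows "winding_number (\<lambda>x. \<Psi> (of_real x + \<i> * of_real y + 1 / 2) - \<Psi> (of_real x + \<i> * of_real y)) 0 = -1"
proof -
  obtain h where h: "h holomorphic_on ball 0 1" "\<And>w. w \<in> ball 0 1 \<Longrightarrow> h w \<noteq> 0" "\<And>w. w \<in> ball 0 1 \<Longrightarrow> g w = w * h w"
    by (rule g_factor) blast
  define Q where "Q w = - inverse (h (- w)) - inverse (h w)" for w
  have Qw: "Q w / w = inverse (g (- w)) - inverse (g w)" if "w \<in> ball 0 1" "w \<noteq> 0" for w
    using that h(2)[of w] h(2)[of "- w"] h(3)[of w] h(3)[of "- w"] by (simp add: Q_def field_simps)
  have "Q w \<noteq> 0" if "w \<in> ball 0 1" for w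
  proof (cases "w = 0")
    case True
    then show ?thesis using h(2)[OF that] by (simp add: Q_def)
  next
    case False
    then have "g (- w) \<noteq> g w" using inj_onD[OF inj_g, of "- w" w] that by auto
    then have "inverse (g (- w)) - inverse (g w) \<noteq> 0" by simp
    then show ?thesis using Qw[OF that False] by auto
  qed
  moreover have "Q holomorphic_on ball 0 1"
  proof -
    have "h \<circ> uminus holomorphic_on ball 0 1"
      by (rule holomorphic_on_compose_gen[OF _ h(1)]) (auto intro!: holomorphic_intros)
    then have "(\<lambda>w. h (- w)) holomorphic_on ball 0 1" by (simp add: o_def)
    then show ?thesis unfolding Q_def using h(2) by (intro holomorphic_intros h(1)) auto
  qed
  ultimately have "winding_number (\<lambda>x. Q (E (of_real x + \<i> * of_real y)) / E (of_real x + \<i> * of_real y)) 0 = -1"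
    using assms by (intro winding_inverse_loop)
  moreover have "Q (E (of_real x + \<i> * of_real y)) / E (of_real x + \<i> * of_real y)
      = \<Psi> (of_real x + \<i> * of_real y + 1 / 2) - \<Psi> (of_real x + \<i> * of_real y)" for x :: real
  proof -
    have "E (\<zeta> + 1 / 2) = - E \<zeta>" for \<zeta>
      by (simp add: E_def distrib_left exp_add)
    then show ?thesis using Qw[OF E_ball] assms by (simp add: \<Psi>_def)
  qed
  ultimately show ?thesis by simp
qed

end

section \<open>Extension of lifted maps across the real axis\<close>

lemma Ints_valued_constant:
  fixes f :: "complex \<Rightarrow> complex"
  assumes "connected S" "continuous_on S f" "\<And>z. z \<in> S \<Longrightarrow> f z \<in> \<int>"
  obtains k :: int where "\<And>z. z \<in> S \<Longrightarrow> f z = of_int k"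
proof (cases "S = {}")
  case False
  have "f constant_on S"
  proof (rule continuous_discrete_range_constant[OF assms(1,2)])
    fix x assume x: "x \<in> S"
    have "1 \<le> cmod (f y - f x)" if y: "y \<in> S" "f y \<noteq> f x" for y
    proof -
      have "f y - f x \<in> \<int>" using assms(3)[OF x] assms(3)[OF y(1)] by (intro Ints_diff)
      then obtain n where n: "f y - f x = of_int n" by (rule Ints_cases)
      then have "n \<noteq> 0" using y by auto
      then show ?thesis using n by simp
    qed
    then show "\<exists>e>0. \<forall>y. y \<in> S \<and> f y \<noteq> f x \<longrightarrow> e \<le> cmod (f y - f x)" by (intro exI[of _ 1]) auto
  qed
  then obtain c where c: "\<And>z. z \<in> S \<Longrightarrow> f z = c" unfolding constant_on_def by blast
  then have "c \<in> \<int>" using False assms(3) by auto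
  then show ?thesis using that c by (metis Ints_cases)
qed (use that in auto)

lemma convex_strip: "convex {z::complex. a < Im z \<and> Im z < b}"
proof -
  have "{z::complex. a < Im z \<and> Im z < b} = {z. Im z > a} \<inter> {z. Im z < b}" by auto
  then show ?thesis by (simp add: convex_Int convex_halfspace_Im_gt convex_halfspace_Im_lt)
qed

lemma open_strip: "open {z::complex. a < Im z \<and> Im z < b}"
proof -
  have "{z::complex. a < Im z \<and> Im z < b} = {z. Im z > a} \<inter> {z. Im z < b}" by auto
  then show ?thesis by (simp add: open_Int open_halfspace_Im_gt open_halfspace_Im_lt)
qed

lemma connected_strip: "connected {z::complex. a < Im z \<and> Im z < b}"
  by (intro convex_connected convex_strip)

text \<open>Subtracting a linear function that dominates \<open>Im \<Phi>\<close> at height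
  \<open>c\<close> leaves a harmonic function that is at most 0 at that height and, in the limit, at
  height 0. Periodicity supplies the compactness needed for the maximum principle.\<close>

lemma Im_linear_bound:
  assumes hol: "\<Phi> holomorphic_on {z. 0 < Im z \<and> Im z < b}" and c: "0 < c" "c < b"
    and per: "\<And>z. 0 < Im z \<Longrightarrow> Im z < b \<Longrightarrow> Im (\<Phi> (z + 1)) = Im (\<Phi> z)"
    and small: "\<And>\<epsilon>. \<epsilon> > 0 \<Longrightarrow> \<exists>\<delta>>0. \<forall>z. 0 < Im z \<longrightarrow> Im z < \<delta> \<longrightarrow> Im z < b \<longrightarrow> Im (\<Phi> z) < \<epsilon>"
  obtains A where "A > 0" "\<And>z. 0 < Im z \<Longrightarrow> Im z \<le> c \<Longrightarrow> Im (\<Phi> z) \<le> A * Im z"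
proof -
  have cont: "continuous_on {z. 0 < Im z \<and> Im z < b} \<Phi>" using hol by (rule holomorphic_on_imp_continuous_on)
  have per_nat: "Im (\<Phi> (z + of_nat n)) = Im (\<Phi> z)" if "0 < Im z" "Im z < b" for z n
  proof (induction n)
    case (Suc n)
    have "Im (\<Phi> (z + of_nat (Suc n))) = Im (\<Phi> ((z + of_nat n) + 1))" by (simp add: add_ac)
    also have "\<dots> = Im (\<Phi> (z + of_nat n))" using that by (intro per) auto
    finally show ?case using Suc by simp
  qed simp
  have per_int: "Im (\<Phi> (z + of_int n)) = Im (\<Phi> z)" if "0 < Im z" "Im z < b" for z n
  proof (cases "n \<ge> 0")
    case True
    then show ?thesis using per_nat[OF that, of "nat n"] by simp
  next
    case False
    then show ?thesis using per_nat[of "z + of_int n" "nat (- n)"] that by simp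
  qed
  define box where "box s = cbox (Complex 0 s) (Complex 1 c)" for s
  have box: "z \<in> box s \<longleftrightarrow> 0 \<le> Re z \<and> Re z \<le> 1 \<and> s \<le> Im z \<and> Im z \<le> c" for z s
    by (auto simp: box_def in_cbox_complex_iff)
  have red: "z + of_int (- \<lfloor>Re z\<rfloor>) \<in> box s" if "s \<le> Im z" "Im z \<le> c" for z s
    using that by (simp add: box) linarith
  have boxsub: "box s \<subseteq> {z. 0 < Im z \<and> Im z < b}" if "s > 0" for s using c that by (auto simp: box)
  define A where "A = 1 + (SUP z\<in>box c. \<bar>Im (\<Phi> z)\<bar>) / c"
  have bdd: "bdd_above ((\<lambda>z. \<bar>Im (\<Phi> z)\<bar>) ` box c)"
  proof -
    have "compact ((\<lambda>z. \<bar>Im (\<Phi> z)\<bar>) ` box c)"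
      by (intro compact_continuous_image continuous_intros continuous_on_subset[OF cont boxsub[OF c(1)]]) (simp add: box_def)
    then show ?thesis by (intro bounded_imp_bdd_above compact_imp_bounded)
  qed
  have top: "Im (\<Phi> z) \<le> A * Im z" "0 < A" if "Im z = c" for z
  proof -
    let ?z = "z + of_int (- \<lfloor>Re z\<rfloor>)"
    have "?z \<in> box c" using that by (intro red) auto
    then have "\<bar>Im (\<Phi> ?z)\<bar> \<le> (SUP z\<in>box c. \<bar>Im (\<Phi> z)\<bar>)" by (rule cSUP_upper) (rule bdd)
    moreover have "Im (\<Phi> ?z) = Im (\<Phi> z)" using that c by (intro per_int) auto
    ultimately have *: "\<bar>Im (\<Phi> z)\<bar> \<le> (SUP z\<in>box c. \<bar>Im (\<Phi> z)\<bar>)" by simp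
    then have "0 \<le> (SUP z\<in>box c. \<bar>Im (\<Phi> z)\<bar>)" by (rule order_trans[OF abs_ge_zero])
    then show "0 < A" using c by (simp add: A_def add_pos_nonneg)
    have "A * c = c + (SUP z\<in>box c. \<bar>Im (\<Phi> z)\<bar>)" using c by (simp add: A_def field_simps)
    then show "Im (\<Phi> z) \<le> A * Im z" using * that c by simp
  qed
  have A: "A > 0" using top(2)[of "Complex 0 c"] by simp
  define u where "u z = Im (\<Phi> z) - A * Im z" for z
  have "u z \<le> 0" if z: "0 < Im z" "Im z \<le> c" for z
  proof (rule ccontr)
    assume "\<not> u z \<le> 0"
    then have uz: "u z > 0" by simp
    obtain \<delta> where \<delta>: "\<delta> > 0" "\<And>w. 0 < Im w \<Longrightarrow> Im w < \<delta> \<Longrightarrow> Im w < b \<Longrightarrow> Im (\<Phi> w) < u z"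
      using small[OF uz] by blast
    \<comment> \<open>Below height \<open>\<delta>\<close> the function \<open>u\<close> is smaller
      than \<open>u z\<close>, so its maximum over the box from height \<open>s\<close> to
      \<open>c\<close> is the maximum over the whole strip.\<close>
    define s where "s = min (\<delta> / 2) (Im z)"
    have s: "s > 0" "s \<le> Im z" "s < \<delta>" using \<delta> z by (auto simp: s_def)
    have low: "u w < u z" if "0 < Im w" "Im w < \<delta>" "Im w < b" for w
      using \<delta>(2)[OF that] A that(1) by (simp add: u_def) (smt (verit) mult_pos_pos)
    have "continuous_on (box s) u" unfolding u_def
      by (intro continuous_intros continuous_on_subset[OF cont boxsub[OF s(1)]])
    moreover have "compact (box s)" by (simp add: box_def)
    moreover have "box s \<noteq> {}" using red[OF s(2) z(2)] by blast
    ultimately obtain x where x: "x \<in> box s" "\<And>w. w \<in> box s \<Longrightarrow> u w \<le> u x"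
      using continuous_attains_sup by metis
    have uper: "u (w + of_int n) = u w" if "0 < Im w" "Im w < b" for w n
      using per_int[OF that] by (simp add: u_def)
    have uzx: "u z \<le> u x"
      using x(2)[OF red[OF s(2) z(2)]] uper[of z "- \<lfloor>Re z\<rfloor>"] z c by simp
    have max: "u w \<le> u x" if "0 < Im w" "Im w < c" for w
    proof (cases "s \<le> Im w")
      case True
      then show ?thesis using x(2)[OF red[of s w]] uper[of w "- \<lfloor>Re w\<rfloor>"] that c by simp
    next
      case False
      then show ?thesis using low[of w] uzx that s c by simp
    qed
    have xc: "0 < Im x" "Im x < c"
    proof -
      show "0 < Im x" using x(1) s by (simp add: box)
      have "Im x \<noteq> c" using top(1)[of x] uzx uz by (auto simp: u_def)
      then show "Im x < c" using x(1) by (simp add: box)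
    qed
    \<comment> \<open>Its modulus is the exponential of \<open>u\<close>, which makes the maximum
      modulus principle available for the harmonic function.\<close>
    define e where "e w = exp (- \<i> * (\<Phi> w - of_real A * w))" for w
    have ne: "cmod (e w) = exp (u w)" for w by (simp add: e_def u_def)
    let ?T = "{z. 0 < Im z \<and> Im z < c}"
    have "e constant_on ?T"
    proof (rule maximum_modulus_principle[OF _ open_strip connected_strip open_strip subset_refl, of _ _ _ x])
      have "\<Phi> holomorphic_on ?T" using hol by (rule holomorphic_on_subset) (use c in auto)
      then show "e holomorphic_on ?T" unfolding e_def by (intro holomorphic_intros)
      show "x \<in> ?T" using xc by simp
      show "cmod (e w) \<le> cmod (e x)" if "w \<in> ?T" for w using max[of w] that by (simp add: ne)
    qed
    then obtain k where k: "\<And>w. w \<in> ?T \<Longrightarrow> e w = k" unfolding constant_on_def by blast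
    define w where "w = Complex 0 (min (\<delta> / 2) (c / 2))"
    have w: "0 < Im w" "Im w < \<delta>" "Im w < c" using \<delta> c by (auto simp: w_def)
    have "e w = e x" using k[of w] k[of x] w xc by simp
    then have "u w = u x" using ne[of w] ne[of x] by simp
    then show False using low[of w] w c uzx by simp
  qed
  then show ?thesis using that[OF A] by (simp add: u_def)
qed

text \<open>The function is bounded on the disc of radius half the distance to the real axis after
  exponentiation, so Cauchy's estimate applies.\<close>

lemma deriv_bound_from_Im_bound:
  assumes hol: "\<Phi> holomorphic_on {z. 0 < Im z \<and> Im z < b}" and A: "A > 0"
    and bound: "\<And>z. 0 < Im z \<Longrightarrow> Im z \<le> c \<Longrightarrow> 0 \<le> Im (\<Phi> z) \<and> Im (\<Phi> z) \<le> A * Im z"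
    and c: "c < b" and z: "0 < Im z" "2 * Im z \<le> c"
  shows "cmod (deriv \<Phi> z) \<le> 3 * A * exp 1"
proof -
  define y where "y = Im z"
  define r where "r = y / 2"
  define B where "B = A * (3 / 2 * y)"
  have y: "y > 0" "2 * y \<le> c" and r: "r > 0" and B: "B > 0" using z A by (auto simp: y_def r_def B_def)
  have disc: "0 < Im w \<and> Im w \<le> 3 / 2 * y" if "w \<in> cball z r" for w
  proof -
    have "\<bar>Im w - Im z\<bar> \<le> r" using abs_Im_le_cmod[of "w - z"] that by (simp add: dist_norm norm_minus_commute)
    then have "\<bar>Im w - y\<bar> \<le> y / 2" by (simp add: y_def r_def)
    then show ?thesis using y by linarith
  qed
  \<comment> \<open>Division by \<open>B\<close> puts the imaginary part between 0 and 1 on the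
    disc, so \<open>h\<close> is bounded by \<open>exp 1\<close> whatever the real part of
    \<open>\<Phi>\<close> is, and its modulus is at least 1 at the centre.\<close>
  define h where "h w = exp (- \<i> * \<Phi> w / B)" for w
  have sub: "cball z r \<subseteq> {z. 0 < Im z \<and> Im z < b}"
  proof
    fix w assume "w \<in> cball z r"
    then show "w \<in> {z. 0 < Im z \<and> Im z < b}" using disc[of w] y c by simp
  qed
  have holh: "h holomorphic_on {z. 0 < Im z \<and> Im z < b}" unfolding h_def using B by (intro holomorphic_intros hol) auto
  have nh: "cmod (h w) = exp (Im (\<Phi> w) / B)" for w by (simp add: h_def Re_divide_of_real)
  have hb: "1 \<le> cmod (h w) \<and> cmod (h w) \<le> exp 1" if "w \<in> cball z r" for w
  proof -
    have w: "0 < Im w" "Im w \<le> 3 / 2 * y" using disc[OF that] by auto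
    have b: "0 \<le> Im (\<Phi> w)" "Im (\<Phi> w) \<le> A * Im w" using bound[of w] w y by auto
    have "A * Im w \<le> B" unfolding B_def using w A by (intro mult_left_mono) auto
    then show ?thesis using b B by (simp add: nh pos_divide_le_eq)
  qed
  have "cmod ((deriv ^^ 1) h z) \<le> fact 1 * exp 1 / r ^ 1"
  proof (rule Cauchy_inequality)
    show "h holomorphic_on ball z r" using sub ball_subset_cball by (intro holomorphic_on_subset[OF holh]) blast
    show "continuous_on (cball z r) h" using holomorphic_on_imp_continuous_on[OF holh] sub by (rule continuous_on_subset)
    show "cmod (h x) \<le> exp 1" if "cmod (z - x) = r" for x using hb[of x] that by (simp add: dist_norm)
  qed (rule r)
  then have 1: "cmod (deriv h z) \<le> exp 1 / r" by simp
  have "(\<Phi> has_field_derivative deriv \<Phi> z) (at z)"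
    using hol open_strip by (rule holomorphic_derivI) (use z c in auto)
  then have "(h has_field_derivative h z * (- \<i> * deriv \<Phi> z / B)) (at z)"
    unfolding h_def using B by (auto intro!: derivative_eq_intros)
  then have "deriv h z = h z * (- \<i> * deriv \<Phi> z / B)" by (rule DERIV_imp_deriv)
  then have "cmod (deriv h z) = cmod (h z) * (cmod (deriv \<Phi> z) / B)" using B by (simp add: norm_mult norm_divide)
  moreover have "1 * (cmod (deriv \<Phi> z) / B) \<le> cmod (h z) * (cmod (deriv \<Phi> z) / B)"
    using hb[of z] r B by (intro mult_right_mono) auto
  ultimately have "cmod (deriv \<Phi> z) / B \<le> exp 1 / r" using 1 by simp
  then have "cmod (deriv \<Phi> z) \<le> exp 1 / r * B" using B by (simp add: pos_divide_le_eq)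
  also have "\<dots> = 3 * A * exp 1" using y by (simp add: r_def B_def)
  finally show ?thesis .
qed

text \<open>Schwarz reflection asks for continuity up to the real axis, while \<open>small\<close>
  only controls the imaginary part there. The linear bound on \<open>Im \<Phi>\<close> bounds the
  derivative, which makes \<open>\<Phi>\<close> Lipschitz and extendable to the axis. The sign of
  the derivative comes from the upper side being mapped into the upper half-plane.\<close>

lemma reflect_across_real_axis:
  assumes hol: "\<Phi> holomorphic_on {z. 0 < Im z \<and> Im z < b}" and c: "0 < c" "c < b"
    and per: "\<And>z. 0 < Im z \<Longrightarrow> Im z < b \<Longrightarrow> Im (\<Phi> (z + 1)) = Im (\<Phi> z)"
    and pos: "\<And>z. 0 < Im z \<Longrightarrow> Im z < b \<Longrightarrow> 0 < Im (\<Phi> z)"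
    and small: "\<And>\<epsilon>. \<epsilon> > 0 \<Longrightarrow> \<exists>\<delta>>0. \<forall>z. 0 < Im z \<longrightarrow> Im z < \<delta> \<longrightarrow> Im z < b \<longrightarrow> Im (\<Phi> z) < \<epsilon>"
  obtains G d where "0 < d" "d < b" "G holomorphic_on {z. - d < Im z \<and> Im z < d}"
    "\<And>z. 0 < Im z \<Longrightarrow> Im z < d \<Longrightarrow> G z = \<Phi> z" "\<And>z. Im z = 0 \<Longrightarrow> Im (G z) = 0"
    "\<And>z. Im z = 0 \<Longrightarrow> 0 \<le> Re (deriv G z)"
proof -
  obtain A where A: "A > 0" "\<And>z. 0 < Im z \<Longrightarrow> Im z \<le> c \<Longrightarrow> Im (\<Phi> z) \<le> A * Im z"
    using Im_linear_bound[OF hol c per small] by blast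
  define d where "d = c / 2"
  have d: "0 < d" "d < b" using c by (auto simp: d_def)
  let ?H = "{z. 0 < Im z \<and> Im z < d}"
  have lip: "cmod (\<Phi> z - \<Phi> w) \<le> 3 * A * exp 1 * cmod (z - w)" if "z \<in> ?H" "w \<in> ?H" for z w
  proof (rule field_differentiable_bound[OF convex_strip[of 0 d]])
    show "(\<Phi> has_field_derivative deriv \<Phi> x) (at x within ?H)" if "x \<in> ?H" for x
      using holomorphic_derivI[OF hol open_strip] that d by (auto intro: has_field_derivative_at_within)
    show "cmod (deriv \<Phi> x) \<le> 3 * A * exp 1" if "x \<in> ?H" for x
    proof (rule deriv_bound_from_Im_bound[OF hol A(1) _ c(2)])
      show "0 \<le> Im (\<Phi> z) \<and> Im (\<Phi> z) \<le> A * Im z" if "0 < Im z" "Im z \<le> c" for z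
        using A(2)[OF that] pos[of z] that c by simp
    qed (use that in \<open>auto simp: d_def\<close>)
  qed (use that in auto)
  have "(3 * A * exp 1)-lipschitz_on ?H \<Phi>"
    using lip A by (intro lipschitz_onI) (auto simp: dist_norm)
  then have "uniformly_continuous_on ?H \<Phi>" by (rule lipschitz_on_uniformly_continuous)
  then obtain g where g: "uniformly_continuous_on (closure ?H) g" "\<And>x. x \<in> ?H \<Longrightarrow> \<Phi> x = g x"
    by (rule uniformly_continuous_on_extension_on_closure) blast
  have cg: "continuous_on (closure ?H) g" using g(1) by (rule uniformly_continuous_imp_continuous)
  have cl: "z \<in> closure ?H" if "0 \<le> Im z" "Im z < d" for z
  proof (unfold closure_approachable, intro allI impI)
    fix e :: real assume e: "e > 0"
    define t where "t = min (e / 2) ((d - Im z) / 2)"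
    have t: "0 < t" "t < e" "t < d - Im z" using e that by (auto simp: t_def min_def field_simps)
    show "\<exists>y\<in>?H. dist y z < e"
      by (rule bexI[of _ "z + \<i> * of_real t"]) (use t that in \<open>auto simp: dist_norm norm_mult\<close>)
  qed
  have real: "Im (g x) = 0" if "Im x = 0" for x
  proof -
    have "(\<lambda>n. of_real (d / (real n + 2)) :: complex) \<longlonglongrightarrow> of_real 0"
      by (intro tendsto_of_real) real_asymp
    then have "(\<lambda>n. x + \<i> * of_real (d / (real n + 2))) \<longlonglongrightarrow> x + \<i> * of_real 0"
      by (rule tendsto_add[OF tendsto_const tendsto_mult[OF tendsto_const]])
    then have lim: "(\<lambda>n. x + \<i> * of_real (d / (real n + 2))) \<longlonglongrightarrow> x" by simp
    have H: "x + \<i> * of_real (d / (real n + 2)) \<in> ?H" for n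
      using that d by (auto simp: field_simps add_pos_nonneg)
    have "(\<lambda>n. g (x + \<i> * of_real (d / (real n + 2)))) \<longlonglongrightarrow> g x"
      using continuous_on_tendsto_compose[OF cg lim cl[of x]] that d H closure_subset
      by (metis (no_types, lifting) always_eventually order_refl subsetD)
    then have "(\<lambda>n. Im (g (x + \<i> * of_real (d / (real n + 2))))) \<longlonglongrightarrow> Im (g x)" by (rule tendsto_Im)
    moreover have "(\<lambda>n. Im (g (x + \<i> * of_real (d / (real n + 2))))) \<longlonglongrightarrow> 0"
    proof (rule tendsto_sandwich[where f = "\<lambda>_. 0" and h = "\<lambda>n. A * (d / (real n + 2))"])
      have "(\<lambda>n. A * (d / (real n + 2))) \<longlonglongrightarrow> 0" by real_asymp
      then show "(\<lambda>n. A * (d / (real n + 2))) \<longlonglongrightarrow> 0" .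
      show "\<forall>\<^sub>F n in sequentially. 0 \<le> Im (g (x + \<i> * of_real (d / (real n + 2))))"
      proof (intro always_eventually allI)
        fix n
        show "0 \<le> Im (g (x + \<i> * of_real (d / (real n + 2))))"
          using g(2)[OF H[of n]] pos[of "x + \<i> * of_real (d / (real n + 2))"] H[of n] d by simp
      qed
      show "\<forall>\<^sub>F n in sequentially. Im (g (x + \<i> * of_real (d / (real n + 2)))) \<le> A * (d / (real n + 2))"
      proof (intro always_eventually allI)
        fix n
        show "Im (g (x + \<i> * of_real (d / (real n + 2)))) \<le> A * (d / (real n + 2))"
        proof -
          define w where "w = x + \<i> * of_real (d / (real n + 2))"
          have w: "w \<in> ?H" "Im w = d / (real n + 2)" using H[of n] that by (simp_all add: w_def)
          then have "0 < Im w" "Im w < d" by auto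
          moreover have "d < c" using c by (simp add: d_def)
          ultimately have "Im (\<Phi> w) \<le> A * Im w" by (intro A(2)) auto
          then show ?thesis using g(2)[OF w(1)] w(2) by (simp add: w_def)
        qed
      qed
    qed (rule tendsto_const)
    ultimately show ?thesis by (rule LIMSEQ_unique)
  qed
  define G where "G z = (if 0 \<le> Im z then g z else cnj (g (cnj z)))" for z
  let ?S = "{z. - d < Im z \<and> Im z < d}"
  have holG: "G holomorphic_on ?S" unfolding G_def
  proof (rule Schwarz_reflection[OF open_strip])
    have "?S \<inter> {z. 0 < Im z} = ?H" using d by auto
    moreover have "\<Phi> holomorphic_on ?H" using hol by (rule holomorphic_on_subset) (use d in auto)
    then have "g holomorphic_on ?H" by (rule holomorphic_transform) (rule g(2))
    ultimately show "g holomorphic_on ?S \<inter> {z. 0 < Im z}" by simp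
    show "continuous_on (?S \<inter> {z. 0 \<le> Im z}) g" by (rule continuous_on_subset[OF cg]) (use cl in auto)
    show "g z \<in> \<real>" if "z \<in> \<real>" for z using real[of z] that by (simp add: complex_is_Real_iff)
  qed auto
  have GR: "Im (G z) = 0" if "Im z = 0" for z using real[OF that] that by (simp add: G_def)
  have Gpos: "0 < Im (G z)" if "0 < Im z" "Im z < d" for z
    using g(2)[of z] pos[of z] that d by (simp add: G_def)
  have "0 \<le> Re (deriv G z)" if "Im z = 0" for z
  proof -
    have "(G has_field_derivative deriv G z) (at z)"
      using holG open_strip by (rule holomorphic_derivI) (use that d in auto)
    then have "((\<lambda>w. (G w - G z) / (w - z)) \<longlongrightarrow> deriv G z) (at z)" by (simp add: has_field_derivative_iff)
    \<comment> \<open>On the vertical approach to \<open>z\<close>, the real part of the difference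
      quotient is the height of the image divided by the height of the point.\<close>
    moreover have "filterlim (\<lambda>n. z + \<i> * of_real (d / (real n + 2))) (at z) sequentially"
    proof (rule filterlim_atI)
      have "(\<lambda>n. of_real (d / (real n + 2)) :: complex) \<longlonglongrightarrow> of_real 0"
        by (intro tendsto_of_real) real_asymp
      then have "(\<lambda>n. z + \<i> * of_real (d / (real n + 2))) \<longlonglongrightarrow> z + \<i> * of_real 0"
        by (rule tendsto_add[OF tendsto_const tendsto_mult[OF tendsto_const]])
      then show "(\<lambda>n. z + \<i> * of_real (d / (real n + 2))) \<longlonglongrightarrow> z" by simp
      show "\<forall>\<^sub>F n in sequentially. z + \<i> * of_real (d / (real n + 2)) \<noteq> z"
      proof (intro always_eventually allI)
        fix n
        have t: "0 < d / (real n + 2)" using d by (intro divide_pos_pos) auto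
        have "Im (z + \<i> * of_real (d / (real n + 2))) = Im z + d / (real n + 2)" by simp
        then have "Im (z + \<i> * of_real (d / (real n + 2))) \<noteq> Im z" using t by linarith
        then show "z + \<i> * of_real (d / (real n + 2)) \<noteq> z" by metis
      qed
    qed
    ultimately have "((\<lambda>n. (G (z + \<i> * of_real (d / (real n + 2))) - G z) / (\<i> * of_real (d / (real n + 2)))) \<longlonglongrightarrow> deriv G z)"
      by (auto dest: filterlim_compose)
    then have "((\<lambda>n. Re ((G (z + \<i> * of_real (d / (real n + 2))) - G z) / (\<i> * of_real (d / (real n + 2))))) \<longlonglongrightarrow> Re (deriv G z))"
      by (rule tendsto_Re)
    moreover have "0 \<le> Re ((G (z + \<i> * of_real (d / (real n + 2))) - G z) / (\<i> * of_real (d / (real n + 2))))" for n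
    proof -
      define t where "t = d / (real n + 2)"
      have t: "0 < t" "t < d" using d by (auto simp: t_def field_simps add_pos_nonneg)
      have "Re (w / (\<i> * of_real t)) = Im w / t" for w
        using t by (simp add: Re_divide power2_eq_square)
      then have "Re ((G (z + \<i> * of_real t) - G z) / (\<i> * of_real t)) = Im (G (z + \<i> * of_real t)) / t"
        using GR[OF that] by simp
      then show ?thesis using Gpos[of "z + \<i> * of_real t"] t that by (simp add: t_def[symmetric])
    qed
    ultimately show ?thesis by (intro LIMSEQ_le_const[of _ "Re (deriv G z)"]) auto
  qed
  then show ?thesis using that[of d G] d holG GR g(2) by (auto simp: G_def)
qed

context exterior_chart
begin

text \<open>The map induced by \<open>G\<close> on the prime ends, as an analytic map of the line:
  \<open>\<gamma>\<close> is the lift of \<open>G\<close> through \<open>\<Psi>\<close>, reflected,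
  and \<open>k\<close> is its degree. \<open>Gi\<close> ensures that points outside \<open>K\<close>
  stay outside, so that they can be lifted.\<close>

lemma boundary_lift:
  assumes V: "open V" "K \<subseteq> V" and G: "G holomorphic_on V" "G ` K \<subseteq> K"
    and Gi: "Gi ` K \<subseteq> K" "\<And>z. z \<in> V \<Longrightarrow> Gi (G z) = z"
  obtains \<eta> \<gamma> k where "0 < \<eta>" "\<gamma> holomorphic_on {z. - \<eta> < Im z \<and> Im z < \<eta>}"
    "\<And>z. 0 < Im z \<Longrightarrow> Im z < \<eta> \<Longrightarrow> 0 < Im (\<gamma> z) \<and> \<Psi> (\<gamma> z) = G (\<Psi> z) \<and> \<Psi> z \<in> V"
    "\<And>z. Im z = 0 \<Longrightarrow> Im (\<gamma> z) = 0" "\<And>z. Im z = 0 \<Longrightarrow> 0 \<le> Re (deriv \<gamma> z)"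
    "\<And>z. - \<eta> < Im z \<Longrightarrow> Im z < \<eta> \<Longrightarrow> \<gamma> (z + 1) = \<gamma> z + of_int k"
    "\<And>\<epsilon>. \<epsilon> > 0 \<Longrightarrow> \<exists>\<delta>>0. \<forall>z. 0 < Im z \<longrightarrow> Im z < \<delta> \<longrightarrow> Im z < \<eta> \<longrightarrow> Im (\<gamma> z) < \<epsilon>"
proof -
  obtain b where b: "0 < b" "\<And>z. 0 < Im z \<Longrightarrow> Im z < b \<Longrightarrow> \<Psi> z \<in> V" using \<Psi>_near[OF V] by blast
  define S where "S = {z. 0 < Im z \<and> Im z < b}"
  have S: "open S" "convex S" "connected S" unfolding S_def by (rule open_strip convex_strip connected_strip)+
  have "G \<circ> \<Psi> holomorphic_on S"
  proof (rule holomorphic_on_compose_gen[OF _ G(1)])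
    show "\<Psi> holomorphic_on S" using hol_\<Psi> by (rule holomorphic_on_subset) (auto simp: S_def)
  qed (use b in \<open>auto simp: S_def\<close>)
  moreover have GK: "G (\<Psi> z) \<notin> K" if "z \<in> S" for z
  proof
    assume "G (\<Psi> z) \<in> K"
    then have "Gi (G (\<Psi> z)) \<in> K" using Gi(1) by blast
    moreover have "Gi (G (\<Psi> z)) = \<Psi> z" using Gi(2) b(2) that by (simp add: S_def)
    ultimately show False using \<Psi>_notin[of z] that by (simp add: S_def)
  qed
  ultimately obtain \<Phi> where \<Phi>: "\<Phi> holomorphic_on S" "\<And>z. z \<in> S \<Longrightarrow> 0 < Im (\<Phi> z) \<and> \<Psi> (\<Phi> z) = (G \<circ> \<Psi>) z"
    using \<Psi>_lift[OF S(1,2), of "G \<circ> \<Psi>"] by (metis comp_apply)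
  have per: "\<Phi> (z + 1) - \<Phi> z \<in> \<int>" if zS: "z \<in> S" for z
  proof -
    have z1: "z + 1 \<in> S" using zS by (simp add: S_def)
    have "\<Psi> (\<Phi> (z + 1)) = \<Psi> (\<Phi> z)" using \<Phi>(2)[OF zS] \<Phi>(2)[OF z1] \<Psi>_periodic[of z 1] by simp
    then obtain n :: int where "\<Phi> (z + 1) = \<Phi> z + of_int n"
      using \<Psi>_eq_iff \<Phi>(2)[OF zS] \<Phi>(2)[OF z1] by blast
    then show ?thesis by simp
  qed
  have cont: "continuous_on S (\<lambda>z. \<Phi> (z + 1) - \<Phi> z)"
  proof (intro continuous_intros)
    have c: "continuous_on S \<Phi>" using \<Phi>(1) by (rule holomorphic_on_imp_continuous_on)
    then show "continuous_on S \<Phi>" .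
    show "continuous_on S (\<lambda>z. \<Phi> (z + 1))"
      by (rule continuous_on_compose2[OF c]) (auto intro!: continuous_intros simp: S_def)
  qed
  obtain k :: int where k: "\<And>z. z \<in> S \<Longrightarrow> \<Phi> (z + 1) - \<Phi> z = of_int k"
    by (rule Ints_valued_constant[OF S(3) cont per], assumption, rule that)
  \<comment> \<open>Heights measure neighbourhoods of \<open>K\<close>, so continuity of
    \<open>G\<close> at the points of \<open>K\<close> says that small heights go to small
    heights.\<close>
  have small: "\<exists>\<delta>>0. \<forall>z. 0 < Im z \<longrightarrow> Im z < \<delta> \<longrightarrow> Im z < b \<longrightarrow> Im (\<Phi> z) < \<epsilon>" if \<epsilon>: "\<epsilon> > 0" for \<epsilon>
  proof -
    define W where "W = K \<union> \<Psi> ` {\<zeta>. 0 < Im \<zeta> \<and> Im \<zeta> < \<epsilon>}"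
    have "open W" unfolding W_def by (rule \<Psi>_strip_open[OF \<epsilon>])
    then have "open (V \<inter> G -` W)" using G(1) V(1) by (intro continuous_open_preimage holomorphic_on_imp_continuous_on)
    moreover have "K \<subseteq> V \<inter> G -` W" using V(2) G(2) by (auto simp: W_def)
    ultimately obtain \<delta> where \<delta>: "\<delta> > 0" "\<And>z. 0 < Im z \<Longrightarrow> Im z < \<delta> \<Longrightarrow> \<Psi> z \<in> V \<inter> G -` W"
      using \<Psi>_near by blast
    have "Im (\<Phi> z) < \<epsilon>" if z: "0 < Im z" "Im z < \<delta>" "Im z < b" for z
    proof -
      have zS: "z \<in> S" using z by (simp add: S_def)
      have "G (\<Psi> z) \<in> W" using \<delta>(2)[OF z(1,2)] by blast
      then obtain \<xi> where \<xi>: "0 < Im \<xi>" "Im \<xi> < \<epsilon>" "G (\<Psi> z) = \<Psi> \<xi>" using GK[OF zS] by (auto simp: W_def)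
      then have "\<Psi> (\<Phi> z) = \<Psi> \<xi>" using \<Phi>(2)[OF zS] by simp
      then obtain n :: int where "\<Phi> z = \<xi> + of_int n" using \<Psi>_eq_iff \<Phi>(2)[OF zS] \<xi>(1) by blast
      then show ?thesis using \<xi>(2) by simp
    qed
    then show ?thesis using \<delta>(1) by blast
  qed
  obtain \<gamma> d where d: "0 < d" "d < b" and \<gamma>: "\<gamma> holomorphic_on {z. - d < Im z \<and> Im z < d}"
    "\<And>z. 0 < Im z \<Longrightarrow> Im z < d \<Longrightarrow> \<gamma> z = \<Phi> z" "\<And>z. Im z = 0 \<Longrightarrow> Im (\<gamma> z) = 0"
    "\<And>z. Im z = 0 \<Longrightarrow> 0 \<le> Re (deriv \<gamma> z)"
  proof (rule reflect_across_real_axis[of \<Phi> b "b / 2"])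
    show "\<Phi> holomorphic_on {z. 0 < Im z \<and> Im z < b}" using \<Phi>(1) by (simp add: S_def)
    show "Im (\<Phi> (z + 1)) = Im (\<Phi> z)" if "0 < Im z" "Im z < b" for z
    proof -
      have "\<Phi> (z + 1) = \<Phi> z + of_int k" using k[of z] that by (simp add: S_def algebra_simps)
      then show ?thesis by simp
    qed
    show "0 < Im (\<Phi> z)" if "0 < Im z" "Im z < b" for z using \<Phi>(2)[of z] that by (simp add: S_def)
  qed (use b(1) small in auto)
  let ?T = "{z. - d < Im z \<and> Im z < d}"
  have perT: "\<gamma> (z + 1) = \<gamma> z + of_int k" if "z \<in> ?T" for z
  proof (rule analytic_continuation_open[of "{z. 0 < Im z \<and> Im z < d}" ?T "\<lambda>z. \<gamma> (z + 1)" "\<lambda>z. \<gamma> z + of_int k"])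
    have "\<gamma> \<circ> (\<lambda>z. z + 1) holomorphic_on ?T"
      by (rule holomorphic_on_compose_gen[OF _ \<gamma>(1)]) (auto intro!: holomorphic_intros)
    then show "(\<lambda>z. \<gamma> (z + 1)) holomorphic_on ?T" by (simp add: o_def)
    show "(\<lambda>z. \<gamma> z + of_int k) holomorphic_on ?T" by (intro holomorphic_intros \<gamma>(1))
    have "\<i> * of_real (d / 2) \<in> {z. 0 < Im z \<and> Im z < d}" using d by simp
    then show "{z. 0 < Im z \<and> Im z < d} \<noteq> {}" by blast
    show "\<gamma> (z + 1) = \<gamma> z + of_int k" if "z \<in> {z. 0 < Im z \<and> Im z < d}" for z
      using \<gamma>(2)[of z] \<gamma>(2)[of "z + 1"] k[of z] that d by (simp add: S_def algebra_simps)
  qed (use d that open_strip connected_strip in auto)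
  show ?thesis
  proof (rule that[of d \<gamma> k])
    show "0 < Im (\<gamma> z) \<and> \<Psi> (\<gamma> z) = G (\<Psi> z) \<and> \<Psi> z \<in> V" if "0 < Im z" "Im z < d" for z
      using \<gamma>(2)[OF that] \<Phi>(2)[of z] b(2)[of z] that d by (simp add: S_def)
    show "\<exists>\<delta>>0. \<forall>z. 0 < Im z \<longrightarrow> Im z < \<delta> \<longrightarrow> Im z < d \<longrightarrow> Im (\<gamma> z) < \<epsilon>" if "\<epsilon> > 0" for \<epsilon>
      using small[OF that] \<gamma>(2) d by (metis less_trans)
  qed (use d \<gamma> perT in auto)
qed

end

lemma of_real_restriction:
  assumes g: "g holomorphic_on {z. - \<eta> < Im z \<and> Im z < \<eta>}" "\<eta> > 0" and re: "\<And>z. Im z = 0 \<Longrightarrow> Im (g z) = 0"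
  shows "((\<lambda>t. Re (g (of_real t))) has_real_derivative Re (deriv g (of_real x))) (at x)"
    and "Im (deriv g (of_real x)) = 0"
proof -
  have "(g has_field_derivative deriv g (of_real x)) (at (of_real x))"
    using g(1) open_strip by (rule holomorphic_derivI) (use g(2) in auto)
  then have v: "((\<lambda>t. g (of_real t)) has_vector_derivative deriv g (of_real x)) (at x)"
    by (rule has_vector_derivative_real_field)
  have "((\<lambda>t. Re (g (of_real t))) has_vector_derivative Re (deriv g (of_real x))) (at x)"
    using bounded_linear.has_vector_derivative[OF bounded_linear_Re v] .
  then show "((\<lambda>t. Re (g (of_real t))) has_real_derivative Re (deriv g (of_real x))) (at x)"
    by (simp add: has_real_derivative_iff_has_vector_derivative)
  have "((\<lambda>t. Im (g (of_real t))) has_vector_derivative Im (deriv g (of_real x))) (at x)"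
    using bounded_linear.has_vector_derivative[OF bounded_linear_Im v] .
  moreover have "(\<lambda>t. Im (g (of_real t))) = (\<lambda>t. 0)" using re by auto
  ultimately have "((\<lambda>t::real. 0::real) has_vector_derivative Im (deriv g (of_real x))) (at x)" by simp
  then show "Im (deriv g (of_real x)) = 0" using vector_derivative_unique_at has_vector_derivative_const by blast
qed

text \<open>The two derivatives on the real line are nonnegative with product 1, so neither
  vanishes.\<close>

lemma inverse_on_reals_deriv:
  assumes g: "g holomorphic_on {z. - \<eta> < Im z \<and> Im z < \<eta>}" "\<And>z. Im z = 0 \<Longrightarrow> Im (g z) = 0" "\<And>z. Im z = 0 \<Longrightarrow> 0 \<le> Re (deriv g z)"
    and h: "h holomorphic_on {z. - \<eta>' < Im z \<and> Im z < \<eta>'}" "\<And>z. Im z = 0 \<Longrightarrow> Im (h z) = 0" "\<And>z. Im z = 0 \<Longrightarrow> 0 \<le> Re (deriv h z)"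
    and \<eta>: "\<eta> > 0" "\<eta>' > 0" and hg: "\<And>t::real. h (g (of_real t)) = of_real t + c"
  shows "0 < Re (deriv g (of_real x))" "0 < Re (deriv h (g (of_real x)))"
proof -
  define \<rho> where "\<rho> t = Re (g (of_real t))" for t :: real
  have g\<rho>: "g (of_real t) = of_real (\<rho> t)" for t using g(2)[of "of_real t"] by (simp add: \<rho>_def complex_eq_iff)
  have 1: "(\<rho> has_real_derivative Re (deriv g (of_real x))) (at x)"
    unfolding \<rho>_def by (rule of_real_restriction(1)[OF g(1) \<eta>(1) g(2)])
  have 2: "((\<lambda>t. Re (h (of_real t))) has_real_derivative Re (deriv h (of_real (\<rho> x)))) (at (\<rho> x))"
    by (rule of_real_restriction(1)[OF h(1) \<eta>(2) h(2)])
  have "((\<lambda>t. Re (h (of_real (\<rho> t)))) has_real_derivative Re (deriv h (of_real (\<rho> x))) * Re (deriv g (of_real x))) (at x)"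
    by (rule DERIV_chain2[OF 2 1])
  moreover have "(\<lambda>t. Re (h (of_real (\<rho> t)))) = (\<lambda>t. t + Re c)" using hg by (simp add: g\<rho>)
  moreover have "((\<lambda>t. t + Re c) has_real_derivative 1) (at x)" by (auto intro!: derivative_eq_intros)
  ultimately have "Re (deriv h (of_real (\<rho> x))) * Re (deriv g (of_real x)) = 1" using DERIV_unique by metis
  then show "0 < Re (deriv g (of_real x))" "0 < Re (deriv h (g (of_real x)))"
    using g(3)[of "of_real x"] h(3)[of "of_real (\<rho> x)"] by (auto simp: g\<rho> less_le)
qed

context exterior_chart
begin

text \<open>Lifts of mutually inverse maps compose to a deck translation, whose amount is removed
  from \<open>v\<close>. The degrees are integers with product 1 and the first is positive, so the
  boundary map is an orientation-preserving analytic circle diffeomorphism.\<close>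

lemma boundary_lifts:
  assumes V: "open V" "K \<subseteq> V" and G: "G holomorphic_on V" "G ` K \<subseteq> K" "\<And>z. z \<in> V \<Longrightarrow> Gi (G z) = z"
    and Gi: "Gi holomorphic_on V" "Gi ` K \<subseteq> K" "\<And>z. z \<in> V \<Longrightarrow> G (Gi z) = z"
  obtains \<eta> u v where "0 < \<eta>"
    "u holomorphic_on {z. - \<eta> < Im z \<and> Im z < \<eta>}" "v holomorphic_on {z. - \<eta> < Im z \<and> Im z < \<eta>}"
    "\<And>z. 0 < Im z \<Longrightarrow> Im z < \<eta> \<Longrightarrow> 0 < Im (u z) \<and> \<Psi> (u z) = G (\<Psi> z) \<and> \<Psi> z \<in> V"
    "\<And>z. 0 < Im z \<Longrightarrow> Im z < \<eta> \<Longrightarrow> 0 < Im (v z) \<and> \<Psi> (v z) = Gi (\<Psi> z)"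
    "\<And>z. Im z = 0 \<Longrightarrow> Im (u z) = 0 \<and> Im (v z) = 0 \<and> v (u z) = z \<and> u (v z) = z"
    "\<And>z. Im z = 0 \<Longrightarrow> 0 < Re (deriv u z) \<and> 0 < Re (deriv v z)"
    "\<And>z. - \<eta> < Im z \<Longrightarrow> Im z < \<eta> \<Longrightarrow> u (z + 1) = u z + 1"
proof -
  obtain \<eta>1 u k1 where 1: "0 < \<eta>1" "u holomorphic_on {z. - \<eta>1 < Im z \<and> Im z < \<eta>1}"
    "\<And>z. 0 < Im z \<Longrightarrow> Im z < \<eta>1 \<Longrightarrow> 0 < Im (u z) \<and> \<Psi> (u z) = G (\<Psi> z) \<and> \<Psi> z \<in> V"
    "\<And>z. Im z = 0 \<Longrightarrow> Im (u z) = 0" "\<And>z. Im z = 0 \<Longrightarrow> 0 \<le> Re (deriv u z)"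
    "\<And>z. - \<eta>1 < Im z \<Longrightarrow> Im z < \<eta>1 \<Longrightarrow> u (z + 1) = u z + of_int k1"
    "\<And>\<epsilon>. \<epsilon> > 0 \<Longrightarrow> \<exists>\<delta>>0. \<forall>z. 0 < Im z \<longrightarrow> Im z < \<delta> \<longrightarrow> Im z < \<eta>1 \<longrightarrow> Im (u z) < \<epsilon>"
    by (rule boundary_lift[OF V G(1,2) Gi(2) G(3)]) blast+
  obtain \<eta>2 v k2 where 2: "0 < \<eta>2" "v holomorphic_on {z. - \<eta>2 < Im z \<and> Im z < \<eta>2}"
    "\<And>z. 0 < Im z \<Longrightarrow> Im z < \<eta>2 \<Longrightarrow> 0 < Im (v z) \<and> \<Psi> (v z) = Gi (\<Psi> z) \<and> \<Psi> z \<in> V"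
    "\<And>z. Im z = 0 \<Longrightarrow> Im (v z) = 0" "\<And>z. Im z = 0 \<Longrightarrow> 0 \<le> Re (deriv v z)"
    "\<And>z. - \<eta>2 < Im z \<Longrightarrow> Im z < \<eta>2 \<Longrightarrow> v (z + 1) = v z + of_int k2"
    "\<And>\<epsilon>. \<epsilon> > 0 \<Longrightarrow> \<exists>\<delta>>0. \<forall>z. 0 < Im z \<longrightarrow> Im z < \<delta> \<longrightarrow> Im z < \<eta>2 \<longrightarrow> Im (v z) < \<epsilon>"
    by (rule boundary_lift[OF V Gi(1,2) G(2) Gi(3)]) blast+
  obtain \<delta>0 where \<delta>0: "\<delta>0 > 0" "\<And>z. 0 < Im z \<Longrightarrow> Im z < \<delta>0 \<Longrightarrow> Im z < \<eta>1 \<Longrightarrow> Im (u z) < \<eta>2"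
    using 1(7)[OF 2(1)] by blast
  define \<delta> where "\<delta> = min \<delta>0 \<eta>1"
  have \<delta>: "\<delta> > 0" "\<delta> \<le> \<delta>0" "\<delta> \<le> \<eta>1" using \<delta>0 1(1) by (auto simp: \<delta>_def)
  let ?S = "{z. 0 < Im z \<and> Im z < \<delta>}"
  have gS: "0 < Im (u z)" "Im (u z) < \<eta>2" if "z \<in> ?S" for z
    using 1(3)[of z] \<delta>0(2)[of z] that \<delta> by auto
  have int: "v (u z) - z \<in> \<int>" if zS: "z \<in> ?S" for z
  proof -
    have z: "0 < Im z" "Im z < \<eta>1" using zS \<delta> by auto
    have "\<Psi> (v (u z)) = Gi (\<Psi> (u z))" "0 < Im (v (u z))" using 2(3)[OF gS[OF zS]] by auto
    moreover have "Gi (\<Psi> (u z)) = \<Psi> z" using 1(3)[OF z] G(3)[of "\<Psi> z"] by auto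
    ultimately obtain n :: int where "v (u z) = z + of_int n" using \<Psi>_eq_iff[of "v (u z)" z] z(1) by auto
    then show ?thesis by simp
  qed
  have cg: "continuous_on {z. - \<eta>1 < Im z \<and> Im z < \<eta>1} u" and ch: "continuous_on {z. - \<eta>2 < Im z \<and> Im z < \<eta>2} v"
    using 1(2) 2(2) by (auto intro: holomorphic_on_imp_continuous_on)
  have cont: "continuous_on ?S (\<lambda>z. v (u z) - z)"
    by (intro continuous_intros continuous_on_compose2[OF ch] continuous_on_subset[OF cg]) (use gS \<delta> 2(1) in force)+
  obtain n :: int where n: "\<And>z. z \<in> ?S \<Longrightarrow> v (u z) - z = of_int n"
    by (rule Ints_valued_constant[OF connected_strip cont int], assumption, rule that)
  \<comment> \<open>The relation is known for small positive heights only and passes to the real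
    axis by continuity.\<close>
  have nR: "v (u (of_real t)) = of_real t + of_int n" for t :: real
  proof -
    define x where "x = complex_of_real t"
    have cgx: "isCont u x" using 1(1) cg open_strip by (auto simp: continuous_on_eq_continuous_at x_def)
    have "Im (u x) = 0" by (rule 1(4)) (simp add: x_def)
    then have "isCont v (u x)" using 2(1) ch open_strip by (auto simp: continuous_on_eq_continuous_at)
    then have "isCont (\<lambda>z. v (u z) - z) x" using cgx by (intro continuous_intros isCont_o2[OF cgx]) auto
    then have "((\<lambda>z. v (u z) - z) \<longlongrightarrow> v (u x) - x) (at x within ?S)"
      unfolding isCont_def by (rule tendsto_within_subset) auto
    moreover have "((\<lambda>z. v (u z) - z) \<longlongrightarrow> of_int n) (at x within ?S)"
      by (rule Lim_transform_eventually[OF tendsto_const]) (use n in \<open>auto simp: eventually_at_filter\<close>)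
    moreover have "at x within ?S \<noteq> bot"
    proof -
      have "\<exists>y\<in>?S. y \<noteq> x \<and> dist y x < e" if "e > 0" for e
        by (rule bexI[of _ "x + \<i> * of_real (min (e / 2) (\<delta> / 2))"]) (use that \<delta>(1) in \<open>auto simp: x_def dist_norm norm_mult complex_eq_iff min_def\<close>)
      then show ?thesis by (simp add: trivial_limit_within islimpt_approachable)
    qed
    ultimately have "v (u x) - x = of_int n" using tendsto_unique by blast
    then show ?thesis by (simp add: x_def algebra_simps)
  qed
  note dg = inverse_on_reals_deriv[OF 1(2,4,5) 2(2,4,5) 1(1) 2(1) nR]
  define \<rho> where "\<rho> t = Re (u (of_real t))" for t :: real
  define \<sigma> where "\<sigma> t = Re (v (of_real t))" for t :: real
  have u\<rho>: "u (of_real t) = of_real (\<rho> t)" for t using 1(4)[of "of_real t"] by (simp add: \<rho>_def complex_eq_iff)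
  have v\<sigma>: "v (of_real t) = of_real (\<sigma> t)" for t using 2(4)[of "of_real t"] by (simp add: \<sigma>_def complex_eq_iff)
  have \<sigma>\<rho>: "\<sigma> (\<rho> t) = t + of_int n" for t
  proof -
    have "of_real (\<sigma> (\<rho> t)) = (of_real (t + of_int n) :: complex)" using nR[of t] by (simp add: u\<rho> v\<sigma>)
    then show ?thesis by (simp only: of_real_eq_iff)
  qed
  have \<rho>der: "(\<rho> has_real_derivative Re (deriv u (of_real x))) (at x)" for x
    unfolding \<rho>_def by (rule of_real_restriction(1)[OF 1(2,1,4)])
  have \<rho>mono: "\<rho> s < \<rho> t" if "s < t" for s t
    using that by (rule DERIV_pos_imp_increasing) (use \<rho>der dg(1) in blast)
  have \<sigma>mono: "\<sigma> s \<le> \<sigma> t" if "s \<le> t" for s t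
  proof (rule DERIV_nonneg_imp_nondecreasing[OF that])
    show "\<exists>y. (\<sigma> has_real_derivative y) (at x) \<and> 0 \<le> y" for x
      unfolding \<sigma>_def using of_real_restriction(1)[OF 2(2,1,4), of x] 2(5)[of "of_real x"] by auto
  qed
  have \<rho>per: "\<rho> (t + 1) = \<rho> t + of_int k1" for t using 1(1) 1(6)[of "of_real t"] by (simp add: \<rho>_def)
  have \<sigma>per: "\<sigma> (t + 1) = \<sigma> t + of_int k2" for t using 2(1) 2(6)[of "of_real t"] by (simp add: \<sigma>_def)
  have \<sigma>pern: "\<sigma> (t + real m) = \<sigma> t + real m * of_int k2" for t m
  proof (induction m)
    case (Suc m)
    have "\<sigma> (t + real (Suc m)) = \<sigma> ((t + real m) + 1)" by (simp add: add_ac)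
    then show ?case using Suc \<sigma>per[of "t + real m"] by (simp add: algebra_simps)
  qed simp
  have "\<rho> 0 < \<rho> (0 + 1)" by (rule \<rho>mono) simp
  then have k1: "k1 > 0" using \<rho>per[of 0] by simp
  \<comment> \<open>One turn before \<open>\<rho>\<close> means \<open>k1\<close> turns before
    \<open>\<sigma>\<close> and, by the inverse relation, one turn in the end; hence
    \<open>k1 * k2 = 1\<close>.\<close>
  have "\<sigma> (\<rho> 0 + real (nat k1)) = \<sigma> (\<rho> 0) + 1" using \<sigma>\<rho>[of "0 + 1"] \<sigma>\<rho>[of 0] \<rho>per[of 0] k1 by simp
  then have "real_of_int (k1 * k2) = 1" using \<sigma>pern[of "\<rho> 0" "nat k1"] k1 by simp
  then have "k1 * k2 = 1" by linarith
  then have k1': "k1 = 1" using k1 by (simp add: zmult_eq_1_iff)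
  define v' where "v' z = v z - of_int n" for z
  have v'u: "v' (u (of_real t)) = of_real t" for t using nR[of t] by (simp add: v'_def)
  have hol': "v' holomorphic_on {z. - \<eta>2 < Im z \<and> Im z < \<eta>2}" unfolding v'_def by (intro holomorphic_intros 2(2))
  have Imh': "Im (v' z) = 0" if "Im z = 0" for z using 2(4)[OF that] by (simp add: v'_def)
  have dh': "deriv v' z = deriv v z" if "Im z = 0" for z
  proof -
    have "(v has_field_derivative deriv v z) (at z)" using 2(2) open_strip by (rule holomorphic_derivI) (use that 2(1) in auto)
    then have "(v' has_field_derivative deriv v z) (at z)" unfolding v'_def by (auto intro!: derivative_eq_intros)
    then show ?thesis by (rule DERIV_imp_deriv)
  qed
  have \<rho>cont: "continuous_on UNIV \<rho>" using \<rho>der by (meson DERIV_isCont continuous_at_imp_continuous_on)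
  have surj: "\<exists>t. \<rho> t = s" for s
  proof -
    have \<rho>n: "\<rho> (t + real m) = \<rho> t + real m" for t m
    proof (induction m)
      case (Suc m)
      have "\<rho> (t + real (Suc m)) = \<rho> ((t + real m) + 1)" by (simp add: add_ac)
      then show ?case using Suc \<rho>per[of "t + real m"] k1' by simp
    qed simp
    obtain m :: nat where m: "\<bar>s - \<rho> 0\<bar> < real m" using reals_Archimedean2 by blast
    have "\<rho> (- real m) = \<rho> 0 - real m" using \<rho>n[of "- real m" m] by simp
    moreover have "\<rho> (real m) = \<rho> 0 + real m" using \<rho>n[of 0 m] by simp
    ultimately have "\<exists>x\<ge>- real m. x \<le> real m \<and> \<rho> x = s"
      using m by (intro IVT') (auto intro: continuous_on_subset[OF \<rho>cont])
    then show ?thesis by blast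
  qed
  have gh': "u (v' z) = z" if "Im z = 0" for z
  proof -
    have z: "z = of_real (Re z)" using that by (simp add: complex_eq_iff)
    obtain t where t: "\<rho> t = Re z" using surj by blast
    then have "z = u (of_real t)" using z u\<rho>[of t] by simp
    then show ?thesis using v'u[of t] by simp
  qed
  have dpos: "0 < Re (deriv u z) \<and> 0 < Re (deriv v' z)" if "Im z = 0" for z
  proof -
    have z: "z = of_real (Re z)" using that by (simp add: complex_eq_iff)
    obtain t where t: "\<rho> t = Re z" using surj by blast
    then have "z = u (of_real t)" using z u\<rho>[of t] by simp
    then show ?thesis using dg(1)[of "Re z"] dg(2)[of t] z dh'[OF that] by simp
  qed
  define \<eta> where "\<eta> = min \<eta>1 \<eta>2"
  have \<eta>: "\<eta> \<le> \<eta>1" "\<eta> \<le> \<eta>2" "0 < \<eta>" using 1(1) 2(1) by (auto simp: \<eta>_def)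
  show ?thesis
  proof (rule that[of \<eta> u v'])
    show "u holomorphic_on {z. - \<eta> < Im z \<and> Im z < \<eta>}" using 1(2) by (rule holomorphic_on_subset) (use \<eta> in auto)
    show "v' holomorphic_on {z. - \<eta> < Im z \<and> Im z < \<eta>}" using hol' by (rule holomorphic_on_subset) (use \<eta> in auto)
    show "0 < Im (u z) \<and> \<Psi> (u z) = G (\<Psi> z) \<and> \<Psi> z \<in> V" if "0 < Im z" "Im z < \<eta>" for z using 1(3)[of z] that \<eta> by simp
    show "0 < Im (v' z) \<and> \<Psi> (v' z) = Gi (\<Psi> z)" if "0 < Im z" "Im z < \<eta>" for z
      using 2(3)[of z] that \<eta> \<Psi>_periodic[of "v z" "- n"] by (simp add: v'_def)
    show "Im (u z) = 0 \<and> Im (v' z) = 0 \<and> v' (u z) = z \<and> u (v' z) = z" if "Im z = 0" for z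
    proof -
      have "z = of_real (Re z)" using that by (simp add: complex_eq_iff)
      then show ?thesis using v'u[of "Re z"] gh'[OF that] 1(4)[OF that] Imh'[OF that] by simp
    qed
    show "u (z + 1) = u z + 1" if "- \<eta> < Im z" "Im z < \<eta>" for z using 1(6)[of z] that \<eta> k1' by simp
  qed (use dpos \<eta> in auto)
qed

end

section \<open>Orbits between two boundary fixed points\<close>

lemma convex_combination_pos:
  fixes a b s :: real
  assumes "0 < a" "0 < b" "0 \<le> s" "s \<le> 1"
  shows "0 < (1 - s) * a + s * b"
proof (cases "s = 0")
  case False
  then have "0 < s * b" "0 \<le> (1 - s) * a" using assms by auto
  then show ?thesis by linarith
qed (use assms in auto)

lemma nonvanishing_constant_sign:
  fixes \<phi> :: "real \<Rightarrow> real"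
  assumes "\<And>x. isCont \<phi> x" "\<And>x. a < x \<Longrightarrow> x < b \<Longrightarrow> \<phi> x \<noteq> 0" "a < c" "c < b" "0 < \<phi> c" "a < x" "x < b"
  shows "0 < \<phi> x"
proof (rule ccontr)
  assume n: "\<not> 0 < \<phi> x"
  have "connected (\<phi> ` {a<..<b})"
    by (intro connected_continuous_image continuous_at_imp_continuous_on ballI assms(1)) simp
  then have "0 \<in> \<phi> ` {a<..<b}"
    using connectedD_interval[of "\<phi> ` {a<..<b}" "\<phi> x" "\<phi> c" 0] n assms(3-7) by auto
  then show False using assms(2) by auto
qed

text \<open>Without fixed points in between, the real orbit of \<open>c\<close> is monotone, so its
  steps add up to at most \<open>b - a\<close> and \<open>orbit_distortion\<close> applies, with
  \<open>h\<close> providing the comparison of successive steps. A start at a height below a small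
  multiple of the first step stays within \<open>r\<close> of the real orbit for all time. Heights
  remain positive because \<open>g\<close> preserves the upper side.\<close>

lemma orbit_near_real_interval:
  assumes \<eta>: "0 < \<eta>" and g: "g holomorphic_on {z. - \<eta> < Im z \<and> Im z < \<eta>}" and h: "h holomorphic_on {z. - \<eta> < Im z \<and> Im z < \<eta>}"
    and real: "\<And>z. Im z = 0 \<Longrightarrow> Im (g z) = 0 \<and> h (g z) = z" and der: "\<And>z. Im z = 0 \<Longrightarrow> 0 < Re (deriv g z)"
    and up: "\<And>z. 0 < Im z \<Longrightarrow> Im z < \<eta> \<Longrightarrow> 0 < Im (g z)"
    and fp: "g (of_real a) = of_real a" "g (of_real b) = of_real b" and ac: "a < c" "c < b"
    and nofix: "\<And>x. a < x \<Longrightarrow> x < b \<Longrightarrow> g (of_real x) \<noteq> of_real x" and \<epsilon>: "0 < \<epsilon>" "\<epsilon> \<le> \<eta>"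
  obtains y0 where "y0 > 0" "\<And>y n. 0 < y \<Longrightarrow> y < y0 \<Longrightarrow> 0 < Im ((g ^^ n) (of_real c + \<i> * of_real y)) \<and> Im ((g ^^ n) (of_real c + \<i> * of_real y)) < \<epsilon>"
proof -
  define \<rho> where "\<rho> t = Re (g (of_real t))" for t :: real
  have g\<rho>: "g (of_real t) = of_real (\<rho> t)" for t using real[of "of_real t"] by (simp add: \<rho>_def complex_eq_iff)
  have \<rho>der: "(\<rho> has_real_derivative Re (deriv g (of_real x))) (at x)" for x
    unfolding \<rho>_def by (rule of_real_restriction(1)[OF g \<eta>]) (use real in blast)
  have \<rho>mono: "\<rho> s < \<rho> t" if "s < t" for s t
  proof (rule DERIV_pos_imp_increasing[OF that])
    fix x show "\<exists>y. (\<rho> has_real_derivative y) (at x) \<and> 0 < y" using \<rho>der[of x] der[of "of_real x"] by auto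
  qed
  have \<rho>ab: "\<rho> a = a" "\<rho> b = b" using fp by (auto simp: \<rho>_def)
  have \<rho>in: "a < \<rho> x" "\<rho> x < b" if "a < x" "x < b" for x using \<rho>mono[OF that(1)] \<rho>mono[OF that(2)] \<rho>ab by auto
  have \<rho>ne: "\<rho> x - x \<noteq> 0" if "a < x" "x < b" for x using nofix[OF that] g\<rho>[of x] by auto
  have cont: "isCont (\<lambda>x. \<rho> x - x) x" "isCont (\<lambda>x. x - \<rho> x) x" for x
    using DERIV_isCont[OF \<rho>der[of x]] by (auto intro!: continuous_intros)
  define X where "X n = (\<rho> ^^ n) c" for n
  have XS: "X (Suc n) = \<rho> (X n)" for n by (simp add: X_def)
  have Xin: "a < X n" "X n < b" for n
  proof -
    have "a < X n \<and> X n < b"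
      by (induction n) (use ac \<rho>in in \<open>auto simp: X_def\<close>)
    then show "a < X n" "X n < b" by auto
  qed
  have abs: "\<bar>X (Suc n) - X n\<bar> = (if \<rho> c > c then X (Suc n) - X n else X n - X (Suc n))" for n
  proof (cases "\<rho> c > c")
    case True
    have "0 < \<rho> (X n) - X n"
      by (rule nonvanishing_constant_sign[OF cont(1) \<rho>ne ac _ Xin]) (use True in auto)
    then show ?thesis using True by (simp add: XS)
  next
    case False
    have "0 < X n - \<rho> (X n)"
    proof (rule nonvanishing_constant_sign[OF cont(2) _ ac _ Xin])
      show "x - \<rho> x \<noteq> 0" if "a < x" "x < b" for x using \<rho>ne[OF that] by simp
      show "0 < c - \<rho> c" using False \<rho>ne[OF ac] by simp
    qed
    then show ?thesis using False by (simp add: XS)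
  qed
  have sum: "(\<Sum>k<N. \<bar>X (Suc k) - X k\<bar>) \<le> b - a" for N
  proof (cases "\<rho> c > c")
    case True
    then have "(\<Sum>k<N. \<bar>X (Suc k) - X k\<bar>) = X N - X 0" unfolding abs by (simp add: sum_lessThan_telescope)
    then show ?thesis using Xin[of N] Xin[of 0] by simp
  next
    case False
    then have "(\<Sum>k<N. \<bar>X (Suc k) - X k\<bar>) = X 0 - X N" unfolding abs by (simp add: sum_lessThan_telescope')
    then show ?thesis using Xin[of N] Xin[of 0] by simp
  qed
  define Q where "Q = cbox (Complex (a - 1) (- \<eta> / 2)) (Complex (b + 1) (\<eta> / 2))"
  have Qmem: "z \<in> Q \<longleftrightarrow> a - 1 \<le> Re z \<and> Re z \<le> b + 1 \<and> - \<eta> / 2 \<le> Im z \<and> Im z \<le> \<eta> / 2" for z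
    by (auto simp: Q_def in_cbox_complex_iff)
  have Q: "compact Q" "convex Q" "Q \<subseteq> {z. - \<eta> < Im z \<and> Im z < \<eta>}" using \<eta> by (auto simp: Q_def in_cbox_complex_iff)
  obtain C where C: "0 \<le> C" "\<And>x w. x \<in> Q \<Longrightarrow> w \<in> Q \<Longrightarrow> cmod (g w - g x - deriv g x * (w - x)) \<le> C * (cmod (w - x))\<^sup>2"
    by (rule taylor_bound_convex_compact[OF g open_strip Q(3,1,2)]) blast
  have "deriv h holomorphic_on {z. - \<eta> < Im z \<and> Im z < \<eta>}" using h open_strip by (rule holomorphic_deriv)
  then have "compact (deriv h ` Q)"
    using Q by (intro compact_continuous_image) (auto intro: holomorphic_on_imp_continuous_on continuous_on_subset)
  then obtain M0 where M0: "\<And>z. z \<in> Q \<Longrightarrow> cmod (deriv h z) \<le> M0" by (metis bounded_iff compact_imp_bounded imageI)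
  define M where "M = max 0 M0"
  have M: "0 \<le> M" "\<And>z. z \<in> Q \<Longrightarrow> cmod (deriv h z) \<le> M" using M0 by (auto simp: M_def intro: max.coboundedI2)
  have hlip: "cmod (h u - h v) \<le> M * cmod (u - v)" if "u \<in> Q" "v \<in> Q" for u v
  proof (rule field_differentiable_bound[OF Q(2) _ M(2) that])
    show "(h has_field_derivative deriv h z) (at z within Q)" if "z \<in> Q" for z
      using holomorphic_derivI[OF h open_strip, of z] that Q(3) by (auto intro: has_field_derivative_at_within)
  qed
  define L where "L = b - a"
  have L: "L > 0" using ac by (simp add: L_def)
  define Y where "Y = exp (2 * C * M * L)"
  have Y: "Y > 0" by (simp add: Y_def)
  \<comment> \<open>The first two bounds keep the discs about the real orbit inside the box
    \<open>Q\<close>; the last one yields heights below \<open>\<epsilon>\<close>.\<close>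
  define r where "r = min (min 1 (\<eta> / 2)) (\<epsilon> / 2)"
  have r: "0 < r" "r \<le> 1" "r \<le> \<eta> / 2" "r < \<epsilon>" using \<eta> \<epsilon> by (auto simp: r_def min_def)
  define \<kappa> where "\<kappa> = min 1 (r / L) / Y"
  have \<kappa>: "\<kappa> > 0" "\<kappa> * Y \<le> 1" "\<kappa> * Y \<le> r / L" using Y r L by (auto simp: \<kappa>_def)
  have dX: "\<bar>X (Suc n) - X n\<bar> \<le> L" for n using Xin[of n] Xin[of "Suc n"] by (simp add: L_def)
  have \<kappa>d: "\<kappa> * Y * \<bar>X (Suc n) - X n\<bar> \<le> r" for n
  proof -
    have "\<kappa> * Y * \<bar>X (Suc n) - X n\<bar> \<le> (r / L) * L" using \<kappa> Y dX[of n] r L by (intro mult_mono) auto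
    then show ?thesis using L by simp
  qed
  define x where "x n = complex_of_real (X n)" for n
  have xS: "x (Suc n) = g (x n)" for n by (simp add: x_def g\<rho> XS)
  have nx: "cmod (x (Suc n) - x n) = \<bar>X (Suc n) - X n\<bar>" for n
    unfolding x_def of_real_diff[symmetric] norm_of_real by simp
  have xQ: "w \<in> Q" if "cmod (w - x n) \<le> r" for w n
  proof -
    have "\<bar>Re w - X n\<bar> \<le> r" "\<bar>Im w\<bar> \<le> r"
      using abs_Re_le_cmod[of "w - x n"] abs_Im_le_cmod[of "w - x n"] that by (auto simp: x_def)
    then show ?thesis unfolding Qmem using r Xin[of n] by linarith
  qed
  have xQ0: "x n \<in> Q" for n using xQ[of "x n" n] r by simp
  define y0 where "y0 = \<kappa> * \<bar>X 1 - X 0\<bar>"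
  have "X 1 - X 0 \<noteq> 0" using \<rho>ne[OF ac] by (simp add: X_def)
  then have y0: "y0 > 0" using \<kappa> by (simp add: y0_def)
  have "0 < Im ((g ^^ n) (of_real c + \<i> * of_real y)) \<and> Im ((g ^^ n) (of_real c + \<i> * of_real y)) < \<epsilon>"
    if y: "0 < y" "y < y0" for y n
  proof -
    define v where "v n = (g ^^ n) (of_real c + \<i> * of_real y)" for n
    have vS: "v (Suc n) = g (v n)" for n by (simp add: v_def)
    have "cmod (v n - x n) \<le> \<kappa> * exp (2 * C * M * L) * cmod (x (Suc n) - x n)" for n
    proof (rule orbit_distortion[where \<Phi> = g and x = x and y = v and D = "\<lambda>n. deriv g (x n)" and N = n and r = r])
      show "cmod (g w - g (x i) - deriv g (x i) * (w - x i)) \<le> C * (cmod (w - x i))\<^sup>2"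
        if "i < n" "cmod (w - x i) \<le> r \<or> w = x (Suc i)" for i w
        by (rule C(2)) (use xQ0 xQ that(2) in auto)
      show "cmod (x (Suc i) - x i) \<le> M * cmod (x (Suc (Suc i)) - x (Suc i))" if "i < n" for i
      proof -
        have "h (x (Suc k)) = x k" for k unfolding xS using real[of "x k"] by (simp add: x_def)
        then show ?thesis using hlip[OF xQ0[of "Suc (Suc i)"] xQ0[of "Suc i"]] by simp
      qed
      show "(\<Sum>k<n. cmod (x (Suc k) - x k)) \<le> L" unfolding nx L_def by (rule sum)
      show "\<kappa> * exp (2 * C * M * L) \<le> 1" using \<kappa>(2) by (simp add: Y_def)
      show "\<kappa> * exp (2 * C * M * L) * cmod (x (Suc i) - x i) \<le> r" if "i < n" for i
        using \<kappa>d[of i] unfolding nx Y_def .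
      show "cmod (v 0 - x 0) \<le> \<kappa> * cmod (x 1 - x 0)"
      proof -
        have "v 0 - x 0 = \<i> * of_real y" by (simp add: v_def x_def X_def)
        then have "cmod (v 0 - x 0) = y" using y(1) by (simp add: norm_mult)
        then show ?thesis using y(2) nx[of 0] by (simp add: y0_def)
      qed
    qed (use xS vS \<kappa>(1) C(1) M(1) in \<open>simp_all add: less_imp_le\<close>)
    then have d: "cmod (v n - x n) \<le> r" for n using \<kappa>d[of n] unfolding nx Y_def by (rule order_trans)
    have vlt: "Im (v n) < \<epsilon>" for n
    proof -
      have "Im (v n) \<le> cmod (v n - x n)" using abs_Im_le_cmod[of "v n - x n"] by (simp add: x_def)
      then show ?thesis using d[of n] r(4) by linarith
    qed
    have "0 < Im (v n)" for n
    proof (induction n)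
      case 0
      then show ?case using y(1) by (simp add: v_def)
    next
      case (Suc n)
      then show ?case unfolding vS using up vlt[of n] \<epsilon>(2) by simp
    qed
    then show ?thesis using vlt by (simp add: v_def)
  qed
  then show ?thesis using that y0 by blast
qed

section \<open>Boundary fixed points from the argument principle\<close>

lemma zorder_ge_2:
  assumes "f holomorphic_on S" "open S" "connected S" "z \<in> S" "f z = 0" "deriv f z = 0" "\<exists>w\<in>S. f w \<noteq> 0"
  shows "zorder f z \<ge> 2"
proof -
  define g where "g = zor_poly f z"
  obtain r where r: "zorder f z > 0" "r > 0" "cball z r \<subseteq> S" "g holomorphic_on cball z r"
    "\<And>w. w \<in> cball z r \<Longrightarrow> f w = g w * (w - z) ^ nat (zorder f z) \<and> g w \<noteq> 0"
    using zorder_exist_zero[OF assms(1-4,7)] assms(5) unfolding g_def by auto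
  show ?thesis
  proof (rule ccontr)
    assume "\<not> ?thesis"
    then have n: "nat (zorder f z) = 1" using r(1) by simp
    have gh: "g holomorphic_on ball z r" using r(4) by (rule holomorphic_on_subset) auto
    have "(g has_field_derivative deriv g z) (at z)" using gh open_ball by (rule holomorphic_derivI) (use r in auto)
    then have "((\<lambda>w. g w * (w - z)) has_field_derivative g z) (at z)" by (auto intro!: derivative_eq_intros)
    moreover have "\<forall>\<^sub>F w in nhds z. w \<in> ball z r" by (rule eventually_nhds_in_open) (use r(2) in auto)
    then have "\<forall>\<^sub>F w in nhds z. f w = g w * (w - z)" by eventually_elim (use r(5) n in auto)
    ultimately have "deriv f z = g z" by (metis DERIV_imp_deriv deriv_cong_ev)
    then show False using assms(6) r(2) r(5)[of z] by auto
  qed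
qed

context exterior_chart
begin

text \<open>The points of height at least \<open>e\<close> have a connected image disjoint from the
  loop. It is unbounded, because heights tending to infinity lead to infinity.\<close>

lemma outside_loop:
  assumes "e > y" "y > 0" "e \<le> Im \<xi>"
  shows "winding_number (\<lambda>x. \<Psi> (of_real x + \<i> * of_real y)) (\<Psi> \<xi>) = 0"
proof -
  define \<gamma> where "\<gamma> = (\<lambda>x::real. \<Psi> (of_real x + \<i> * of_real y))"
  have cP: "continuous_on {\<zeta>. 0 < Im \<zeta>} \<Psi>" using hol_\<Psi> by (rule holomorphic_on_imp_continuous_on)
  have "path \<gamma>" unfolding path_def \<gamma>_def
    by (rule continuous_on_compose2[OF cP]) (use assms in \<open>auto intro!: continuous_intros\<close>)
  moreover have "pathfinish \<gamma> = pathstart \<gamma>"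
    using \<Psi>_periodic[of "\<i> * of_real y" 1] by (simp add: pathfinish_def pathstart_def \<gamma>_def add.commute)
  moreover have "\<Psi> \<xi> \<in> outside (path_image \<gamma>)"
  proof -
    define A where "A = \<Psi> ` {\<zeta>. e \<le> Im \<zeta>}"
    have "convex {\<zeta>. e \<le> Im \<zeta>}"
    proof (unfold convex_def, intro ballI allI impI)
      fix w z :: complex and s t :: real
      assume *: "w \<in> {\<zeta>. e \<le> Im \<zeta>}" "z \<in> {\<zeta>. e \<le> Im \<zeta>}" "0 \<le> s" "0 \<le> t" "s + t = 1"
      then have "s * e + t * e \<le> s * Im w + t * Im z" by (intro add_mono mult_left_mono) auto
      moreover have "s * e + t * e = e" using *(5) by (metis distrib_right mult_1)
      ultimately show "s *\<^sub>R w + t *\<^sub>R z \<in> {\<zeta>. e \<le> Im \<zeta>}" by simp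
    qed
    then have cA: "connected A" unfolding A_def
      by (intro connected_continuous_image continuous_on_subset[OF cP] convex_connected) (use assms in auto)
    have xA: "\<Psi> \<xi> \<in> A" using assms(3) by (auto simp: A_def)
    have disj: "A \<subseteq> - path_image \<gamma>"
    proof
      fix z assume "z \<in> A"
      then obtain \<zeta> where \<zeta>: "e \<le> Im \<zeta>" "z = \<Psi> \<zeta>" by (auto simp: A_def)
      have "\<Psi> \<zeta> \<noteq> \<gamma> x" for x
      proof
        assume "\<Psi> \<zeta> = \<gamma> x"
        then obtain n :: int where "\<zeta> = of_real x + \<i> * of_real y + of_int n"
          using \<Psi>_eq_iff[of \<zeta> "of_real x + \<i> * of_real y"] \<zeta>(1) assms by (auto simp: \<gamma>_def)
        then have "Im \<zeta> = y" by simp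
        then show False using \<zeta>(1) assms by simp
      qed
      then show "z \<in> - path_image \<gamma>" using \<zeta>(2) by (auto simp: path_image_def)
    qed
    have unb: "\<not> bounded A"
    proof
      assume "bounded A"
      then obtain B where B: "B > 0" "\<And>z. z \<in> A \<Longrightarrow> cmod z \<le> B" using bounded_pos by blast
      have "isCont g 0" using holg by (auto intro: continuous_on_interior holomorphic_on_imp_continuous_on)
      then obtain s where s: "s > 0" "\<And>w. cmod w < s \<Longrightarrow> cmod (g w) < 1 / B"
        using g0 B(1) unfolding continuous_at_eps_delta by (auto simp: dist_norm) (metis divide_pos_pos zero_less_one)
      obtain w where w: "w \<in> ball 0 1" "w \<noteq> 0" "cmod w < min s (exp (- (2 * pi * e)))"
      proof (rule that)
        show "of_real (min (min s (exp (- (2 * pi * e)))) 1 / 2) \<in> ball (0::complex) 1" using s(1) by simp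
      qed (use s(1) in \<open>auto simp: min_def\<close>)
      obtain \<zeta> where \<zeta>: "0 < Im \<zeta>" "E \<zeta> = w" using E_preimage[OF w(1,2)] by blast
      have "exp (- (2 * pi * Im \<zeta>)) < exp (- (2 * pi * e))" using norm_E[of \<zeta>] \<zeta>(2) w(3) by simp
      then have "e \<le> Im \<zeta>" by simp
      then have "cmod (\<Psi> \<zeta>) \<le> B" using B(2) by (auto simp: A_def)
      moreover have "cmod (\<Psi> \<zeta>) = 1 / cmod (g w)" using \<zeta>(2) by (simp add: \<Psi>_def norm_inverse inverse_eq_divide norm_divide)
      ultimately have "1 \<le> B * cmod (g w)" using gK[OF w(1,2)] by (simp add: pos_divide_le_eq)
      moreover have "cmod (g w) < 1 / B" using s(2) w(3) by simp
      then have "B * cmod (g w) < 1" using B(1) by (simp add: pos_less_divide_eq mult.commute)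
      ultimately show False by simp
    qed
    have "A \<subseteq> connected_component_set (- path_image \<gamma>) (\<Psi> \<xi>)"
      by (rule connected_component_maximal[OF xA cA disj])
    then have "\<not> bounded (connected_component_set (- path_image \<gamma>) (\<Psi> \<xi>))"
      using unb bounded_subset by blast
    then show ?thesis using xA disj by (auto simp: outside_def)
  qed
  ultimately show ?thesis using winding_number_zero_in_outside unfolding \<gamma>_def by blast
qed

text \<open>If the boundary map moves every point, the displacement of G along a loop near K has winding
  number -1, while the argument principle counts every zero in K with the sign -1.\<close>

lemma multiple_fixed_point_gives_boundary_fixed_point:
  assumes V: "open V" "K \<subseteq> V" and conK: "connected K" and G: "G holomorphic_on V" "G 0 = 0" "deriv G 0 = 1"
    and \<eta>: "0 < \<eta>" and u: "u holomorphic_on {z. - \<eta> < Im z \<and> Im z < \<eta>}"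
    and up: "\<And>z. 0 < Im z \<Longrightarrow> Im z < \<eta> \<Longrightarrow> 0 < Im (u z) \<and> \<Psi> (u z) = G (\<Psi> z) \<and> \<Psi> z \<in> V"
    and real: "\<And>z. Im z = 0 \<Longrightarrow> Im (u z) = 0"
    and per: "\<And>z. - \<eta> < Im z \<Longrightarrow> Im z < \<eta> \<Longrightarrow> u (z + 1) = u z + 1"
  shows "\<exists>x::real. u (of_real x) - of_real x \<in> \<int>"
proof (rule ccontr)
  assume no: "\<not> ?thesis"
  have cu: "continuous_on {z. - \<eta> < Im z \<and> Im z < \<eta>} u" using u by (rule holomorphic_on_imp_continuous_on)
  \<comment> \<open>Subtracting the integer part moves the displacement at 0 into the open unit
    interval. It is never an integer on the real line, so it stays there; by compactness and
    periodicity its real part does so in a thin strip too.\<close>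
  define n where "n = \<lfloor>Re (u 0)\<rfloor>"
  define D where "D z = u z - z - of_int n" for z
  have cD: "continuous_on {z. - \<eta> < Im z \<and> Im z < \<eta>} D" unfolding D_def by (intro continuous_intros cu)
  define \<delta> where "\<delta> x = Re (D (of_real x))" for x :: real
  have cont: "continuous_on UNIV \<delta>" unfolding \<delta>_def
    by (intro continuous_intros continuous_on_compose2[OF cD]) (use \<eta> in \<open>auto intro!: continuous_intros\<close>)
  have \<delta>Z: "\<delta> x \<notin> \<int>" for x
  proof
    assume "\<delta> x \<in> \<int>"
    then obtain k :: int where "\<delta> x = of_int k" by (rule Ints_cases)
    then have "Re (u (of_real x)) - x = of_int (k + n)" by (simp add: \<delta>_def D_def)
    then have "u (of_real x) - of_real x = of_int (k + n)" using real[of "of_real x"] by (simp add: complex_eq_iff)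
    then show False using no by (metis Ints_of_int)
  qed
  have \<delta>0: "0 < \<delta> 0" "\<delta> 0 < 1"
  proof -
    have "\<delta> 0 = frac (Re (u 0))" by (simp add: \<delta>_def D_def n_def frac_def)
    moreover have "\<delta> 0 \<noteq> 0" using \<delta>Z[of 0] by auto
    ultimately show "0 < \<delta> 0" "\<delta> 0 < 1" using frac_ge_0[of "Re (u 0)"] frac_lt_1[of "Re (u 0)"] by auto
  qed
  have \<delta>: "0 < \<delta> x \<and> \<delta> x < 1" for x
  proof -
    have con: "connected (range \<delta>)" using cont by (intro connected_continuous_image) auto
    have "\<not> \<delta> x \<le> 0"
    proof
      assume "\<delta> x \<le> 0"
      then have "0 \<in> range \<delta>" using connectedD_interval[OF con, of "\<delta> x" "\<delta> 0" 0] \<delta>0 by auto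
      then obtain t where "\<delta> t = 0" by auto
      then show False using \<delta>Z[of t] by simp
    qed
    moreover have "\<not> 1 \<le> \<delta> x"
    proof
      assume "1 \<le> \<delta> x"
      then have "1 \<in> range \<delta>" using connectedD_interval[OF con, of "\<delta> 0" "\<delta> x" 1] \<delta>0 by auto
      then obtain t where "\<delta> t = 1" by auto
      then show False using \<delta>Z[of t] by simp
    qed
    ultimately show ?thesis by simp
  qed
  define W where "W = {z. - \<eta> < Im z \<and> Im z < \<eta>} \<inter> D -` {w. 0 < Re w \<and> Re w < 1}"
  have "open {w::complex. 0 < Re w \<and> Re w < 1}"
    by (intro open_Collect_conj open_Collect_less continuous_intros)
  then have oW: "open W" unfolding W_def by (intro continuous_open_preimage cD open_strip)
  have "compact (of_real ` {0..1::real} :: complex set)" by (intro compact_continuous_image continuous_intros) auto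
  moreover have "of_real ` {0..1::real} \<subseteq> W" using \<delta> \<eta> by (auto simp: W_def \<delta>_def)
  ultimately obtain e where e: "e > 0" "(\<Union>x\<in>of_real ` {0..1::real}. ball x e) \<subseteq> W"
    using compact_subset_open_imp_ball_epsilon_subset oW by metis
  have Wn: "- \<eta> < Im z \<and> Im z < \<eta> \<and> 0 < Re (D z) \<and> Re (D z) < 1" if "0 \<le> Re z" "Re z \<le> 1" "\<bar>Im z\<bar> < e" for z
  proof -
    have "z - of_real (Re z) = \<i> * of_real (Im z)" by (simp add: complex_eq_iff)
    then have "dist (of_real (Re z)) z < e" using that(3) by (simp add: dist_norm norm_minus_commute norm_mult)
    then have "z \<in> ball (of_real (Re z)) e" by simp
    moreover have "complex_of_real (Re z) \<in> of_real ` {0..1}" using that(1,2) by auto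
    ultimately have "z \<in> W" using e(2) by (meson UN_I subsetD)
    then show ?thesis by (simp add: W_def)
  qed
  have e\<eta>: "e \<le> \<eta>"
  proof (rule ccontr)
    assume "\<not> e \<le> \<eta>"
    then show False using Wn[of "\<i> * of_real \<eta>"] \<eta> by simp
  qed
  have Dper: "D (z + 1) = D z" if "\<bar>Im z\<bar> < e" for z using per[of z] that e\<eta> by (simp add: D_def)
  have Dn: "D (z + of_nat m) = D z" if "\<bar>Im z\<bar> < e" for z m
  proof (induction m)
    case (Suc m)
    have "D (z + of_nat (Suc m)) = D ((z + of_nat m) + 1)" by (simp add: add_ac)
    then show ?case using Dper[of "z + of_nat m"] Suc that by simp
  qed simp
  have Di: "D (z + of_int m) = D z" if "\<bar>Im z\<bar> < e" for z m
  proof (cases "m \<ge> 0")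
    case True
    then show ?thesis using Dn[OF that, of "nat m"] by simp
  next
    case False
    then show ?thesis using Dn[of "z + of_int m" "nat (- m)"] that by simp
  qed
  have DW: "0 < Re (D z) \<and> Re (D z) < 1" if "\<bar>Im z\<bar> < e" for z
  proof -
    have "0 \<le> Re (z + of_int (- \<lfloor>Re z\<rfloor>))" "Re (z + of_int (- \<lfloor>Re z\<rfloor>)) \<le> 1"
      using frac_ge_0[of "Re z"] frac_lt_1[of "Re z"] by (simp_all add: frac_def)
    then show ?thesis using Wn[of "z + of_int (- \<lfloor>Re z\<rfloor>)"] Di[OF that, of "- \<lfloor>Re z\<rfloor>"] that by simp
  qed
  have \<Psi>D: "\<Psi> (z + D z) = G (\<Psi> z) \<and> \<Psi> z \<in> V \<and> 0 < Im (z + D z)" if "0 < Im z" "Im z < e" for z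
    using up[of z] that e\<eta> \<Psi>_periodic[of "u z" "- n"] by (simp add: D_def)
  have moved: "\<Psi> (z + w) \<noteq> \<Psi> z" if zw: "0 < Im z" "0 < Im (z + w)" "0 < Re w" "Re w < 1" for z w
  proof
    assume "\<Psi> (z + w) = \<Psi> z"
    then obtain k :: int where "z + w = z + of_int k" using \<Psi>_eq_iff[OF zw(2,1)] by blast
    then have "Re w = of_int k" by simp
    then show False using zw(3,4) by simp
  qed
  define y where "y = e / 2"
  have y: "0 < y" "y < e" using e by (auto simp: y_def)
  define \<zeta> where "\<zeta> x = of_real x + \<i> * of_real y" for x :: real
  have \<zeta>: "0 < Im (\<zeta> x)" "Im (\<zeta> x) < e" "\<bar>Im (\<zeta> x)\<bar> < e" for x using y by (auto simp: \<zeta>_def)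
  have \<zeta>1: "\<zeta> 1 = \<zeta> 0 + 1" by (simp add: \<zeta>_def)
  define \<gamma> where "\<gamma> x = \<Psi> (\<zeta> x)" for x
  define F where "F z = G z - z" for z
  have cP: "continuous_on {\<zeta>. 0 < Im \<zeta>} \<Psi>" using hol_\<Psi> by (rule holomorphic_on_imp_continuous_on)
  \<comment> \<open>The displacement of the lift is deformed linearly into the constant 1 / 2. Its
    real part stays strictly between 0 and 1 and all points stay in the upper half-plane, so
    injectivity of \<open>\<Psi>\<close> modulo integers keeps the difference nonzero.\<close>
  have "homotopic_loops (- {0}) (F \<circ> \<gamma>) (\<lambda>x. \<Psi> (\<zeta> x + 1 / 2) - \<Psi> (\<zeta> x))"
    unfolding homotopic_loops
  proof (intro exI conjI ballI)
    define H where "H p = \<Psi> (\<zeta> (snd p) + (of_real (1 - fst p) * D (\<zeta> (snd p)) + of_real (fst p) * (1 / 2))) - \<Psi> (\<zeta> (snd p))" for p :: "real \<times> real"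
    have Hn: "0 < Im (\<zeta> x + (of_real (1 - s) * D (\<zeta> x) + of_real s * (1 / 2)))
        \<and> 0 < Re (of_real (1 - s) * D (\<zeta> x) + of_real s * (1 / 2)) \<and> Re (of_real (1 - s) * D (\<zeta> x) + of_real s * (1 / 2)) < 1"
      if "0 \<le> s" "s \<le> 1" for s x
    proof -
      have D: "0 < Re (D (\<zeta> x))" "Re (D (\<zeta> x)) < 1" using DW[OF \<zeta>(3)] by auto
      have "0 < Im (\<zeta> x + D (\<zeta> x))" using \<Psi>D[OF \<zeta>(1,2)] by simp
      then have "0 < (1 - s) * Im (\<zeta> x + D (\<zeta> x)) + s * Im (\<zeta> x)"
        by (rule convex_combination_pos[OF _ \<zeta>(1) that])
      then have 1: "0 < Im (\<zeta> x + (of_real (1 - s) * D (\<zeta> x) + of_real s * (1 / 2)))" by (simp add: algebra_simps)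
      have "0 < (1 - s) * Re (D (\<zeta> x)) + s * (1 / 2)"
        by (rule convex_combination_pos[OF D(1) _ that]) simp
      moreover have "0 < (1 - s) * (1 - Re (D (\<zeta> x))) + s * (1 / 2)"
        by (rule convex_combination_pos[OF _ _ that]) (use D(2) in simp_all)
      ultimately show ?thesis using 1 by (simp add: algebra_simps)
    qed
    have \<zeta>in: "- \<eta> < Im (\<zeta> x) \<and> Im (\<zeta> x) < \<eta>" for x using \<zeta>(1,2)[of x] e\<eta> \<eta> by linarith
    have c\<zeta>: "continuous_on A (\<lambda>p. \<zeta> (snd p))" for A :: "(real \<times> real) set" unfolding \<zeta>_def by (intro continuous_intros)
    have cDz: "continuous_on A (\<lambda>p. D (\<zeta> (snd p)))" for A :: "(real \<times> real) set"
      by (rule continuous_on_compose2[OF cD c\<zeta>]) (use \<zeta>in in auto)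
    show "continuous_on ({0..1} \<times> {0..1}) H" unfolding H_def
      by (intro continuous_on_diff continuous_on_compose2[OF cP] continuous_intros c\<zeta> cDz) (use Hn \<zeta> in auto)
    show "H \<in> {0..1} \<times> {0..1} \<rightarrow> - {0}"
    proof
      fix p :: "real \<times> real" assume "p \<in> {0..1} \<times> {0..1}"
      then show "H p \<in> - {0}" using Hn[of "fst p" "snd p"] moved[OF \<zeta>(1)] by (auto simp: H_def)
    qed
    show "H (0, x) = (F \<circ> \<gamma>) x" for x using \<Psi>D[OF \<zeta>(1,2)] by (simp add: H_def F_def \<gamma>_def)
    show "H (1, x) = \<Psi> (\<zeta> x + 1 / 2) - \<Psi> (\<zeta> x)" for x by (simp add: H_def)
    show "pathfinish (H \<circ> Pair s) = pathstart (H \<circ> Pair s)" for s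
    proof -
      have "D (\<zeta> 1) = D (\<zeta> 0)" unfolding \<zeta>1 by (rule Dper[OF \<zeta>(3)])
      moreover have "\<Psi> (\<zeta> 0 + 1 + w) = \<Psi> (\<zeta> 0 + w)" for w using \<Psi>_periodic[of "\<zeta> 0 + w" 1] by (simp add: add_ac)
      ultimately show ?thesis using \<Psi>_periodic[of "\<zeta> 0" 1] by (simp add: pathfinish_def pathstart_def H_def \<zeta>1)
    qed
  qed
  then have "winding_number (F \<circ> \<gamma>) 0 = winding_number (\<lambda>x. \<Psi> (\<zeta> x + 1 / 2) - \<Psi> (\<zeta> x)) 0"
    by (rule winding_number_homotopic_loops)
  then have wF: "winding_number (F \<circ> \<gamma>) 0 = -1" using winding_antipodal[OF y(1)] by (simp add: \<zeta>_def)
  \<comment> \<open>The loop \<open>\<gamma>\<close> lies in this neighbourhood of \<open>K\<close>,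
    at half its height. All zeros of \<open>F\<close> in \<open>S\<close> lie in \<open>K\<close>,
    where the loop has winding number -1.\<close>
  define S where "S = K \<union> \<Psi> ` {z. 0 < Im z \<and> Im z < e}"
  have oS: "open S" unfolding S_def by (rule \<Psi>_strip_open[OF e(1)])
  have SV: "S \<subseteq> V" using V(2) \<Psi>D by (auto simp: S_def)
  have holF: "F holomorphic_on S" unfolding F_def using G(1) SV by (intro holomorphic_intros) (auto intro: holomorphic_on_subset)
  have F\<Psi>: "F (\<Psi> z) \<noteq> 0" if "0 < Im z" "Im z < e" for z
    using moved[OF that(1), of "D z"] \<Psi>D[OF that] DW[of z] that by (simp add: F_def)
  have conS: "connected S" unfolding S_def
  proof (rule connected_Un_closure[OF conK])
    show "connected (\<Psi> ` {z. 0 < Im z \<and> Im z < e})"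
      by (intro connected_continuous_image connected_strip continuous_on_subset[OF cP]) auto
    show "closure (\<Psi> ` {z. 0 < Im z \<and> Im z < e}) \<inter> K \<noteq> {}"
    proof (rule ccontr)
      let ?P = "\<Psi> ` {z. 0 < Im z \<and> Im z < e}"
      assume "\<not> ?thesis"
      then have "open (- closure ?P)" "K \<subseteq> - closure ?P" by auto
      then obtain t where t: "t > 0" "\<And>z. 0 < Im z \<Longrightarrow> Im z < t \<Longrightarrow> \<Psi> z \<in> - closure ?P" using \<Psi>_near by blast
      define z where "z = \<i> * of_real (min t e / 2)"
      have z: "0 < Im z" "Im z < t" "Im z < e" using t(1) e(1) by (auto simp: z_def min_def)
      then have "\<Psi> z \<in> ?P" by (intro imageI) simp
      then have "\<Psi> z \<in> closure ?P" by (rule subsetD[OF closure_subset])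
      with ComplD[OF t(2)[OF z(1,2)]] show False by (rule notE)
    qed
  qed
  have \<gamma>lin: "\<gamma> = \<Psi> \<circ> linepath (\<zeta> 0) (\<zeta> 1)"
    by (auto simp: \<gamma>_def \<zeta>_def linepath_def fun_eq_iff scaleR_conv_of_real algebra_simps)
  have "valid_path (\<Psi> \<circ> linepath (\<zeta> 0) (\<zeta> 1))"
  proof (rule valid_path_compose_holomorphic[OF valid_path_linepath hol_\<Psi>])
    show "open {\<zeta>. 0 < Im \<zeta>}" by (rule open_halfspace_Im_gt)
    have "closed_segment (\<zeta> 0) (\<zeta> 1) \<subseteq> {\<zeta>. 0 < Im \<zeta>}"
      by (rule closed_segment_subset) (use \<zeta>(1) convex_halfspace_Im_gt[of 0] in auto)
    then show "path_image (linepath (\<zeta> 0) (\<zeta> 1)) \<subseteq> {\<zeta>. 0 < Im \<zeta>}" by simp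
  qed
  then have vp: "valid_path \<gamma>" by (simp add: \<gamma>lin)
  have img: "\<gamma> x \<in> S" "F (\<gamma> x) \<noteq> 0" for x using F\<Psi>[OF \<zeta>(1,2)] \<zeta>(1,2) by (auto simp: \<gamma>_def S_def)
  \<comment> \<open>The empty set stands for the poles in the argument principle, and the factor 1
    in the integral below for its weight function.\<close>
  define Z where "Z = {w \<in> S. F w = 0 \<or> w \<in> {}}"
  have ZK: "Z \<subseteq> K" using F\<Psi> by (auto simp: Z_def S_def)
  have Z0: "0 \<in> Z" using K(2) G(2) by (auto simp: Z_def S_def F_def)
  have nc: "\<exists>w\<in>S. F w \<noteq> 0" using img by blast
  have "finite {w \<in> K. F w = 0}"
  proof (rule holomorphic_compact_finite_zeros[OF holF oS conS K(1)])
    show "K \<subseteq> S" by (auto simp: S_def)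
    show "\<not> F constant_on S" using nc Z0 unfolding constant_on_def Z_def by force
  qed
  then have finZ: "finite Z" by (rule finite_subset[rotated]) (use ZK in \<open>auto simp: Z_def\<close>)
  have "contour_integral \<gamma> (\<lambda>x. deriv F x * 1 / F x) = 2 * pi * \<i> * (\<Sum>p\<in>Z. winding_number \<gamma> p * 1 * zorder F p)"
    unfolding Z_def
  proof (rule argument_principle[OF oS conS])
    show "valid_path \<gamma>" by (rule vp)
    show "pathfinish \<gamma> = pathstart \<gamma>" using \<Psi>_periodic[of "\<zeta> 0" 1] by (simp add: pathfinish_def pathstart_def \<gamma>_def \<zeta>1)
    show "path_image \<gamma> \<subseteq> S - {w \<in> S. F w = 0 \<or> w \<in> {}}" using img by (auto simp: path_image_def)
    show "\<forall>z. z \<notin> S \<longrightarrow> winding_number \<gamma> z = 0"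
    proof (intro allI impI)
      fix z assume z: "z \<notin> S"
      then have "z \<notin> K" by (simp add: S_def)
      then obtain \<xi> where \<xi>: "0 < Im \<xi>" "\<Psi> \<xi> = z" "E \<xi> = f z" by (rule \<Psi>_surj)
      then have "e \<le> Im \<xi>" using z by (auto simp: S_def)
      then show "winding_number \<gamma> z = 0" using outside_loop[OF y(2,1), of \<xi>] \<xi>(2) by (simp add: \<gamma>_def[abs_def] \<zeta>_def)
    qed
    show "finite {w \<in> S. F w = 0 \<or> w \<in> {}}" using finZ by (simp add: Z_def)
  qed (use holF in auto)
  moreover have "contour_integral \<gamma> (\<lambda>x. deriv F x * 1 / F x) = - (2 * pi * \<i>)"
  proof -
    have pS: "path_image \<gamma> \<subseteq> S" using img by (auto simp: path_image_def)
    have "valid_path (F \<circ> \<gamma>)" by (rule valid_path_compose_holomorphic[OF vp holF oS pS])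
    moreover have "0 \<notin> path_image (F \<circ> \<gamma>)"
    proof
      assume "0 \<in> path_image (F \<circ> \<gamma>)"
      then obtain x where "0 = F (\<gamma> x)" by (auto simp: path_image_def)
      then show False using img(2)[of x] by simp
    qed
    ultimately have "((\<lambda>w. 1 / (w - 0)) has_contour_integral (2 * pi * \<i> * winding_number (F \<circ> \<gamma>) 0)) (F \<circ> \<gamma>)"
      by (rule has_contour_integral_winding_number)
    then have "contour_integral (F \<circ> \<gamma>) (\<lambda>w. 1 / (w - 0)) = 2 * pi * \<i> * winding_number (F \<circ> \<gamma>) 0"
      by (rule contour_integral_unique)
    moreover have "contour_integral (F \<circ> \<gamma>) (\<lambda>w. 1 / (w - 0)) = contour_integral \<gamma> (\<lambda>w. deriv F w * (1 / (F w - 0)))"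
      by (rule contour_integral_comp_analyticW[OF _ vp pS]) (use holF oS in \<open>simp add: analytic_on_open\<close>)
    ultimately show ?thesis unfolding wF by simp
  qed
  moreover have "winding_number \<gamma> p = -1" if "p \<in> Z" for p
    using winding_\<Psi>[of p y] ZK that y by (auto simp: \<gamma>_def[abs_def] \<zeta>_def)
  ultimately have "- (2 * pi * \<i>) = 2 * pi * \<i> * (\<Sum>p\<in>Z. - of_int (zorder F p) :: complex)" by simp
  then have "2 * pi * \<i> * (-1) = 2 * pi * \<i> * (\<Sum>p\<in>Z. - of_int (zorder F p) :: complex)" by simp
  then have "-1 = (\<Sum>p\<in>Z. - of_int (zorder F p) :: complex)" by (subst (asm) mult_cancel_left) simp
  then have "of_int (\<Sum>p\<in>Z. zorder F p) = (of_int 1 :: complex)" by (simp add: sum_negf)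
  then have "(\<Sum>p\<in>Z. zorder F p) = 1" by (simp only: of_int_eq_iff)
  \<comment> \<open>The orders of the zeros sum to 1, but \<open>deriv G 0 = 1\<close> makes 0 a
    multiple zero of \<open>F\<close>.\<close>
  moreover have "zorder F 0 \<ge> 2"
  proof (rule zorder_ge_2[OF holF oS conS])
    have "0 \<in> V" using V(2) K(2) by blast
    then have "(G has_field_derivative deriv G 0) (at 0)" using G(1) V(1) by (intro holomorphic_derivI)
    then have "(F has_field_derivative 0) (at 0)" unfolding F_def by (auto intro!: derivative_eq_intros simp: G(3))
    then show "deriv F 0 = 0" by (rule DERIV_imp_deriv)
  qed (use Z0 nc in \<open>auto simp: Z_def\<close>)
  moreover have "zorder F p \<ge> 0" if "p \<in> Z" for p
    using zorder_exist_zero[OF holF oS conS _ nc, of p] that by (auto simp: Z_def)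
  then have "zorder F 0 \<le> (\<Sum>p\<in>Z. zorder F p)" using finZ Z0 by (intro member_le_sum) auto
  ultimately show False by simp
qed

end

section \<open>Orbits that shadow \<open>K\<close>\<close>

lemma closed_fixed_points_between:
  fixes S :: "real set"
  assumes S: "closed S" "c \<notin> S" and a0: "a0 \<in> S" "a0 < c" and b0: "b0 \<in> S" "c < b0"
  obtains a b where "a \<in> S" "b \<in> S" "a < c" "c < b" "\<And>x. a < x \<Longrightarrow> x < b \<Longrightarrow> x \<notin> S"
proof -
  have "compact (S \<inter> {a0..c})" "compact (S \<inter> {c..b0})" using S(1) by (auto intro: closed_Int_compact)
  moreover have "S \<inter> {a0..c} \<noteq> {}" "S \<inter> {c..b0} \<noteq> {}" using a0 b0 by auto
  ultimately obtain a b where a: "a \<in> S \<inter> {a0..c}" "\<And>x. x \<in> S \<inter> {a0..c} \<Longrightarrow> x \<le> a"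
    and b: "b \<in> S \<inter> {c..b0}" "\<And>x. x \<in> S \<inter> {c..b0} \<Longrightarrow> b \<le> x"
    using compact_attains_sup compact_attains_inf by metis
  have ac: "a < c" "c < b" using a(1) b(1) S(2) by (auto simp: less_le)
  have "x \<notin> S" if "a < x" "x < b" for x
  proof
    assume x: "x \<in> S"
    show False
    proof (cases "x \<le> c")
      case True
      then have "x \<le> a" using a x that by (intro a(2)) auto
      then show False using that by simp
    next
      case False
      then have "b \<le> x" using b x that by (intro b(2)) auto
      then show False using that by simp
    qed
  qed
  then show ?thesis using that a(1) b(1) ac by blast
qed

lemma identity_from_reals:
  assumes u: "u holomorphic_on {z. - \<eta> < Im z \<and> Im z < \<eta>}" "\<eta> > 0" and re: "\<And>x::real. u (of_real x) = of_real x"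
    and z: "- \<eta> < Im z" "Im z < \<eta>"
  shows "u z = z"
proof -
  have "(\<lambda>z. u z - z) z = 0"
  proof (rule analytic_continuation[where f = "\<lambda>z. u z - z" and w = z and S = "{z. - \<eta> < Im z \<and> Im z < \<eta>}" and U = "range of_real" and \<xi> = 0])
    show "(\<lambda>z. u z - z) holomorphic_on {z. - \<eta> < Im z \<and> Im z < \<eta>}" by (intro holomorphic_intros u)
    have "\<exists>y\<in>range complex_of_real. y \<noteq> 0 \<and> dist y 0 < e" if "e > 0" for e
      by (rule bexI[OF _ rangeI[of of_real "e / 2"]]) (use that in simp)
    then show "(0::complex) islimpt range of_real" unfolding islimpt_approachable by blast
  qed (use u(2) re z open_strip connected_strip in auto)
  then show ?thesis by simp
qed

context exterior_chart
begin

lemma closure_meets_K: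
  assumes "\<And>t. t > 0 \<Longrightarrow> \<exists>z\<in>P. 0 < Im z \<and> Im z < t"
  shows "closure (\<Psi> ` P) \<inter> K \<noteq> {}"
proof (rule ccontr)
  assume "\<not> ?thesis"
  then have "open (- closure (\<Psi> ` P))" "K \<subseteq> - closure (\<Psi> ` P)" by auto
  then obtain t where t: "t > 0" "\<And>z. 0 < Im z \<Longrightarrow> Im z < t \<Longrightarrow> \<Psi> z \<in> - closure (\<Psi> ` P)" using \<Psi>_near by blast
  obtain z where z: "z \<in> P" "0 < Im z" "Im z < t" using assms[OF t(1)] by blast
  have "\<Psi> z \<in> closure (\<Psi> ` P)" by (rule subsetD[OF closure_subset imageI[OF z(1)]])
  with ComplD[OF t(2)[OF z(2,3)]] show False by (rule notE)
qed

text \<open>\<open>J\<close> is the image of a short vertical segment over a real point between two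
  fixed points of the boundary map. Along forward and backward orbits the heights stay below the
  prescribed bound, which by \<open>\<Psi>_near\<close> keeps these orbits in
  \<open>W\<close>.\<close>

lemma orbits_shadowing_K:
  assumes V: "open V" "K \<subseteq> V" and conK: "connected K"
    and G: "G holomorphic_on V" "G ` K \<subseteq> K" "\<And>z. z \<in> V \<Longrightarrow> Gi (G z) = z" "G 0 = 0" "deriv G 0 = 1"
    and Gi: "Gi holomorphic_on V" "Gi ` K \<subseteq> K" "\<And>z. z \<in> V \<Longrightarrow> G (Gi z) = z"
    and W: "open W" "K \<subseteq> W"
  obtains J where "connected J" "J \<noteq> {}" "J \<inter> K = {}" "closure J \<inter> K \<noteq> {}"
    "\<And>n z. z \<in> J \<Longrightarrow> (G ^^ n) z \<in> W" "\<And>n z. z \<in> J \<Longrightarrow> (Gi ^^ n) z \<in> W"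
proof -
  obtain \<eta> u v where \<eta>: "0 < \<eta>" and uv:
    "u holomorphic_on {z. - \<eta> < Im z \<and> Im z < \<eta>}" "v holomorphic_on {z. - \<eta> < Im z \<and> Im z < \<eta>}"
    "\<And>z. 0 < Im z \<Longrightarrow> Im z < \<eta> \<Longrightarrow> 0 < Im (u z) \<and> \<Psi> (u z) = G (\<Psi> z) \<and> \<Psi> z \<in> V"
    "\<And>z. 0 < Im z \<Longrightarrow> Im z < \<eta> \<Longrightarrow> 0 < Im (v z) \<and> \<Psi> (v z) = Gi (\<Psi> z)"
    "\<And>z. Im z = 0 \<Longrightarrow> Im (u z) = 0 \<and> Im (v z) = 0 \<and> v (u z) = z \<and> u (v z) = z"
    "\<And>z. Im z = 0 \<Longrightarrow> 0 < Re (deriv u z) \<and> 0 < Re (deriv v z)"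
    "\<And>z. - \<eta> < Im z \<Longrightarrow> Im z < \<eta> \<Longrightarrow> u (z + 1) = u z + 1"
    by (rule boundary_lifts[OF V G(1-3) Gi]) blast+
  have "\<exists>x::real. u (of_real x) - of_real x \<in> \<int>"
    by (rule multiple_fixed_point_gives_boundary_fixed_point[OF V conK G(1,4,5) \<eta> uv(1,3) _ uv(7)]) (use uv(5) in auto)
  then obtain x0 :: real and n :: int where x0: "u (of_real x0) - of_real x0 = of_int n" by (metis Ints_cases)
  have upn: "u (z + of_nat m) = u z + of_nat m" if "Im z = 0" for z m
  proof (induction m)
    case (Suc m)
    have "u (z + of_nat (Suc m)) = u ((z + of_nat m) + 1)" by (simp add: add_ac)
    then show ?case using Suc uv(7)[of "z + of_nat m"] that \<eta> by simp
  qed simp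
  have upi: "u (z + of_int m) = u z + of_int m" if "Im z = 0" for z m
  proof (cases "m \<ge> 0")
    case True
    then show ?thesis using upn[OF that, of "nat m"] by simp
  next
    case False
    then show ?thesis using upn[of "z + of_int m" "nat (- m)"] that by simp
  qed
  \<comment> \<open>Another choice of lifts: translation by \<open>n\<close> turns the fixed point
    modulo 1 into a genuine fixed point \<open>x0\<close> of \<open>p\<close>, with \<open>q\<close>
    as inverse on the real line.\<close>
  define p where "p z = u z - of_int n" for z
  define q where "q z = v z + of_int n" for z
  have hol: "p holomorphic_on {z. - \<eta> < Im z \<and> Im z < \<eta>}" "q holomorphic_on {z. - \<eta> < Im z \<and> Im z < \<eta>}"
    unfolding p_def q_def by (intro holomorphic_intros uv)+
  have pup: "0 < Im (p z) \<and> \<Psi> (p z) = G (\<Psi> z)" if "0 < Im z" "Im z < \<eta>" for z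
    using uv(3)[OF that] \<Psi>_periodic[of "u z" "- n"] by (simp add: p_def)
  have qup: "0 < Im (q z) \<and> \<Psi> (q z) = Gi (\<Psi> z)" if "0 < Im z" "Im z < \<eta>" for z
    using uv(4)[OF that] \<Psi>_periodic[of "v z" "n"] by (simp add: q_def)
  have pq: "Im (p z) = 0 \<and> q (p z) = z" "Im (q z) = 0 \<and> p (q z) = z" if "Im z = 0" for z
  proof -
    show "Im (q z) = 0 \<and> p (q z) = z" using uv(5)[OF that] upi[of "v z" n] by (simp add: p_def q_def)
    define t where "t = u z"
    have t: "Im t = 0" "v t = z" using uv(5)[OF that] by (auto simp: t_def)
    have "u (v t + of_int (- n)) = t - of_int n" using upi[of "v t" "- n"] uv(5)[OF t(1)] by simp
    then have "v (t - of_int n) = v t - of_int n" using uv(5)[of "v t + of_int (- n)"] t that by simp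
    then show "Im (p z) = 0 \<and> q (p z) = z" using t by (simp add: p_def q_def t_def)
  qed
  have dpq: "0 < Re (deriv p z)" "0 < Re (deriv q z)" if "Im z = 0" for z
  proof -
    have z: "z \<in> {z. - \<eta> < Im z \<and> Im z < \<eta>}" using that \<eta> by simp
    have "(p has_field_derivative deriv u z) (at z)" "(q has_field_derivative deriv v z) (at z)"
      unfolding p_def q_def
      using holomorphic_derivI[OF uv(1) open_strip z] holomorphic_derivI[OF uv(2) open_strip z]
      by (auto intro!: derivative_eq_intros)
    then show "0 < Re (deriv p z)" "0 < Re (deriv q z)" using uv(6)[OF that] by (auto dest: DERIV_imp_deriv)
  qed
  obtain \<epsilon>0 where \<epsilon>0: "0 < \<epsilon>0" "\<And>z. 0 < Im z \<Longrightarrow> Im z < \<epsilon>0 \<Longrightarrow> \<Psi> z \<in> W" using \<Psi>_near[OF W] by blast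
  define \<epsilon> where "\<epsilon> = min \<epsilon>0 \<eta>"
  have \<epsilon>: "0 < \<epsilon>" "\<epsilon> \<le> \<epsilon>0" "\<epsilon> \<le> \<eta>" using \<epsilon>0 \<eta> by (auto simp: \<epsilon>_def)
  define S where "S = {x::real. p (of_real x) = of_real x}"
  have "\<exists>c y0. y0 > 0 \<and> (\<forall>y n. 0 < y \<longrightarrow> y < y0 \<longrightarrow>
      (0 < Im ((p ^^ n) (of_real c + \<i> * of_real y)) \<and> Im ((p ^^ n) (of_real c + \<i> * of_real y)) < \<epsilon>) \<and>
      (0 < Im ((q ^^ n) (of_real c + \<i> * of_real y)) \<and> Im ((q ^^ n) (of_real c + \<i> * of_real y)) < \<epsilon>))"
  proof (cases "\<exists>c. c \<notin> S")
    \<comment> \<open>All real points are fixed, so \<open>p\<close> and \<open>q\<close> are the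
      identity on the strip, and a segment over any real point will do.\<close>
    case False
    then have pr: "p (of_real x) = of_real x" for x :: real by (auto simp: S_def)
    then have qr: "q (of_real x) = of_real x" for x :: real using pq(1)[of "of_real x"] by simp
    have pz: "p z = z" "q z = z" if "- \<eta> < Im z" "Im z < \<eta>" for z
      using identity_from_reals[OF hol(1) \<eta> pr that] identity_from_reals[OF hol(2) \<eta> qr that] by auto
    have "(p ^^ n) z = z \<and> (q ^^ n) z = z" if "0 < Im z" "Im z < \<epsilon>" for z n
      by (induction n) (use pz that \<epsilon> \<eta> in auto)
    then show ?thesis using \<epsilon>(1) by - (rule exI[of _ "0::real"], rule exI[of _ \<epsilon>], simp)
  next
    case True
    then obtain c where c: "c \<notin> S" by blast
    have cp: "continuous_on UNIV (\<lambda>x. p (complex_of_real x))"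
      by (rule continuous_on_compose2[OF holomorphic_on_imp_continuous_on[OF hol(1)]])
         (use \<eta> in \<open>auto intro!: continuous_intros\<close>)
    have clS: "closed S" unfolding S_def by (intro closed_Collect_eq cp continuous_intros)
    have inS: "x0 + of_int m \<in> S" for m
    proof -
      have "u (of_real x0 + of_int m) = of_real x0 + of_int n + of_int m"
        using upi[of "of_real x0" m] x0 by (simp add: algebra_simps)
      then show ?thesis by (simp add: S_def p_def)
    qed
    \<comment> \<open>With \<open>x0\<close> all its integer translates are fixed; the two used here
      enclose \<open>c\<close>.\<close>
    have lo: "x0 + of_int (\<lfloor>c - x0\<rfloor> - 1) < c" and hi: "c < x0 + of_int (\<lfloor>c - x0\<rfloor> + 1)" by linarith+
    obtain a b where ab: "a \<in> S" "b \<in> S" "a < c" "c < b" "\<And>x. a < x \<Longrightarrow> x < b \<Longrightarrow> x \<notin> S"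
      using closed_fixed_points_between[OF clS c inS lo inS hi] by blast
    have qS: "q (of_real x) = of_real x \<longleftrightarrow> x \<in> S" for x
      using pq(1)[of "of_real x"] pq(2)[of "of_real x"] by (auto simp: S_def)
    obtain y1 where y1: "y1 > 0" "\<And>y n. 0 < y \<Longrightarrow> y < y1 \<Longrightarrow> 0 < Im ((p ^^ n) (of_real c + \<i> * of_real y)) \<and> Im ((p ^^ n) (of_real c + \<i> * of_real y)) < \<epsilon>"
    proof (rule orbit_near_real_interval[OF \<eta> hol pq(1) dpq(1) _ _ _ ab(3,4) _ \<epsilon>(1,3)])
      show "p (of_real a) = of_real a" "p (of_real b) = of_real b" using ab by (auto simp: S_def)
      show "p (of_real x) \<noteq> of_real x" if "a < x" "x < b" for x using ab(5)[OF that] by (simp add: S_def)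
    qed (use pup in auto)
    obtain y2 where y2: "y2 > 0" "\<And>y n. 0 < y \<Longrightarrow> y < y2 \<Longrightarrow> 0 < Im ((q ^^ n) (of_real c + \<i> * of_real y)) \<and> Im ((q ^^ n) (of_real c + \<i> * of_real y)) < \<epsilon>"
    proof (rule orbit_near_real_interval[OF \<eta> hol(2,1) pq(2) dpq(2) _ _ _ ab(3,4) _ \<epsilon>(1,3)])
      show "q (of_real a) = of_real a" "q (of_real b) = of_real b" using ab qS by auto
      show "q (of_real x) \<noteq> of_real x" if "a < x" "x < b" for x using ab(5)[OF that] qS by simp
    qed (use qup in auto)
    show ?thesis using y1 y2 by - (rule exI[of _ c], rule exI[of _ "min y1 y2"], simp)
  qed
  then obtain c :: real and y0 where y0: "y0 > 0"
    and yp: "\<And>y n. 0 < y \<Longrightarrow> y < y0 \<Longrightarrow> 0 < Im ((p ^^ n) (of_real c + \<i> * of_real y)) \<and> Im ((p ^^ n) (of_real c + \<i> * of_real y)) < \<epsilon>"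
    and yq: "\<And>y n. 0 < y \<Longrightarrow> y < y0 \<Longrightarrow> 0 < Im ((q ^^ n) (of_real c + \<i> * of_real y)) \<and> Im ((q ^^ n) (of_real c + \<i> * of_real y)) < \<epsilon>"
    by blast
  define P where "P = (\<lambda>y. of_real c + \<i> * of_real y) ` {0<..<y0}"
  have ypP: "0 < Im ((p ^^ n) z) \<and> Im ((p ^^ n) z) < \<epsilon>" if zP: "z \<in> P" for z n
  proof -
    obtain y where "0 < y" "y < y0" "z = of_real c + \<i> * of_real y" using zP unfolding P_def by auto
    then show ?thesis using yp[of y n] by simp
  qed
  have yqP: "0 < Im ((q ^^ n) z) \<and> Im ((q ^^ n) z) < \<epsilon>" if zP: "z \<in> P" for z n
  proof -
    obtain y where "0 < y" "y < y0" "z = of_real c + \<i> * of_real y" using zP unfolding P_def by auto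
    then show ?thesis using yq[of y n] by simp
  qed
  have ImP: "0 < Im z" if "z \<in> P" for z using that by (auto simp: P_def)
  have Gp: "(G ^^ n) (\<Psi> z) = \<Psi> ((p ^^ n) z)" if "z \<in> P" for n z
  proof (induction n)
    case (Suc n)
    have "0 < Im ((p ^^ n) z)" "Im ((p ^^ n) z) < \<eta>" using ypP[OF that, of n] \<epsilon>(3) by auto
    then show ?case using Suc pup by simp
  qed simp
  have Gq: "(Gi ^^ n) (\<Psi> z) = \<Psi> ((q ^^ n) z)" if "z \<in> P" for n z
  proof (induction n)
    case (Suc n)
    have "0 < Im ((q ^^ n) z)" "Im ((q ^^ n) z) < \<eta>" using yqP[OF that, of n] \<epsilon>(3) by auto
    then show ?case using Suc qup by simp
  qed simp
  show ?thesis
  proof (rule that[of "\<Psi> ` P"])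
    have "connected P" unfolding P_def by (intro connected_continuous_image continuous_intros) simp
    then show "connected (\<Psi> ` P)"
      using holomorphic_on_imp_continuous_on[OF hol_\<Psi>] ImP
      by (intro connected_continuous_image) (auto intro: continuous_on_subset)
    show "\<Psi> ` P \<noteq> {}" using y0 by (simp add: P_def)
    show "\<Psi> ` P \<inter> K = {}" using \<Psi>_notin ImP by auto
    show "closure (\<Psi> ` P) \<inter> K \<noteq> {}"
    proof (rule closure_meets_K)
      fix t :: real assume t: "t > 0"
      define y where "y = min t y0 / 2"
      have y: "0 < y" "y < t" "y < y0" using t y0 by (auto simp: y_def min_def)
      then have "of_real c + \<i> * of_real y \<in> P" unfolding P_def by (intro imageI) auto
      then show "\<exists>z\<in>P. 0 < Im z \<and> Im z < t" by (rule bexI[rotated]) (use y in simp)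
    qed
    show "(G ^^ n) z \<in> W" if zP: "z \<in> \<Psi> ` P" for n z
    proof -
      obtain x where x: "x \<in> P" "z = \<Psi> x" using zP by blast
      have "0 < Im ((p ^^ n) x)" "Im ((p ^^ n) x) < \<epsilon>0" using ypP[OF x(1), of n] \<epsilon>(2) by auto
      then show ?thesis using Gp[OF x(1)] \<epsilon>0(2) x(2) by simp
    qed
    show "(Gi ^^ n) z \<in> W" if zP: "z \<in> \<Psi> ` P" for n z
    proof -
      obtain x where x: "x \<in> P" "z = \<Psi> x" using zP by blast
      have "0 < Im ((q ^^ n) x)" "Im ((q ^^ n) x) < \<epsilon>0" using yqP[OF x(1), of n] \<epsilon>(2) by auto
      then show ?thesis using Gq[OF x(1)] \<epsilon>0(2) x(2) by simp
    qed
  qed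
qed

end

section \<open>Multipliers that are roots of unity\<close>

text \<open>After \<open>n\<close> steps of about \<open>s\<close> from the imaginary axis, the
  ideal position has modulus at least \<open>y\<close> and at least \<open>n\<close>, while the
  accumulated error is at most a quarter of \<open>n\<close>. So the Fatou coordinate stays large in
  both directions of time.\<close>

lemma linear_orbit_lower_bound:
  fixes U :: "nat \<Rightarrow> complex"
  assumes "cmod (U n - U 0 - s * of_nat n) \<le> real n / 4" "U 0 = \<i> * of_real y" "0 < y" "s = 1 \<or> s = -1"
  shows "y / 2 \<le> cmod (U n)"
proof -
  have Im: "Im (U 0 + s * of_nat n) = y" and Re: "\<bar>Re (U 0 + s * of_nat n)\<bar> = real n" using assms(2,4) by auto
  have "y \<le> cmod (U 0 + s * of_nat n)" "real n \<le> cmod (U 0 + s * of_nat n)"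
    using abs_Im_le_cmod[of "U 0 + s * of_nat n"] abs_Re_le_cmod[of "U 0 + s * of_nat n"] Im Re by auto
  moreover have "cmod (U 0 + s * of_nat n) - cmod (U n) \<le> cmod (U n - U 0 - s * of_nat n)"
    using norm_triangle_ineq2[of "U 0 + s * of_nat n" "U n"] by (simp add: norm_minus_commute diff_diff_eq)
  ultimately show ?thesis using assms(1,3) by linarith
qed

context mutually_inverse
begin

lemma iterate_domain:
  assumes "0 < s" "s \<le> R"
  shows "open {z. \<forall>i\<le>n. (F ^^ i) z \<in> ball 0 s} \<and> (F ^^ Suc n) holomorphic_on {z. \<forall>i\<le>n. (F ^^ i) z \<in> ball 0 s}"
proof (induction n)
  case 0
  have "F holomorphic_on ball 0 s" using holF by (rule holomorphic_on_subset) (use assms in auto)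
  moreover have "{z. \<forall>i\<le>0. (F ^^ i) z \<in> ball 0 s} = ball 0 s" by auto
  ultimately show ?case by simp
next
  case (Suc n)
  let ?D = "\<lambda>n. {z. \<forall>i\<le>n. (F ^^ i) z \<in> ball 0 s}"
  have eq: "?D (Suc n) = ?D n \<inter> (F ^^ Suc n) -` ball 0 s" by (auto simp: le_Suc_eq simp del: funpow.simps)
  have o: "open (?D (Suc n))" unfolding eq
    by (rule continuous_open_preimage) (use Suc in \<open>auto intro: holomorphic_on_imp_continuous_on\<close>)
  have "(F ^^ Suc n) holomorphic_on ?D (Suc n)" using conjunct2[OF Suc] by (rule holomorphic_on_subset) (unfold eq, rule Int_lower1)
  then have "F \<circ> (F ^^ Suc n) holomorphic_on ?D (Suc n)"
    by (rule holomorphic_on_compose_gen[OF _ holF]) (use assms(2) in \<open>unfold eq, auto\<close>)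
  then show ?case using o by (simp only: funpow.simps(2)[symmetric])
qed

lemma iterate_cancel: "(\<And>i. i \<le> n \<Longrightarrow> (F ^^ i) z \<in> ball 0 R) \<Longrightarrow> (H ^^ n) ((F ^^ n) z) = z"
proof (induction n)
  case (Suc n)
  have "(H ^^ Suc n) ((F ^^ Suc n) z) = (H ^^ n) (H (F ((F ^^ n) z)))" by (simp add: funpow_swap1)
  also have "H (F ((F ^^ n) z)) = (F ^^ n) z" by (rule HF) (use Suc.prems[of n] Suc.prems[of "Suc n"] in auto)
  also have "(H ^^ n) ((F ^^ n) z) = z" using Suc by simp
  finally show ?case .
qed simp

lemma iterate_in_cball:
  assumes "q > 0" and "\<And>k i. i \<le> q \<Longrightarrow> (F ^^ i) (((F ^^ q) ^^ k) z) \<in> cball 0 r"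
  shows "(F ^^ n) z \<in> cball 0 r"
proof -
  have "(F ^^ n) z = (F ^^ (n mod q + q * (n div q))) z" by simp
  also have "\<dots> = (F ^^ (n mod q)) (((F ^^ q) ^^ (n div q)) z)" by (simp only: funpow_add funpow_mult[symmetric] comp_apply mult.commute)
  finally show ?thesis using assms(2)[of "n mod q" "n div q"] assms(1) by (simp add: less_imp_le)
qed

lemma deriv_iterate:
  assumes "(F has_field_derivative l) (at 0)"
  shows "((F ^^ n) has_field_derivative l ^ n) (at 0) \<and> (F ^^ n) 0 = 0"
proof (induction n)
  case 0
  then show ?case by (simp add: id_def)
next
  case (Suc n)
  then have "(F \<circ> (F ^^ n) has_field_derivative l * l ^ n) (at 0)" using assms by (intro DERIV_chain) auto
  then show ?case using Suc F0 by (simp add: o_def)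
qed

end

context mutually_inverse
begin

interpretation inv: mutually_inverse H F R r by (rule swap)

text \<open>Bounding all intermediate iterates makes \<open>F ^^ q\<close> and \<open>H ^^ q\<close>
  inverse to each other here, and lets an orbit of \<open>F ^^ q\<close> control the whole orbit of
  \<open>F\<close>.\<close>

definition region :: "real \<Rightarrow> nat \<Rightarrow> complex set" where
  "region s q = {z. \<forall>i\<le>q. (F ^^ i) z \<in> ball 0 s} \<inter> {z. \<forall>i\<le>q. (H ^^ i) z \<in> ball 0 s}"

lemma region: assumes "0 < s" "s \<le> R" "q > 0"
  shows "open (region s q)" "(F ^^ q) holomorphic_on region s q" "(H ^^ q) holomorphic_on region s q"
    "\<And>z. z \<in> region s q \<Longrightarrow> (H ^^ q) ((F ^^ q) z) = z \<and> (F ^^ q) ((H ^^ q) z) = z" "0 \<in> region s q"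
proof -
  show "open (region s q)" unfolding region_def using iterate_domain[OF assms(1,2)] inv.iterate_domain[OF assms(1,2)] by (intro open_Int) auto
  obtain p where p: "q = Suc p" using assms(3) by (cases q) auto
  show "(F ^^ q) holomorphic_on region s q"
    using conjunct2[OF iterate_domain[OF assms(1,2), of p]] unfolding p region_def by (rule holomorphic_on_subset) (auto simp del: funpow.simps)
  show "(H ^^ q) holomorphic_on region s q"
    using conjunct2[OF inv.iterate_domain[OF assms(1,2), of p]] unfolding p region_def by (rule holomorphic_on_subset) (auto simp del: funpow.simps)
  show "(H ^^ q) ((F ^^ q) z) = z \<and> (F ^^ q) ((H ^^ q) z) = z" if "z \<in> region s q" for z
  proof
    show "(H ^^ q) ((F ^^ q) z) = z" by (rule iterate_cancel) (use that assms in \<open>auto simp: region_def\<close>)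
    show "(F ^^ q) ((H ^^ q) z) = z" by (rule inv.iterate_cancel) (use that assms in \<open>auto simp: region_def\<close>)
  qed
  have "(F ^^ i) 0 = 0" "(H ^^ i) 0 = 0" for i by (induction i) (auto simp: F0 H0)
  then show "0 \<in> region s q" using assms(1) by (simp add: region_def)
qed

lemma shadowing_set_subset_K:
  assumes q: "q > 0" and J: "connected J" "closure J \<inter> K \<noteq> {}"
    and F: "\<And>k z. z \<in> J \<Longrightarrow> ((F ^^ q) ^^ k) z \<in> region r q" and H: "\<And>k z. z \<in> J \<Longrightarrow> ((H ^^ q) ^^ k) z \<in> region r q"
  shows "J \<subseteq> K"
proof (rule extend_K[OF J])
  show "(F ^^ n) ` J \<subseteq> cball 0 r" for n
  proof
    fix w assume "w \<in> (F ^^ n) ` J"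
    then obtain z where z: "z \<in> J" "w = (F ^^ n) z" by blast
    have "(F ^^ n) z \<in> cball 0 r"
      by (rule iterate_in_cball[OF q]) (use F[OF z(1)] in \<open>auto simp: region_def less_imp_le\<close>)
    then show "w \<in> cball 0 r" using z by simp
  qed
  show "(H ^^ n) ` J \<subseteq> cball 0 r" for n
  proof
    fix w assume "w \<in> (H ^^ n) ` J"
    then obtain z where z: "z \<in> J" "w = (H ^^ n) z" by blast
    have "(H ^^ n) z \<in> cball 0 r"
      by (rule inv.iterate_in_cball[OF q]) (use H[OF z(1)] in \<open>auto simp: region_def less_imp_le\<close>)
    then show "w \<in> cball 0 r" using z by simp
  qed
qed

text \<open>The exterior chart needs \<open>K \<noteq> {0}\<close>. Unless \<open>F ^^ q\<close> is
  the identity near 0, there is a ray between an attracting and a repelling direction on which the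
  Fatou coordinate is positive imaginary. From far up this axis both the forward and the backward
  orbit stay at large coordinates, hence near 0, so maximality puts a segment of the ray into
  \<open>K\<close>.\<close>

lemma K_nontrivial:
  assumes q: "q > 0" and F: "(F has_field_derivative l) (at 0)" "l ^ q = 1"
  shows "K \<noteq> {0}"
proof -
  define G where "G = F ^^ q"
  define Gi where "Gi = H ^^ q"
  note reg = region[OF r(1) less_imp_le[OF r(2)] q]
  obtain s where s: "s > 0" "ball 0 s \<subseteq> region r q" using reg(1,5) open_contains_ball by metis
  have G: "G holomorphic_on ball 0 s" "Gi holomorphic_on ball 0 s"
    unfolding G_def Gi_def using reg(2,3) s(2) by (auto intro: holomorphic_on_subset)
  have GG: "Gi (G z) = z" "G (Gi z) = z" if "z \<in> ball 0 s" for z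
    using reg(4)[of z] that s(2) by (auto simp: G_def Gi_def)
  have G0: "G 0 = 0" "(G has_field_derivative 1) (at 0)" using deriv_iterate[OF F(1), of q] F(2) by (auto simp: G_def)
  have Gi0: "Gi 0 = 0" using GG(1)[of 0] G0(1) s(1) by simp
  have found: "\<exists>z\<in>K. z \<noteq> 0" if J: "connected J" "0 \<in> closure J" "z \<in> J" "z \<noteq> 0"
    "\<And>k z. z \<in> J \<Longrightarrow> (G ^^ k) z \<in> ball 0 s" "\<And>k z. z \<in> J \<Longrightarrow> (Gi ^^ k) z \<in> ball 0 s" for J z
  proof -
    have "J \<subseteq> K"
    proof (rule shadowing_set_subset_K[OF q J(1)])
      show "closure J \<inter> K \<noteq> {}" using J(2) K_props(3) by blast
      show "((F ^^ q) ^^ k) z \<in> region r q" if "z \<in> J" for k z using J(5)[OF that, of k] s(2) by (auto simp: G_def)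
      show "((H ^^ q) ^^ k) z \<in> region r q" if "z \<in> J" for k z using J(6)[OF that, of k] s(2) by (auto simp: Gi_def)
    qed
    then show ?thesis using J(3,4) by blast
  qed
  have "\<exists>z\<in>K. z \<noteq> 0"
  proof (cases "(\<lambda>z. G z - z) constant_on ball 0 s")
    case True
    then obtain c where c: "\<And>z. z \<in> ball 0 s \<Longrightarrow> G z - z = c" unfolding constant_on_def by blast
    have id: "G z = z" if "z \<in> ball 0 s" for z using c[OF that] c[of 0] s(1) G0(1) by simp
    have idi: "Gi z = z" if "z \<in> ball 0 s" for z using id[OF that] GG(1)[OF that] by simp
    have it: "(G ^^ k) z = z \<and> (Gi ^^ k) z = z" if "z \<in> ball 0 s" for k z
      by (induction k) (use id[OF that] idi[OF that] in auto)
    show ?thesis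
    proof (rule found[of "ball 0 s" "of_real (s / 2)"])
      show "0 \<in> closure (ball (0::complex) s)" by (rule subsetD[OF closure_subset]) (use s(1) in simp)
    qed (use it s(1) in auto)
  next
    case False
    have hz: "(\<lambda>z. G z - z) holomorphic_on ball 0 s" by (intro holomorphic_intros G)
    have z0: "0 \<in> ball (0::complex) s" "G 0 - 0 = 0" using s(1) G0(1) by auto
    obtain n \<rho> b where br: "0 < n" "0 < \<rho>" "ball (0::complex) \<rho> \<subseteq> ball 0 s" "b holomorphic_on ball 0 \<rho>"
      "\<And>w. w \<in> ball 0 \<rho> \<Longrightarrow> G w - w = (w - 0) ^ n * b w" "\<And>w. w \<in> ball 0 \<rho> \<Longrightarrow> b w \<noteq> 0"
      by (rule holomorphic_factor_zero_nonconstant[OF hz open_ball connected_ball z0 False]) (rule that)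
    define a where "a = b 0"
    have a: "a \<noteq> 0" using br by (simp add: a_def)
    have bc: "isCont b 0" using br(2,4) by (auto intro!: continuous_on_interior[of "ball 0 \<rho>"] holomorphic_on_imp_continuous_on)
    have ev\<rho>: "\<forall>\<^sub>F z in nhds 0. z \<in> ball 0 \<rho>" by (rule eventually_nhds_in_open) (use br(2) in simp_all)
    have n2: "n \<ge> 2"
    proof (rule ccontr)
      assume "\<not> n \<ge> 2"
      then have n1: "n = 1" using br(1) by simp
      have "(b has_field_derivative deriv b 0) (at 0)" using br(4) open_ball by (rule holomorphic_derivI) (use br(2) in auto)
      then have "((\<lambda>w. w * b w) has_field_derivative b 0) (at 0)" by (auto intro!: derivative_eq_intros)
      moreover from ev\<rho> have "\<forall>\<^sub>F w in nhds 0. G w - w = w * b w" by eventually_elim (use br(5) n1 in auto)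
      then have "deriv (\<lambda>w. G w - w) 0 = deriv (\<lambda>w. w * b w) 0" by (rule deriv_cong_ev) simp
      ultimately have "deriv (\<lambda>w. G w - w) 0 = b 0" using DERIV_imp_deriv by metis
      moreover have "((\<lambda>w. G w - w) has_field_derivative 1 - 1) (at 0)" by (intro derivative_intros G0(2))
      then have "deriv (\<lambda>w. G w - w) 0 = 0" by (auto dest: DERIV_imp_deriv)
      ultimately show False using a by (simp add: a_def)
    qed
    define m where "m = n - 1"
    have m: "m \<ge> 1" "n = Suc m" using n2 by (auto simp: m_def)
    define U where "U z = - 1 / (of_nat m * a * z ^ m)" for z
    have ma: "of_nat m * a \<noteq> 0" using m a by simp
    from ev\<rho> have "\<forall>\<^sub>F z in nhds 0. G z = z + z ^ Suc m * b z"
      by eventually_elim (use br(5) m(2) in \<open>auto simp: algebra_simps\<close>)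
    from tendstoD[OF nontangential_fatou_coordinate[OF bc a_def[symmetric] a m(1) this], of "1 / 4"]
    have "\<forall>\<^sub>F z in at 0. cmod (U (G z) - U z - 1) < 1 / 4" by (simp add: dist_norm U_def)
    then obtain r2' where r2': "r2' > 0" "\<And>z. z \<noteq> 0 \<Longrightarrow> cmod z < r2' \<Longrightarrow> cmod (U (G z) - U z - 1) < 1 / 4"
      unfolding eventually_at dist_norm diff_zero by blast
    define r2 where "r2 = min r2' s"
    have r2: "r2 > 0" "r2 \<le> s" "\<And>z. z \<noteq> 0 \<Longrightarrow> cmod z < r2 \<Longrightarrow> cmod (U (G z) - U z - 1) < 1 / 4"
      using r2' s(1) by (auto simp: r2_def)
    have "isCont Gi 0" using G(2) s(1) by (auto intro!: continuous_on_interior[of "ball 0 s"] holomorphic_on_imp_continuous_on)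
    then obtain r3 where r3: "r3 > 0" "\<And>z. cmod z < r3 \<Longrightarrow> cmod (Gi z) < r2"
      using Gi0 r2(1) unfolding continuous_at_eps_delta dist_norm by fastforce
    \<comment> \<open>Points of this disc and their images under \<open>Gi\<close> all lie where the
      translation estimate for \<open>G\<close> is valid, so the estimate can be run
      backwards.\<close>
    define r1 where "r1 = min r2 r3"
    have r1: "r1 > 0" "r1 \<le> r2" "r1 \<le> r3" using r2(1) r3(1) by (auto simp: r1_def)
    have Gnz: "G z \<noteq> 0" "Gi z \<noteq> 0" if "z \<noteq> 0" "z \<in> ball 0 s" for z
      using GG[OF that(2)] that(1) G0(1) Gi0 by metis+
    \<comment> \<open>So large that a coordinate of modulus at least \<open>Y / 2\<close>, the bound
      of \<open>linear_orbit_lower_bound\<close>, forces \<open>cmod z < r1\<close>; the 4 leaves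
      room for strictness.\<close>
    define Y where "Y = max 1 (4 / (cmod (of_nat m * a) * r1 ^ m))"
    have mr: "cmod (of_nat m * a) * r1 ^ m > 0" using ma r1(1) by (intro mult_pos_pos zero_less_power) auto
    have Y: "Y \<ge> 1" "Y / 2 > 1 / (cmod (of_nat m * a) * r1 ^ m)"
    proof -
      show "Y \<ge> 1" by (simp add: Y_def)
      have "Y \<ge> 4 * (1 / (cmod (of_nat m * a) * r1 ^ m))" by (simp add: Y_def)
      moreover have "1 / (cmod (of_nat m * a) * r1 ^ m) > 0" using mr by (rule divide_pos_pos[OF zero_less_one])
      ultimately show "Y / 2 > 1 / (cmod (of_nat m * a) * r1 ^ m)" by linarith
    qed
    have Usmall: "cmod z < r1" if "Y / 2 \<le> cmod (U z)" for z
    proof (rule ccontr)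
      assume "\<not> cmod z < r1"
      then have "r1 ^ m \<le> cmod z ^ m" using r1(1) by (intro power_mono) auto
      then have "cmod (of_nat m * a) * r1 ^ m \<le> cmod (of_nat m * a * z ^ m)"
        unfolding norm_mult[of _ "z ^ m"] norm_power by (rule mult_left_mono) simp
      then have "cmod (U z) \<le> 1 / (cmod (of_nat m * a) * r1 ^ m)" unfolding U_def norm_divide using mr by (intro frac_le) auto
      then show False using that Y(2) by linarith
    qed
    \<comment> \<open>An m-th root of \<open>\<i> / (of_nat m * a)\<close>, so that the coordinate
      of \<open>w * of_real t\<close> is \<open>\<i> * of_real (1 / t ^ m)\<close>.\<close>
    define w where "w = cis (Arg (\<i> / (of_nat m * a)) / m) * of_real (root m (cmod (\<i> / (of_nat m * a))))"
    have wm: "w ^ m = \<i> / (of_nat m * a)"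
    proof -
      define c where "c = \<i> / (of_nat m * a)"
      have c: "c \<noteq> 0" using ma by (simp add: c_def)
      have "cis (Arg c / m) ^ m = cis (Arg c)" using m(1) by (simp add: Complex.DeMoivre)
      moreover have "of_real (root m (cmod c)) ^ m = (of_real (cmod c) :: complex)"
        using m(1) by (simp flip: of_real_power)
      ultimately have "w ^ m = cis (Arg c) * of_real (cmod c)" by (simp add: w_def c_def[symmetric] power_mult_distrib)
      also have "\<dots> = c" using rcis_cmod_Arg[of c] by (simp add: rcis_def mult.commute)
      finally show ?thesis by (simp add: c_def)
    qed
    have w0: "w \<noteq> 0" using wm ma m(1) by (metis complex_i_not_zero divide_eq_0_iff power_0_left not_one_le_zero)
    have Uw: "U (w * of_real t) = \<i> * of_real (1 / t ^ m)" if "t > 0" for t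
      using that ma by (simp add: U_def power_mult_distrib wm field_simps)
    define J where "J = (\<lambda>t. w * of_real t) ` {0<..<1 / Y}"
    have JU: "z \<noteq> 0 \<and> (\<exists>y\<ge>Y. U z = \<i> * of_real y)" if zJ: "z \<in> J" for z
    proof -
      obtain t where t: "0 < t" "t < 1 / Y" "z = w * of_real t" using zJ by (auto simp: J_def)
      have tY: "t * Y < 1" using t(2) Y(1) by (simp add: pos_less_divide_eq)
      have t1: "t < 1" using t(1) tY Y(1) mult_left_mono[of 1 Y t] by linarith
      have "t ^ m \<le> t" using power_decreasing[of 1 m t] m(1) t(1) t1 by simp
      then have "t ^ m * Y \<le> 1" using tY Y(1) mult_right_mono[of "t ^ m" t Y] by linarith
      then have "Y \<le> 1 / t ^ m" using t(1) by (simp add: pos_le_divide_eq mult.commute)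
      then show ?thesis using Uw[OF t(1)] t w0 by auto
    qed
    have fwd: "cmod ((G ^^ k) z) < r1 \<and> (G ^^ k) z \<noteq> 0 \<and> cmod (U ((G ^^ k) z) - U z - 1 * of_nat k) \<le> real k / 4"
      if zJ: "z \<in> J" for z k
    proof -
      obtain y where y: "z \<noteq> 0" "y \<ge> Y" "U z = \<i> * of_real y" using JU[OF zJ] by blast
      \<comment> \<open>The bound speaks about sequences; it is applied to an auxiliary one with
        \<open>z\<close> at index 0 and \<open>x\<close> at the indices after it, and in the case
        \<open>k = 0\<close> to a constant one.\<close>
      have low: "cmod x < r1" if "cmod (U x - U z - 1 * of_nat k) \<le> real k / 4" for x k
        using linear_orbit_lower_bound[of "\<lambda>j. if j = 0 then U z else U x" k 1 y] that y Y(1) Usmall[of x]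
          linear_orbit_lower_bound[of "\<lambda>j. U x" 0 1 y]
        by (cases "k = 0") auto
      show ?thesis
      proof (induction k)
        case 0
        then show ?case using low[of z 0] y(1) by simp
      next
        case (Suc k)
        define x where "x = (G ^^ k) z"
        have x: "cmod x < r1" "x \<noteq> 0" "cmod (U x - U z - 1 * of_nat k) \<le> real k / 4" using Suc by (auto simp: x_def)
        have "cmod (U (G x) - U x - 1) < 1 / 4" using r2(3)[OF x(2)] x(1) r1 by simp
        then have "cmod ((U (G x) - U x - 1) + (U x - U z - 1 * of_nat k)) \<le> 1 / 4 + real k / 4"
          using x(3) by (intro norm_triangle_mono) auto
        then have "cmod (U (G x) - U z - 1 * of_nat (Suc k)) \<le> real (Suc k) / 4" by (simp add: algebra_simps add_divide_distrib)
        then show ?case using low[of "G x" "Suc k"] Gnz(1)[OF x(2)] x(1) r1 r2(2) by (simp add: x_def)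
      qed
    qed
    have bwd: "cmod ((Gi ^^ k) z) < r1 \<and> (Gi ^^ k) z \<noteq> 0 \<and> cmod (U ((Gi ^^ k) z) - U z - (-1) * of_nat k) \<le> real k / 4"
      if zJ: "z \<in> J" for z k
    proof -
      obtain y where y: "z \<noteq> 0" "y \<ge> Y" "U z = \<i> * of_real y" using JU[OF zJ] by blast
      have low: "cmod x < r1" if "cmod (U x - U z - (-1) * of_nat k) \<le> real k / 4" for x k
        using linear_orbit_lower_bound[of "\<lambda>j. if j = 0 then U z else U x" k "-1" y] that y Y(1) Usmall[of x]
          linear_orbit_lower_bound[of "\<lambda>j. U x" 0 "-1" y]
        by (cases "k = 0") auto
      show ?thesis
      proof (induction k)
        case 0
        then show ?case using low[of z 0] y(1) by simp
      next
        case (Suc k)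
        define x where "x = (Gi ^^ k) z"
        have x: "cmod x < r1" "x \<noteq> 0" "cmod (U x - U z - (-1) * of_nat k) \<le> real k / 4" using Suc by (auto simp: x_def)
        have xs: "x \<in> ball 0 s" using x(1) r1 r2(2) by simp
        have "cmod (U (G (Gi x)) - U (Gi x) - 1) < 1 / 4"
          by (rule r2(3)) (use Gnz(2)[OF x(2) xs] r3(2)[of x] x(1) r1 in auto)
        then have "cmod (U (Gi x) - U x + 1) < 1 / 4"
          using norm_minus_cancel[of "U (Gi x) - U x + 1"] by (simp add: GG(2)[OF xs] algebra_simps)
        then have "cmod ((U (Gi x) - U x + 1) + (U x - U z - (-1) * of_nat k)) \<le> 1 / 4 + real k / 4"
          using x(3) by (intro norm_triangle_mono) auto
        then have "cmod (U (Gi x) - U z - (-1) * of_nat (Suc k)) \<le> real (Suc k) / 4" by (simp add: algebra_simps add_divide_distrib)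
        then show ?case using low[of "Gi x" "Suc k"] Gnz(2)[OF x(2) xs] by (simp add: x_def)
      qed
    qed
    show ?thesis
    proof (rule found[of J "w * of_real (1 / (2 * Y))"])
      show "connected J" unfolding J_def by (intro connected_continuous_image continuous_intros) simp
      show "w * of_real (1 / (2 * Y)) \<in> J" unfolding J_def
        by (rule imageI) (use Y(1) in \<open>auto simp: field_simps\<close>)
      show "w * of_real (1 / (2 * Y)) \<noteq> 0" using w0 Y(1) by simp
      show "0 \<in> closure J" unfolding closure_approachable
      proof (intro allI impI)
        fix e :: real assume e: "e > 0"
        define t where "t = min (1 / (2 * Y)) (e / (2 * cmod w))"
        have "1 / (2 * Y) < 1 / Y" using Y(1) by (simp add: field_simps)
        then have t: "0 < t" "t < 1 / Y" "t \<le> e / (2 * cmod w)" using Y(1) e w0 by (auto simp: t_def)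
        have "cmod w * t \<le> e / 2" using mult_left_mono[OF t(3), of "cmod w"] w0 by simp
        then have "dist (w * of_real t) 0 < e" using t(1) e by (simp add: norm_mult)
        then show "\<exists>y\<in>J. dist y 0 < e" using t unfolding J_def by auto
      qed
      show "(G ^^ k) z \<in> ball 0 s" if "z \<in> J" for k z using fwd[OF that, of k] r1 r2(2) by simp
      show "(Gi ^^ k) z \<in> ball 0 s" if "z \<in> J" for k z using bwd[OF that, of k] r1 r2(2) by simp
    qed
  qed
  then show ?thesis by blast
qed

text \<open>If \<open>K\<close> lay in the open disc, it would lie in the open set
  \<open>region r q\<close>, and orbits of \<open>F ^^ q\<close> and \<open>H ^^ q\<close> shadowing
  \<open>K\<close> could be kept there. By maximality the shadowing set would belong to
  \<open>K\<close>, although it is disjoint from \<open>K\<close>.\<close>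

lemma K_touches_sphere:
  assumes q: "q > 0" and F: "(F has_field_derivative l) (at 0)" "l ^ q = 1"
  obtains z where "z \<in> K" "cmod z = r"
proof (rule ccontr)
  assume "\<not> thesis"
  then have K: "K \<subseteq> ball 0 r" using K_props(4) that by (force simp: less_le)
  obtain g f where "exterior_chart K g f"
    using exterior_chart_exists[OF K_props(1,2) K_full K_props(3) K_nontrivial[OF assms]] by blast
  then interpret ch: exterior_chart K g f .
  note reg = region[OF r(1) less_imp_le[OF r(2)] q]
  have KR: "K \<subseteq> region r q"
  proof
    fix x assume "x \<in> K"
    then have "(F ^^ i) x \<in> ball 0 r" "(H ^^ i) x \<in> ball 0 r" for i using funpow_K K by blast+
    then show "x \<in> region r q" by (simp add: region_def)
  qed
  have img: "(F ^^ q) ` K \<subseteq> K" "(H ^^ q) ` K \<subseteq> K" using funpow_K by auto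
  have G0: "(F ^^ q) 0 = 0" "deriv (F ^^ q) 0 = 1" using deriv_iterate[OF F(1), of q] F(2) by (auto dest: DERIV_imp_deriv)
  have inv1: "(H ^^ q) ((F ^^ q) z) = z" and inv2: "(F ^^ q) ((H ^^ q) z) = z" if "z \<in> region r q" for z
    using reg(4)[OF that] by auto
  obtain J where J: "connected J" "J \<noteq> {}" "J \<inter> K = {}" "closure J \<inter> K \<noteq> {}"
    "\<And>n z. z \<in> J \<Longrightarrow> ((F ^^ q) ^^ n) z \<in> region r q" "\<And>n z. z \<in> J \<Longrightarrow> ((H ^^ q) ^^ n) z \<in> region r q"
  proof (rule ch.orbits_shadowing_K[where G = "F ^^ q" and Gi = "H ^^ q" and V = "region r q" and W = "region r q", OF reg(1) KR K_props(2) reg(2) img(1) _ G0 reg(3) img(2) _ reg(1) KR])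
    show "(H ^^ q) ((F ^^ q) z) = z" if "z \<in> region r q" for z by (rule inv1[OF that])
    show "(F ^^ q) ((H ^^ q) z) = z" if "z \<in> region r q" for z by (rule inv2[OF that])
  qed (rule that)
  have "J \<subseteq> K" by (rule shadowing_set_subset_K[OF q J(1,4,5,6)])
  then show False using J(2,3) by blast
qed

end

section \<open>Irrational multipliers and small Siegel compacta\<close>

lemma real_approx_by_quotients:
  obtains p :: "nat \<Rightarrow> int" where "(\<lambda>n. of_int (p n) / real (Suc n)) \<longlonglongrightarrow> \<alpha>"
proof
  show "(\<lambda>n. of_int \<lfloor>\<alpha> * real (Suc n)\<rfloor> / real (Suc n)) \<longlonglongrightarrow> \<alpha>"
  proof (rule tendsto_sandwich[where f = "\<lambda>n. \<alpha> - 1 / real (Suc n)" and h = "\<lambda>n. \<alpha>"])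
    show "\<forall>\<^sub>F n in sequentially. \<alpha> - 1 / real (Suc n) \<le> of_int \<lfloor>\<alpha> * real (Suc n)\<rfloor> / real (Suc n)"
    proof (intro always_eventually allI)
      fix n
      have "(\<alpha> * real (Suc n) - 1) / real (Suc n) \<le> of_int \<lfloor>\<alpha> * real (Suc n)\<rfloor> / real (Suc n)"
        by (intro divide_right_mono) linarith+
      then show "\<alpha> - 1 / real (Suc n) \<le> of_int \<lfloor>\<alpha> * real (Suc n)\<rfloor> / real (Suc n)" by (simp add: diff_divide_distrib)
    qed
    show "\<forall>\<^sub>F n in sequentially. of_int \<lfloor>\<alpha> * real (Suc n)\<rfloor> / real (Suc n) \<le> \<alpha>"
    proof (intro always_eventually allI)
      fix n
      show "of_int \<lfloor>\<alpha> * real (Suc n)\<rfloor> / real (Suc n) \<le> \<alpha>" unfolding pos_divide_le_eq[OF of_nat_0_less_iff[THEN iffD2, OF zero_less_Suc]] by linarith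
    qed
    show "(\<lambda>n. \<alpha> - 1 / real (Suc n)) \<longlonglongrightarrow> \<alpha>" by real_asymp
  qed simp
qed

text \<open>Multiplying \<open>F\<close> by \<open>c n\<close>, of modulus 1, changes the multiplier
  to the root of unity \<open>rot (t n)\<close> and preserves both discs. The continua
  \<open>C n\<close> of the perturbed maps reach the circle, and their upper limit \<open>L\<close>
  is invariant under \<open>F\<close> itself.\<close>

lemma (in mutually_inverse) K_touches_sphere_limit:
  assumes F: "(F has_field_derivative rot \<alpha>) (at 0)"
  obtains z where "z \<in> K" "cmod z = r"
proof -
  obtain p :: "nat \<Rightarrow> int" where p: "(\<lambda>n. of_int (p n) / real (Suc n)) \<longlonglongrightarrow> \<alpha>" by (rule real_approx_by_quotients)
  define t where "t n = of_int (p n) / real (Suc n)" for n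
  define c where "c n = rot (t n - \<alpha>)" for n
  have nc: "cmod (c n) = 1" "c n \<noteq> 0" for n by (auto simp: c_def rot_def)
  have cl: "c \<longlonglongrightarrow> 1"
  proof -
    have "(\<lambda>n. rot (t n - \<alpha>)) \<longlonglongrightarrow> rot (\<alpha> - \<alpha>)" unfolding rot_def t_def by (intro tendsto_intros p)
    then show ?thesis by (simp add: c_def[abs_def] rot_def)
  qed
  have mi: "mutually_inverse (\<lambda>z. c n * F z) (\<lambda>z. H (z / c n)) R r" for n
  proof
    show "(\<lambda>z. c n * F z) holomorphic_on ball 0 R" by (intro holomorphic_intros holF)
    have "H \<circ> (\<lambda>z. z / c n) holomorphic_on ball 0 R"
      by (rule holomorphic_on_compose_gen[OF _ holH]) (use nc[of n] in \<open>auto intro!: holomorphic_intros simp: norm_divide\<close>)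
    then show "(\<lambda>z. H (z / c n)) holomorphic_on ball 0 R" by (simp add: o_def)
    show "H (c n * F z / c n) = z" if "z \<in> ball 0 R" "c n * F z \<in> ball 0 R" for z
      using HF[of z] that nc[of n] by (simp add: norm_mult)
    show "c n * F (H (z / c n)) = z" if "z \<in> ball 0 R" "H (z / c n) \<in> ball 0 R" for z
      using FH[of "z / c n"] that nc[of n] by (simp add: norm_divide)
  qed (use r F0 H0 in auto)
  define C where "C n = mutually_inverse.K (\<lambda>z. c n * F z) r" for n
  have "\<exists>z\<in>C n. cmod z = r" for n
  proof -
    interpret a: mutually_inverse "\<lambda>z. c n * F z" "\<lambda>z. H (z / c n)" R r by (rule mi)
    have "((\<lambda>z. c n * F z) has_field_derivative c n * rot \<alpha>) (at 0)" by (rule DERIV_cmult[OF F])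
    moreover have "c n * rot \<alpha> = rot (t n)" by (simp add: c_def rot_def exp_add[symmetric] algebra_simps)
    moreover have "rot (t n) ^ Suc n = 1" unfolding rot_power rot_eq_1_iff by (simp add: t_def del: of_nat_Suc)
    ultimately show ?thesis using a.K_touches_sphere[OF zero_less_Suc] unfolding C_def by metis
  qed
  then obtain z where z: "\<And>n. z n \<in> C n" "\<And>n. cmod (z n) = r" by metis
  have C: "compact (C n)" "connected (C n)" "0 \<in> C n" "C n \<subseteq> cball 0 r" "(\<lambda>z. c n * F z) ` C n = C n" "(\<lambda>z. H (z / c n)) ` C n = C n" for n
    unfolding C_def using mutually_inverse.K_props[OF mi[of n]] by auto
  \<comment> \<open>The upper limit is written as a nested intersection of compact connected sets;
    the unions are connected because all \<open>C n\<close> contain 0.\<close>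
  define D where "D m = closure (\<Union>n\<in>{m..}. C n)" for m
  have Dc: "D m \<subseteq> cball 0 r" for m unfolding D_def by (rule closure_minimal) (use C(4) in auto)
  define L where "L = (\<Inter>m. D m)"
  have conL: "connected L" unfolding L_def
  proof (rule connected_nest)
    show "compact (D m)" for m unfolding compact_eq_bounded_closed
      using Dc[of m] bounded_subset[OF bounded_cball] by (auto simp: D_def)
    show "connected (D m)" for m unfolding D_def
    proof (rule connected_imp_connected_closure, rule connected_Union)
      have "0 \<in> \<Inter> (C ` {m..})" using C(3) by blast
      then show "\<Inter> (C ` {m..}) \<noteq> {}" by blast
      show "connected S" if "S \<in> C ` {m..}" for S using that C(2) by auto
    qed
    show "D n \<subseteq> D m" if "m \<le> n" for m n unfolding D_def by (intro closure_mono UN_mono) (use that in auto)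
  qed
  have C_lim: "x \<in> L" if x: "strict_mono \<sigma>" "\<And>k. y k \<in> C (\<sigma> k)" "y \<longlonglongrightarrow> x" for \<sigma> y x
  proof -
    have "x \<in> D m" for m
    proof -
      have "\<forall>\<^sub>F k in sequentially. y k \<in> (\<Union>n\<in>{m..}. C n)"
        using eventually_ge_at_top[of m] by eventually_elim (use x(2) seq_suble[OF x(1)] in \<open>auto intro: order_trans\<close>)
      then have "\<forall>\<^sub>F k in sequentially. y k \<in> D m"
        unfolding D_def by (rule eventually_mono) (rule subsetD[OF closure_subset])
      then show ?thesis by (rule Lim_in_closed_set[rotated]) (simp_all add: x(3) D_def)
    qed
    then show ?thesis by (simp add: L_def)
  qed
  have L_seq: "\<exists>\<sigma> y. strict_mono \<sigma> \<and> (\<forall>k. y k \<in> C (\<sigma> k)) \<and> y \<longlonglongrightarrow> x" if x: "x \<in> L" for x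
  proof -
    have "\<exists>n y. m \<le> n \<and> y \<in> C n \<and> dist y x < 1 / real (Suc k)" for m k
    proof -
      have "x \<in> closure (\<Union>n\<in>{m..}. C n)" using x by (auto simp: L_def D_def)
      then have "\<exists>y\<in>(\<Union>n\<in>{m..}. C n). dist y x < 1 / real (Suc k)" unfolding closure_approachable by (auto simp del: of_nat_Suc)
      then show ?thesis by auto
    qed
    then obtain N Y where NY: "\<And>m k. m \<le> N m k \<and> Y m k \<in> C (N m k) \<and> dist (Y m k) x < 1 / real (Suc k)" by metis
    \<comment> \<open>Each selection starts beyond the index selected before, so that the indices
      increase strictly.\<close>
    define s where "s = rec_nat 0 (\<lambda>k i. Suc (N i k))"
    have sS: "s (Suc k) = Suc (N (s k) k)" for k by (simp add: s_def)
    define \<sigma> where "\<sigma> k = N (s k) k" for k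
    define y where "y k = Y (s k) k" for k
    have "strict_mono \<sigma>" unfolding strict_mono_Suc_iff
    proof
      fix k show "\<sigma> k < \<sigma> (Suc k)" using NY[of "s (Suc k)" "Suc k"] unfolding \<sigma>_def sS by simp
    qed
    moreover have "\<forall>k. y k \<in> C (\<sigma> k)" using NY by (simp add: y_def \<sigma>_def)
    moreover have "y \<longlonglongrightarrow> x"
    proof (rule tendsto_dist_iff[THEN iffD2], rule tendsto_sandwich[where f = "\<lambda>_. 0" and h = "\<lambda>k. 1 / real (Suc k)"])
      show "\<forall>\<^sub>F k in sequentially. dist (y k) x \<le> 1 / real (Suc k)" using NY by (auto simp: y_def less_imp_le simp del: of_nat_Suc)
      show "(\<lambda>k. 1 / real (Suc k)) \<longlonglongrightarrow> 0" by real_asymp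
    qed auto
    ultimately show ?thesis by blast
  qed
  have Lsub: "L \<subseteq> cball 0 r" using Dc by (auto simp: L_def)
  have cs: "(\<lambda>k. c (\<sigma> k)) \<longlonglongrightarrow> 1" if "strict_mono \<sigma>" for \<sigma> using LIMSEQ_subseq_LIMSEQ[OF cl that] by (simp add: o_def)
  have FL: "F x \<in> L" if x: "x \<in> L" for x
  proof -
    obtain \<sigma> y where y: "strict_mono \<sigma>" "\<And>k. y k \<in> C (\<sigma> k)" "y \<longlonglongrightarrow> x" using L_seq[OF x] by blast
    have yk: "\<forall>k. y k \<in> cball 0 r" using C(4) y(2) by blast
    have "(\<lambda>k. F (y k)) \<longlonglongrightarrow> F x"
      by (rule continuous_on_tendsto_compose[OF cont(1) y(3)]) (use x Lsub yk in auto)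
    then have "(\<lambda>k. c (\<sigma> k) * F (y k)) \<longlonglongrightarrow> 1 * F x" by (intro tendsto_intros cs[OF y(1)])
    moreover have "c (\<sigma> k) * F (y k) \<in> C (\<sigma> k)" for k using C(5)[of "\<sigma> k"] y(2)[of k] by blast
    ultimately show ?thesis using C_lim[OF y(1)] by fastforce
  qed
  have HL: "H x \<in> L" if x: "x \<in> L" for x
  proof -
    obtain \<sigma> y where y: "strict_mono \<sigma>" "\<And>k. y k \<in> C (\<sigma> k)" "y \<longlonglongrightarrow> x" using L_seq[OF x] by blast
    have yk: "\<forall>k. y k \<in> cball 0 r" using C(4) y(2) by blast
    have "(\<lambda>k. y k / c (\<sigma> k)) \<longlonglongrightarrow> x / 1" by (intro tendsto_intros cs[OF y(1)] y(3)) simp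
    then have yc: "(\<lambda>k. y k / c (\<sigma> k)) \<longlonglongrightarrow> x" by simp
    have "(\<lambda>k. H (y k / c (\<sigma> k))) \<longlonglongrightarrow> H x"
      by (rule continuous_on_tendsto_compose[OF cont(2) yc]) (use x Lsub yk nc in \<open>auto simp: norm_divide\<close>)
    moreover have "H (y k / c (\<sigma> k)) \<in> C (\<sigma> k)" for k using C(6)[of "\<sigma> k"] y(2)[of k] by blast
    ultimately show ?thesis using C_lim[OF y(1)] by fastforce
  qed
  have "F ` L = L"
  proof
    show "F ` L \<subseteq> L" using FL by blast
    have "F (H x) = x" if "x \<in> L" for x by (rule FH) (use that HL[OF that] Lsub cball_sub in auto)
    then show "L \<subseteq> F ` L" using HL by (metis image_eqI subsetI)
  qed
  moreover have "0 \<in> L" using C_lim[of "\<lambda>k. k" "\<lambda>_. 0" 0] C(3) by (auto simp: strict_mono_def)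
  ultimately have "L \<subseteq> K" using conL Lsub by (intro invariant_subset) (simp add: invariant_continuum_def)
  moreover have "\<forall>n. z n \<in> cball 0 r" using z(2) by simp
  then obtain x \<sigma> where xs: "strict_mono \<sigma>" "(z \<circ> \<sigma>) \<longlonglongrightarrow> x"
    using compact_cball[of "0::complex" r] unfolding compact_def by blast
  have "(\<lambda>k. cmod ((z \<circ> \<sigma>) k)) \<longlonglongrightarrow> cmod x" by (rule tendsto_norm[OF xs(2)])
  then have "cmod x = r" by (simp add: z(2) LIMSEQ_const_iff)
  moreover have "x \<in> L" by (rule C_lim[OF xs(1) _ xs(2)]) (simp add: z(1))
  ultimately show ?thesis using that by blast
qed

lemma small_siegel_compact_exists:
  assumes f: "f holomorphic_on ball 0 s" "s > 0" "f 0 = 0" "deriv f 0 = rot \<alpha>" and \<epsilon>: "\<epsilon> > 0"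
  obtains K where "siegel_compact f K" "compact K" "0 \<in> K" "diameter K < \<epsilon>"
proof -
  have df: "(f has_field_derivative rot \<alpha>) (at 0)" using holomorphic_derivI[OF f(1) open_ball, of 0] f(2,4) by simp
  have nz: "deriv f 0 \<noteq> 0" using f(4) by (simp add: rot_def)
  obtain R0 where R0: "R0 > 0" "ball (0::complex) R0 \<subseteq> ball 0 s" "inj_on f (ball 0 R0)"
    by (rule has_complex_derivative_locally_injective[OF f(1) centre_in_ball[THEN iffD2, OF f(2)] open_ball nz]) (rule that)
  have hf: "f holomorphic_on ball 0 R0" using f(1) R0(2) by (rule holomorphic_on_subset)
  obtain h where h: "h holomorphic_on f ` ball 0 R0" "\<And>z. z \<in> ball 0 R0 \<Longrightarrow> deriv f z * deriv h (f z) = 1" "\<And>z. z \<in> ball 0 R0 \<Longrightarrow> h (f z) = z"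
    using holomorphic_has_inverse[OF hf open_ball R0(3)] by metis
  have "open (f ` ball 0 R0)" using open_mapping_thm3[OF hf open_ball R0(3)] .
  moreover have "0 \<in> f ` ball 0 R0" using f(3) R0(1) by force
  ultimately obtain R1 where R1: "R1 > 0" "ball (0::complex) R1 \<subseteq> f ` ball 0 R0" using open_contains_ball by metis
  define R where "R = min R0 R1"
  \<comment> \<open>\<open>R / 2\<close> leaves a margin for the maps around the closed disc;
    \<open>\<epsilon> / 4\<close> makes the diameter \<open>2 * r\<close> of the disc at most
    \<open>\<epsilon> / 2\<close>.\<close>
  define r where "r = min (R / 2) (\<epsilon> / 4)"
  have R: "R > 0" "R \<le> R0" "R \<le> R1" and r: "0 < r" "r < R" "2 * r < \<epsilon>" using R0 R1 \<epsilon> by (auto simp: R_def r_def)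
  interpret m: mutually_inverse f h R r
  proof
    show "f holomorphic_on ball 0 R" using hf by (rule holomorphic_on_subset) (use R in auto)
    show "h holomorphic_on ball 0 R" using h(1) by (rule holomorphic_on_subset) (use R R1(2) in auto)
    show "h (f z) = z" if "z \<in> ball 0 R" for z using h(3)[of z] that R by simp
    show "f (h z) = z" if zR: "z \<in> ball 0 R" for z
    proof -
      obtain x where "x \<in> ball 0 R0" "z = f x" using zR R(3) R1(2) by force
      then show ?thesis using h(3)[of x] by simp
    qed
    show "h 0 = 0" using h(3)[of 0] f(3) R0(1) by simp
  qed (use r f(3) in auto)
  obtain z where z: "z \<in> m.K" "cmod z = r" by (rule m.K_touches_sphere_limit[OF df])
  have "siegel_compact f m.K" unfolding siegel_compact_def
  proof (intro conjI exI)
    show "m.K \<noteq> {0}"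
    proof
      assume "m.K = {0}"
      with z(1) have "z = 0" by blast
      with z(2) r(1) show False by simp
    qed
    show "m.K \<subseteq> ball 0 R0" by (rule subset_trans[OF m.K_props(4)]) (use r(2) R(2) in auto)
    show "\<forall>\<^sub>F z in nhds 0. f z = f z" by simp
  qed (rule m.K_props m.K_full hf R0(3) open_ball)+
  moreover have "diameter m.K \<le> 2 * r"
  proof -
    have "diameter m.K \<le> diameter (cball (0::complex) r)" by (rule diameter_subset[OF m.K_props(4) bounded_cball])
    also have "\<dots> = 2 * r" using r(1) by (simp add: diameter_cball)
    finally show ?thesis .
  qed
  ultimately show ?thesis using that[OF _ m.K_props(1,3)] r(3) by simp
qed

theorem theorem3p8:
  fixes f g :: "complex \<Rightarrow> complex" and \<alpha> \<beta> :: real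
  assumes "nonlinearizable f \<alpha>" and "nonlinearizable g \<beta>"
  shows "((\<exists>K. hedgehog f \<alpha> K \<and> hedgehog g \<beta> K) \<longrightarrow> germs_commute f g)
       \<and> (same_hedgehog_germ f g \<longrightarrow> germs_commute f g)"
proof (intro conjI impI)
  have \<alpha>: "\<alpha> \<notin> \<rat>" and f0: "f 0 = 0" and df: "deriv f 0 = rot \<alpha>" and g0: "g 0 = 0"
    using assms by (simp_all add: nonlinearizable_def irrational_germ_def)
  have commute: "germs_commute f g" if "siegel_compact f K" "siegel_compact g K" for K
    using \<alpha> df f0 g0 that by (rule common_siegel_compact_commute)
  show "germs_commute f g" if "\<exists>K. hedgehog f \<alpha> K \<and> hedgehog g \<beta> K"
    using that commute by (auto simp: hedgehog_def)
  show "germs_commute f g" if same: "same_hedgehog_germ f g"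
  proof -
    obtain \<epsilon> where \<epsilon>: "\<epsilon> > 0" "\<And>K::complex set. compact K \<Longrightarrow> 0 \<in> K \<Longrightarrow> diameter K < \<epsilon> \<Longrightarrow>
        siegel_compact f K \<longleftrightarrow> siegel_compact g K"
      using same unfolding same_hedgehog_germ_def by blast
    obtain s where s: "s > 0" "f holomorphic_on ball 0 s"
      using assms(1) by (auto simp: nonlinearizable_def irrational_germ_def)
    \<comment> \<open>Equality of the germs speaks only about sets of small diameter, so a Siegel
      compact of \<open>f\<close> below the threshold is required; it is then shared by
      \<open>g\<close>.\<close>
    obtain K where K: "siegel_compact f K" "compact K" "0 \<in> K" "diameter K < \<epsilon>"
      by (rule small_siegel_compact_exists[OF s(2,1) f0 df \<epsilon>(1)])
    then show ?thesis using commute[OF K(1)] \<epsilon>(2)[OF K(2,3,4)] by simp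
  qed
qed

end
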